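(* Let $\mu$ be the Patterson–Sullivan measure for $F$. Then $\mu$-a.e. limit point is a $\Gamma$-Myrberg limit point. More specifically, for $\mu$-a.e. $\xi \in \Lambda F$, for each $g \in \Gamma$, there exists $h \in \Gamma$ such that the $13C$-neighborhood of $[x_0, \xi)$ contains $h [x_0, gx_0]$.
   Context: $\Gamma=\{\mathfrak{g}_1,\mathfrak{g}_2,\ldots\}$ (a fixed enumeration) is a non-elementary, non-convex-cocompact discrete group acting properly by isometries on $\mathbb{H}^d\ni x_0$ (non-elementary: limit set $\Lambda\Gamma$ has more than two points; convex-cocompact: for some $K'>0$ all geodesics $[gx_0,hx_0]$, $g,h\in\Gamma$, lie in the $K'$-neighborhood of $\Gamma x_0$). $\|g\|:=d(x_0,gx_0)$; $B_r:=\{g\in\Gamma:\|g\|<r\}$; $(x|y)_z=\frac12[d(x,z)+d(z,y)-d(x,y)]$; $\mathcal{P}_A(s)=\sum_{g\in A}e^{-s\|g\|}$ with abscissa of convergence $\delta_A$. $\mathcal{O}_{M,M}$ is the set of $g\in\Gamma$ for which there are $x,y\in\mathbb{H}^d$ with $d(x,x_0),d(y,gx_0)\le M$ and $d([x,y],\Gamma x_0)\ge M$. Fixed $a,b\in\Gamma$ satisfy $\|a^n\|,\|b^n\|\to+\infty$ as $n\to+\infty$ and $\|a\|\ge10^3\|b\|>10^6(3+\sup_{n,m\in\mathbb{Z}}(a^nx_0|b^mx_0)_{x_0})$, the supremum being finite. Put $C:=10^{-3}\|a\|$. An element $h\in\Gamma$ has Property (A) if there are $n\ge1$ and points $x_0=z_0,\ldots,z_n=hx_0$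 such that in the sequence $(a^{-1}x_0,z_0,\ldots,z_n,hax_0)$ consecutive points are at distance $\ge\|a\|$ and any three consecutive points $u,v,w$ satisfy $(u|w)_v\le10^{-6}\|a\|$. $\Phi:\Gamma\to\{g: g\text{ has Property (A)}\}$ is a fixed map with $\Phi(g)=g$ if $g$ has Property (A); otherwise $\Phi(g)$ is one of $bg,gb,bgb$ having Property (A) if $\|g\|\ge\|a\|$ (one of them always does), and $\Phi(g)=bab$ if $\|g\|<\|a\|$. Construction of $F$. For $S\subseteq\Gamma$ let $\langle S\rangle_a:=\{g_1ag_2a\cdots ag_n:n\ge1,g_i\in S\}$. Fix $0<\epsilon<1$. Take $r_0$ with $\#B_r\le\exp((1+0.001\epsilon)\delta_\Gamma r)$ for $r\ge r_0$, and $R_0>\frac{10^7(C+r_0)(1+\delta_\Gamma)}{\delta_\Gamma\epsilon}$ with $\#(B_{R_0}\cap\Phi(\Gamma))\ge\exp((1-0.001\epsilon)\delta_\Gamma R_0)$. Let $K$ be a maximal subset of $(B_{R_0}\cap\Phi(\Gamma))\setminus B_{(1-0.003\epsilon)R_0}$ such that $d(gx_0,hx_0)>0.004\epsilon R_0$ for distinct $g,h\in K$. Let $F_1=\langle K\rangle_a$, $\alpha_1=\delta_{F_1}$, and pick $\beta_1\in(\alpha_1,\alpha_1+0.5)$ with $\mathcal{P}_{F_1}(\beta_1)>2$. Inductively, for $k\ge1$, given $\varphi_1,\ldots,\varphi_{k-1}$, $F_k=\langle K\cup\{\varphi_1,\ldots,\varphi_{k-1}\}\rangle_a$ and $\beta_1>\cdots>\beta_k$,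 put $M_j=\mathcal{P}_{F_k}(\beta_j)$ and pick, for each $j\le k$, $\epsilon_j\in(0,1/2)$ with $2\epsilon_jM_j<1$ and $\frac{M_j+2\epsilon_j+4M_j\epsilon_j}{1-2\epsilon_jM_j}<(2-2^{j-k-1})\mathcal{P}_{F_j}(\beta_j)$; pick $R_k>100R_{k-1}$ with $K\cup\{\varphi_1,\ldots,\varphi_{k-1}\}\subseteq B_{R_k-10^4C}$ and $e^{-\beta_jR_k}\le\epsilon_j$ for all $j\le k$; pick $\phi_k\in\mathcal{O}_{10C,10C}\setminus B_{R_k+2500C}$; set $\varphi_k:=\Phi(\phi_k)\,a\,\Phi(\mathfrak{g}_k)$, $F_{k+1}:=\langle K\cup\{\varphi_1,\ldots,\varphi_k\}\rangle_a$, $\alpha_{k+1}:=\delta_{F_{k+1}}$, and pick $\beta_{k+1}\in(\alpha_{k+1},\min(\alpha_{k+1}+2^{-k-1},\beta_k))$ with $\mathcal{P}_{F_{k+1}}(\beta_{k+1})>2^{k+1}$. Finally $F:=\bigcup_kF_k=\langle K\cup\{\varphi_1,\varphi_2,\ldots\}\rangle_a$; one has $\mathcal{P}_F(\delta_F)=+\infty$. Patterson–Sullivan measure. For $s>\delta_F$ let $\mu_{x_0}^s=\frac{1}{\mathcal{P}_F(s)}\sum_{g\in F}e^{-s\|g\|}\mathrm{Dir}_{gx_0}$ ($\mathrm{Dir}$ = Dirac mass), a probability measure on the compact set $\Gamma x_0\cup\partial\mathbb{H}^d$. Choose $s_n\searrow\delta_F$ such that $\mu_{x_0}^{s_n}$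 converges weakly; the limit $\mu$ is called the Patterson–Sullivan measure for $F$. $\Lambda F\subseteq\partial\mathbb{H}^d$ is the set of accumulation points of $Fx_0$ in $\partial\mathbb{H}^d$. A point $\xi\in\Lambda\Gamma$ is $\Gamma$-Myrberg if the closure of the $\Gamma$-orbit of $[x_0,\xi)$ contains every geodesic connecting a pair of distinct points of $\Lambda\Gamma$; equivalently, if there exists $K'>0$ such that for every $g\in\Gamma$ there is $h\in\Gamma$ with $h[x_0,gx_0]$ contained in the $K'$-neighborhood of $[x_0,\xi)$. *)

theory Defs
  imports "HOL-Analysis.Analysis" "HOL-Algebra.Group_Action"
begin

section \<open>Hyperbolic space in the Beltrami--Klein model\<close>

text \<open>
  Hyperbolic \<open>d\<close>-space is the open unit ball of a Euclidean space of dimension \<open>d\<close>, with the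
  Beltrami--Klein metric.  Its boundary at infinity is the unit sphere, and the compactification by
  this boundary is the closed ball with the Euclidean topology; the metric topology on the
  open ball is the Euclidean one as well.  In this model the geodesics are exactly the straight
  chords.
\<close>

abbreviation hspace :: "'a::euclidean_space set"
  where "hspace \<equiv> ball 0 1"

abbreviation hboundary :: "'a::euclidean_space set"
  where "hboundary \<equiv> sphere 0 1"

definition hdist :: "'a::euclidean_space \<Rightarrow> 'a \<Rightarrow> real"
  where "hdist x y = arcosh ((1 - x \<bullet> y) / sqrt ((1 - (norm x)\<^sup>2) * (1 - (norm y)\<^sup>2)))"

definition geodesic_segment :: "'a::euclidean_space \<Rightarrow> 'a \<Rightarrow> 'a set"
  where "geodesic_segment x y = closed_segment x y"

definition geodesic_ray :: "'a::euclidean_space \<Rightarrow> 'a \<Rightarrow> 'a set"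
  where "geodesic_ray x \<xi> = closed_segment x \<xi> - {\<xi>}"

definition geodesic_line :: "'a::euclidean_space \<Rightarrow> 'a \<Rightarrow> 'a set"
  where "geodesic_line \<xi> \<eta> = open_segment \<xi> \<eta>"

definition hnbhd :: "real \<Rightarrow> 'a::euclidean_space set \<Rightarrow> 'a set"
  where "hnbhd r A = {z \<in> hspace. \<exists>y\<in>A. hdist z y < r}"

definition gromov_product :: "'a::euclidean_space \<Rightarrow> 'a \<Rightarrow> 'a \<Rightarrow> real"
  where "gromov_product z x y = (hdist x z + hdist z y - hdist x y) / 2"


section \<open>Orbits and Poincare series\<close>

definition disp :: "('g \<Rightarrow> 'a::euclidean_space \<Rightarrow> 'a) \<Rightarrow> 'a \<Rightarrow> 'g \<Rightarrow> real"
  where "disp act x\<^sub>0 g = hdist x\<^sub>0 (act g x\<^sub>0)"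

definition norm_ball ::
    "('g, 'm) monoid_scheme \<Rightarrow> ('g \<Rightarrow> 'a::euclidean_space \<Rightarrow> 'a) \<Rightarrow> 'a \<Rightarrow> real \<Rightarrow> 'g set"
  where "norm_ball G act x\<^sub>0 r = {g \<in> carrier G. disp act x\<^sub>0 g < r}"

definition poincare_series ::
    "('g \<Rightarrow> 'a::euclidean_space \<Rightarrow> 'a) \<Rightarrow> 'a \<Rightarrow> 'g set \<Rightarrow> real \<Rightarrow> ennreal"
  where "poincare_series act x\<^sub>0 A s = (\<Sum>\<^sub>\<infinity>g\<in>A. ennreal (exp (- s * disp act x\<^sub>0 g)))"

text \<open>
  The abscissa of convergence is taken over all real exponents.  As a real number it is meaningful
  for infinite \<open>A\<close> with at most exponential growth, which is the case of interest.
\<close>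
definition critical_exponent ::
    "('g \<Rightarrow> 'a::euclidean_space \<Rightarrow> 'a) \<Rightarrow> 'a \<Rightarrow> 'g set \<Rightarrow> real"
  where "critical_exponent act x\<^sub>0 A = Inf {s. poincare_series act x\<^sub>0 A s < \<infinity>}"

definition limit_set ::
    "('g \<Rightarrow> 'a::euclidean_space \<Rightarrow> 'a) \<Rightarrow> 'a \<Rightarrow> 'g set \<Rightarrow> 'a set"
  where "limit_set act x\<^sub>0 A = {\<xi> \<in> hboundary. \<xi> islimpt (\<lambda>g. act g x\<^sub>0) ` A}"


section \<open>Discrete groups of isometries\<close>

text \<open>
  The library's \<^locale>\<open>group_action\<close> requires each \<open>act g\<close> to be a bijection of hyperbolic space,
  extended by \<^const>\<open>undefined\<close> outside of it.
\<close>
locale proper_isometric_action = group_action G hspace act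
  for G :: "('g, 'm) monoid_scheme" (structure)
    and act :: "'g \<Rightarrow> 'a::euclidean_space \<Rightarrow> 'a" +
  fixes x\<^sub>0 :: 'a
  assumes base_point: "x\<^sub>0 \<in> hspace"
    and isometric: "\<lbrakk>g \<in> carrier G; x \<in> hspace; y \<in> hspace\<rbrakk>
          \<Longrightarrow> hdist (act g x) (act g y) = hdist x y"
    and proper: "\<lbrakk>L \<subseteq> hspace; compact L\<rbrakk> \<Longrightarrow> finite {g \<in> carrier G. act g ` L \<inter> L \<noteq> {}}"

definition non_elementary ::
    "('g, 'm) monoid_scheme \<Rightarrow> ('g \<Rightarrow> 'a::euclidean_space \<Rightarrow> 'a) \<Rightarrow> 'a \<Rightarrow> bool"
  where "non_elementary G act x\<^sub>0 \<longleftrightarrow>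
    (\<exists>\<xi> \<eta> \<zeta>. {\<xi>, \<eta>, \<zeta>} \<subseteq> limit_set act x\<^sub>0 (carrier G) \<and> \<xi> \<noteq> \<eta> \<and> \<eta> \<noteq> \<zeta> \<and> \<xi> \<noteq> \<zeta>)"

definition convex_cocompact ::
    "('g, 'm) monoid_scheme \<Rightarrow> ('g \<Rightarrow> 'a::euclidean_space \<Rightarrow> 'a) \<Rightarrow> 'a \<Rightarrow> bool"
  where "convex_cocompact G act x\<^sub>0 \<longleftrightarrow>
    (\<exists>K'>0. \<forall>g\<in>carrier G. \<forall>h\<in>carrier G.
       geodesic_segment (act g x\<^sub>0) (act h x\<^sub>0) \<subseteq> hnbhd K' (orbit G act x\<^sub>0))"

text \<open>
  Membership of a closed set \<open>L\<close> in the closure of the set of translates \<open>{h S | h}\<close>, with respect to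
  Hausdorff convergence on compact sets (the Chabauty--Fell topology on closed subsets of
  hyperbolic space).
\<close>
definition in_orbit_closure ::
    "('g, 'm) monoid_scheme \<Rightarrow> ('g \<Rightarrow> 'a::euclidean_space \<Rightarrow> 'a) \<Rightarrow> 'a set \<Rightarrow> 'a set \<Rightarrow> bool"
  where "in_orbit_closure G act S L \<longleftrightarrow>
    (\<forall>Q e. Q \<subseteq> hspace \<and> compact Q \<and> e > 0 \<longrightarrow>
      (\<exists>h\<in>carrier G. Q \<inter> L \<subseteq> hnbhd e (act h ` S) \<and> Q \<inter> act h ` S \<subseteq> hnbhd e L))"

definition myrberg ::
    "('g, 'm) monoid_scheme \<Rightarrow> ('g \<Rightarrow> 'a::euclidean_space \<Rightarrow> 'a) \<Rightarrow> 'a \<Rightarrow> 'a \<Rightarrow> bool"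
  where "myrberg G act x\<^sub>0 \<xi> \<longleftrightarrow>
    \<xi> \<in> limit_set act x\<^sub>0 (carrier G) \<and>
    (\<forall>\<eta>\<in>limit_set act x\<^sub>0 (carrier G). \<forall>\<zeta>\<in>limit_set act x\<^sub>0 (carrier G). \<eta> \<noteq> \<zeta> \<longrightarrow>
       in_orbit_closure G act (geodesic_ray x\<^sub>0 \<xi>) (geodesic_line \<eta> \<zeta>))"


section \<open>Ingredients of the construction\<close>

definition outside_orbit ::
    "('g, 'm) monoid_scheme \<Rightarrow> ('g \<Rightarrow> 'a::euclidean_space \<Rightarrow> 'a) \<Rightarrow> 'a \<Rightarrow> real \<Rightarrow> 'g set"
  where "outside_orbit G act x\<^sub>0 M = {g \<in> carrier G.
    \<exists>x\<in>hspace. \<exists>y\<in>hspace. hdist x x\<^sub>0 \<le> M \<and> hdist y (act g x\<^sub>0) \<le> M \<and>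
      (\<forall>z\<in>geodesic_segment x y. \<forall>p\<in>orbit G act x\<^sub>0. M \<le> hdist z p)}"

text \<open>Here \<open>zs\<close> lists the points \<open>z\<^sub>0, \<dots>, z\<^sub>n\<close>.\<close>
definition property_A ::
    "('g, 'm) monoid_scheme \<Rightarrow> ('g \<Rightarrow> 'a::euclidean_space \<Rightarrow> 'a) \<Rightarrow> 'a \<Rightarrow> 'g \<Rightarrow> 'g \<Rightarrow> bool"
  where "property_A G act x\<^sub>0 a h \<longleftrightarrow> h \<in> carrier G \<and>
    (\<exists>zs ps. length zs \<ge> 2 \<and> set zs \<subseteq> hspace \<and> hd zs = x\<^sub>0 \<and> last zs = act h x\<^sub>0 \<and>
      ps = act (inv\<^bsub>G\<^esub> a) x\<^sub>0 # zs @ [act (h \<otimes>\<^bsub>G\<^esub> a) x\<^sub>0] \<and>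
      (\<forall>i. i + 1 < length ps \<longrightarrow> disp act x\<^sub>0 a \<le> hdist (ps ! i) (ps ! (i + 1))) \<and>
      (\<forall>i. i + 2 < length ps \<longrightarrow>
         gromov_product (ps ! (i + 1)) (ps ! i) (ps ! (i + 2)) \<le> disp act x\<^sub>0 a / 10 ^ 6))"

text \<open>The products \<open>g\<^sub>1 a g\<^sub>2 a \<dots> a g\<^sub>n\<close> with \<open>n \<ge> 1\<close> and all \<open>g\<^sub>i\<close> in \<open>S\<close>.\<close>
inductive_set a_products :: "('g, 'm) monoid_scheme \<Rightarrow> 'g \<Rightarrow> 'g set \<Rightarrow> 'g set"
  for G (structure) and a and S
  where
    single: "g \<in> S \<Longrightarrow> g \<in> a_products G a S"
  | step: "\<lbrakk>g \<in> S; w \<in> a_products G a S\<rbrakk> \<Longrightarrow> g \<otimes> a \<otimes> w \<in> a_products G a S"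

definition separated :: "('g \<Rightarrow> 'a::euclidean_space \<Rightarrow> 'a) \<Rightarrow> 'a \<Rightarrow> real \<Rightarrow> 'g set \<Rightarrow> bool"
  where "separated act x\<^sub>0 r A \<longleftrightarrow>
    (\<forall>g\<in>A. \<forall>h\<in>A. g \<noteq> h \<longrightarrow> r < hdist (act g x\<^sub>0) (act h x\<^sub>0))"


section \<open>The construction of \<open>F\<close>\<close>

locale property_A_setting = proper_isometric_action G act x\<^sub>0
  for G :: "('g, 'm) monoid_scheme" (structure)
    and act :: "'g \<Rightarrow> 'a::euclidean_space \<Rightarrow> 'a" and x\<^sub>0 :: 'a +
  fixes gam :: "nat \<Rightarrow> 'g" \<comment> \<open>the enumeration of \<open>\<Gamma>\<close>, with indices starting from 1\<close>
    and a b :: 'g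
    and C :: real
    and \<Phi> :: "'g \<Rightarrow> 'g"
  assumes non_elementary: "non_elementary G act x\<^sub>0"
    and not_convex_cocompact: "\<not> convex_cocompact G act x\<^sub>0"
    and enumeration: "gam ` {1..} = carrier G"
    and a_in: "a \<in> carrier G" and b_in: "b \<in> carrier G"
    and a_unbounded: "filterlim (\<lambda>n::nat. disp act x\<^sub>0 (a [^] n)) at_top sequentially"
    and b_unbounded: "filterlim (\<lambda>n::nat. disp act x\<^sub>0 (b [^] n)) at_top sequentially"
    and a_b_bounded: "bdd_above (range (\<lambda>(n::int, m::int).
          gromov_product x\<^sub>0 (act (a [^] n) x\<^sub>0) (act (b [^] m) x\<^sub>0)))"
    and a_large: "disp act x\<^sub>0 a \<ge> 10 ^ 3 * disp act x\<^sub>0 b"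
    and b_large: "10 ^ 3 * disp act x\<^sub>0 b > 10 ^ 6 * (3 + (SUP (n::int, m::int).
          gromov_product x\<^sub>0 (act (a [^] n) x\<^sub>0) (act (b [^] m) x\<^sub>0)))"
    and C_eq: "C = disp act x\<^sub>0 a / 10 ^ 3"
    and \<Phi>_A: "g \<in> carrier G \<Longrightarrow> property_A G act x\<^sub>0 a (\<Phi> g)"
    and \<Phi>_id: "property_A G act x\<^sub>0 a g \<Longrightarrow> \<Phi> g = g"
    and \<Phi>_long: "\<lbrakk>g \<in> carrier G; \<not> property_A G act x\<^sub>0 a g; disp act x\<^sub>0 g \<ge> disp act x\<^sub>0 a\<rbrakk>
          \<Longrightarrow> \<Phi> g \<in> {b \<otimes> g, g \<otimes> b, b \<otimes> g \<otimes> b}"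
    and \<Phi>_short: "\<lbrakk>g \<in> carrier G; \<not> property_A G act x\<^sub>0 a g; disp act x\<^sub>0 g < disp act x\<^sub>0 a\<rbrakk>
          \<Longrightarrow> \<Phi> g = b \<otimes> a \<otimes> b"

text \<open>
  \<open>R 0\<close> is \<open>R\<^sub>0\<close>, and \<open>eps k j\<close> is the number \<open>\<epsilon>\<^sub>j\<close> picked at stage \<open>k\<close>.  At stage \<open>k\<close> an element
  \<open>\<phi> k\<close> is picked in \<^const>\<open>outside_orbit\<close>, and \<open>gen k\<close> is the generator obtained from it and added
  to the generators of \<open>Fs k\<close>.  The values of \<open>eps\<close>, \<open>\<phi>\<close>, \<open>gen\<close>, \<open>\<beta>\<close>, \<open>Fs\<close> at stage 0 are irrelevant.
  The numbers \<open>\<alpha>\<^sub>k\<close> and \<open>M\<^sub>j\<close> of stage \<open>k\<close> are written as \<open>critical_exponent act x\<^sub>0 (Fs k)\<close> and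
  \<open>poincare_series act x\<^sub>0 (Fs k) (\<beta> j)\<close>; the conditions on \<open>M\<^sub>j\<close> are stated in \<^typ>\<open>ennreal\<close>, where the
  first of them forces \<open>M\<^sub>j\<close> to be finite.
\<close>
locale F_construction = property_A_setting G act x\<^sub>0 gam a b C \<Phi>
  for G :: "('g, 'm) monoid_scheme" (structure)
    and act :: "'g \<Rightarrow> 'a::euclidean_space \<Rightarrow> 'a" and x\<^sub>0 :: 'a
    and gam :: "nat \<Rightarrow> 'g" and a b :: 'g and C :: real and \<Phi> :: "'g \<Rightarrow> 'g" +
  fixes \<epsilon> r\<^sub>0 :: real
    and R :: "nat \<Rightarrow> real"
    and K :: "'g set"
    and \<beta> :: "nat \<Rightarrow> real"
    and eps :: "nat \<Rightarrow> nat \<Rightarrow> real"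
    and \<phi> gen :: "nat \<Rightarrow> 'g"
    and Fs :: "nat \<Rightarrow> 'g set"
    and F :: "'g set"
  assumes \<epsilon>_range: "0 < \<epsilon>" "\<epsilon> < 1"
    and r\<^sub>0: "r \<ge> r\<^sub>0 \<Longrightarrow> real (card (norm_ball G act x\<^sub>0 r))
          \<le> exp ((1 + \<epsilon> / 1000) * critical_exponent act x\<^sub>0 (carrier G) * r)"
    and R\<^sub>0_large: "R 0 > 10 ^ 7 * (C + r\<^sub>0) * (1 + critical_exponent act x\<^sub>0 (carrier G))
          / (critical_exponent act x\<^sub>0 (carrier G) * \<epsilon>)"
    and R\<^sub>0_count: "real (card (norm_ball G act x\<^sub>0 (R 0) \<inter> \<Phi> ` carrier G))
          \<ge> exp ((1 - \<epsilon> / 1000) * critical_exponent act x\<^sub>0 (carrier G) * R 0)"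
    and K_sub: "K \<subseteq> (norm_ball G act x\<^sub>0 (R 0) \<inter> \<Phi> ` carrier G)
          - norm_ball G act x\<^sub>0 ((1 - 3 * \<epsilon> / 1000) * R 0)"
    and K_separated: "separated act x\<^sub>0 (4 * \<epsilon> / 1000 * R 0) K"
    and K_maximal: "\<lbrakk>K \<subseteq> K'; separated act x\<^sub>0 (4 * \<epsilon> / 1000 * R 0) K';
          K' \<subseteq> (norm_ball G act x\<^sub>0 (R 0) \<inter> \<Phi> ` carrier G)
            - norm_ball G act x\<^sub>0 ((1 - 3 * \<epsilon> / 1000) * R 0)\<rbrakk> \<Longrightarrow> K' = K"
    and Fs_eq: "k \<ge> 1 \<Longrightarrow> Fs k = a_products G a (K \<union> gen ` {1..<k})"
    and \<beta>_1: "critical_exponent act x\<^sub>0 (Fs 1) < \<beta> 1"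
          "\<beta> 1 < critical_exponent act x\<^sub>0 (Fs 1) + 1 / 2"
          "poincare_series act x\<^sub>0 (Fs 1) (\<beta> 1) > 2"
    and eps_range: "\<lbrakk>1 \<le> j; j \<le> k\<rbrakk> \<Longrightarrow> 0 < eps k j \<and> eps k j < 1 / 2"
    and eps_M: "\<lbrakk>1 \<le> j; j \<le> k\<rbrakk> \<Longrightarrow>
          2 * ennreal (eps k j) * poincare_series act x\<^sub>0 (Fs k) (\<beta> j) < 1"
    and eps_quotient: "\<lbrakk>1 \<le> j; j \<le> k\<rbrakk> \<Longrightarrow>
          (poincare_series act x\<^sub>0 (Fs k) (\<beta> j) + 2 * ennreal (eps k j)
             + 4 * poincare_series act x\<^sub>0 (Fs k) (\<beta> j) * ennreal (eps k j))
          / (1 - 2 * ennreal (eps k j) * poincare_series act x\<^sub>0 (Fs k) (\<beta> j))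
          < ennreal (2 - 1 / 2 ^ (k + 1 - j)) * poincare_series act x\<^sub>0 (Fs j) (\<beta> j)"
    and R_growth: "k \<ge> 1 \<Longrightarrow> R k > 100 * R (k - 1)"
    and R_gens: "k \<ge> 1 \<Longrightarrow> K \<union> gen ` {1..<k} \<subseteq> norm_ball G act x\<^sub>0 (R k - 10 ^ 4 * C)"
    and R_eps: "\<lbrakk>1 \<le> j; j \<le> k\<rbrakk> \<Longrightarrow> exp (- \<beta> j * R k) \<le> eps k j"
    and \<phi>: "k \<ge> 1 \<Longrightarrow> \<phi> k \<in> outside_orbit G act x\<^sub>0 (10 * C)
          - norm_ball G act x\<^sub>0 (R k + 2500 * C)"
    and gen_eq: "k \<ge> 1 \<Longrightarrow> gen k = \<Phi> (\<phi> k) \<otimes> a \<otimes> \<Phi> (gam k)"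
    and \<beta>_Suc: "k \<ge> 1 \<Longrightarrow> critical_exponent act x\<^sub>0 (Fs (k + 1)) < \<beta> (k + 1) \<and>
          \<beta> (k + 1) < min (critical_exponent act x\<^sub>0 (Fs (k + 1)) + 1 / 2 ^ (k + 1)) (\<beta> k) \<and>
          poincare_series act x\<^sub>0 (Fs (k + 1)) (\<beta> (k + 1)) > 2 ^ (k + 1)"
    and F_eq: "F = (\<Union>k\<in>{1..}. Fs k)"


section \<open>Patterson--Sullivan measures\<close>

definition orbit_compactification ::
    "('g, 'm) monoid_scheme \<Rightarrow> ('g \<Rightarrow> 'a::euclidean_space \<Rightarrow> 'a) \<Rightarrow> 'a \<Rightarrow> 'a set"
  where "orbit_compactification G act x\<^sub>0 = orbit G act x\<^sub>0 \<union> hboundary"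

text \<open>The push-forward under the orbit map of the weights \<open>g \<mapsto> e\<^bsup>-s\<parallel>g\<parallel>\<^esup> / P\<^sub>A(s)\<close> on \<open>A\<close>.\<close>
definition approximating_measure ::
    "('g, 'm) monoid_scheme \<Rightarrow> ('g \<Rightarrow> 'a::euclidean_space \<Rightarrow> 'a) \<Rightarrow> 'a \<Rightarrow> 'g set \<Rightarrow> real \<Rightarrow> 'a measure"
  where "approximating_measure G act x\<^sub>0 A s =
    distr (point_measure A (\<lambda>g. ennreal (exp (- s * disp act x\<^sub>0 g)) / poincare_series act x\<^sub>0 A s))
      (restrict_space borel (orbit_compactification G act x\<^sub>0)) (\<lambda>g. act g x\<^sub>0)"

text \<open>
  A limit may depend on the chosen sequence of exponents; \<open>\<mu>\<close> is any of them.  Weak convergence is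
  tested against the continuous functions on the compact set on which the measures live.
\<close>
definition patterson_sullivan_measure ::
    "('g, 'm) monoid_scheme \<Rightarrow> ('g \<Rightarrow> 'a::euclidean_space \<Rightarrow> 'a) \<Rightarrow> 'a \<Rightarrow> 'g set \<Rightarrow> 'a measure \<Rightarrow> bool"
  where "patterson_sullivan_measure G act x\<^sub>0 A \<mu> \<longleftrightarrow>
    sets \<mu> = sets (restrict_space borel (orbit_compactification G act x\<^sub>0)) \<and>
    emeasure \<mu> (space \<mu>) = 1 \<and>
    (\<exists>s :: nat \<Rightarrow> real. decseq s \<and> (\<forall>n. s n > critical_exponent act x\<^sub>0 A) \<and>
      s \<longlonglongrightarrow> critical_exponent act x\<^sub>0 A \<and>
      (\<forall>f :: 'a \<Rightarrow> real. continuous_on (orbit_compactification G act x\<^sub>0) f \<longrightarrow>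
        (\<lambda>n. integral\<^sup>L (approximating_measure G act x\<^sub>0 A (s n)) f) \<longlonglongrightarrow> integral\<^sup>L \<mu> f))"

end

theory Submission
  imports Defs
begin

text \<open>
  Elements of \<open>F\<close> spell out local quasi-geodesics: the orbit points at which one letter ends and the
  next begins lie close to the geodesic from \<open>x\<^sub>0\<close>, and norms are almost additive along a word.  Fix a
  generator \<open>gen k\<close>.  Since \<open>\<phi> k\<close> stays away from the orbit for a long time, the first
  occurrence of \<open>gen k\<close> in a word is determined by the spelled element up to bounded error, so
  \<open>(v, u) \<mapsto> v gen\<^sub>k a u\<close> is boundedly-many-to-one on pairs in which \<open>v\<close> avoids
  \<open>gen k\<close>.  Hence the Poincare series of the words that avoid \<open>gen k\<close> stays bounded as
  \<open>s\<close> decreases to the critical exponent, while that of \<open>F\<close> diverges, and \<open>\<mu>\<close> is carried by the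
  limits of words that contain \<open>gen k\<close>.  Geodesics towards such limits pass along a translate
  of \<open>[x\<^sub>0, g x\<^sub>0]\<close> where \<open>g\<close> is the \<open>k\<close>-th element of the enumeration.

  Freeness of \<open>F\<close> is not available: \<open>r\<^sub>0\<close> may be negative, and then the lower bound on \<open>R 0\<close>
  does not make the separation constant of \<open>K\<close> large.
\<close>

section \<open>Metric geometry of the Klein model\<close>

text \<open>The measure \<open>\<mu>\<close> is only a weak limit, which controls closed sets,
  whereas the elements containing \<open>gen k\<close> fall into infinitely many cylinders, one for
  each prefix \<open>v\<close> in front of the first \<open>gen k\<close>, and their union need not
  be closed. The multiplicity bound helps because the series of \<open>F\<close> stands on both
  sides: the product of the series of \<open>Pre k\<close> and of \<open>F\<close> is at most a
  constant times the series of \<open>F\<close>. Cancelling this finite factor bounds the series of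
  \<open>Pre k\<close> for s > \<delta>, hence also at \<delta>. A convergent series has a small
  tail, so finitely many cylinders, whose union is closed, carry all mass but \<eta>; the remaining
  bounded terms vanish after division by the diverging series of \<open>F\<close>. Finiteness at
  \<open>\<beta> j\<close> and divergence at \<delta> come from \<open>eps\<close>: adding
  \<open>gen k\<close> leads to a recursive inequality for the series, whose solution is the
  quotient in \<open>eps_quotient\<close>. Fixing the prefix also serves the geometry: the translate
  of the segment from \<open>x\<^sub>0\<close> to \<open>g x\<^sub>0\<close> then depends on
  \<open>v\<close> alone and stays put while the endpoints tend to \<xi>.\<close>

lemma one_minus_norm_sq_pos:
  fixes x :: "'a::euclidean_space"
  assumes "x \<in> hspace" shows "0 < 1 - (norm x)\<^sup>2"
  using assms by (simp add: abs_square_less_1)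

lemma klein_denom_pos:
  fixes x y :: "'a::euclidean_space"
  assumes "x \<in> hspace" "y \<in> hspace"
  shows "0 < sqrt ((1 - (norm x)\<^sup>2) * (1 - (norm y)\<^sup>2))"
  using one_minus_norm_sq_pos[OF assms(1)] one_minus_norm_sq_pos[OF assms(2)]
  by (simp only: real_sqrt_gt_0_iff mult_pos_pos)

text \<open>The reverse Cauchy-Schwarz inequality for the Lorentz form at \<open>(1, x)\<close> and
  \<open>(1, y)\<close>; it puts the argument of \<open>arcosh\<close> into the range where
  \<open>cosh\<close> inverts it.\<close>

lemma klein_form_ge:
  fixes x y :: "'a::euclidean_space"
  assumes "x \<in> hspace" "y \<in> hspace"
  shows "sqrt ((1 - (norm x)\<^sup>2) * (1 - (norm y)\<^sup>2)) \<le> 1 - x \<bullet> y"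
proof -
  have xy: "x \<bullet> y \<le> norm x * norm y" by (rule norm_cauchy_schwarz)
  have "norm x < 1" "norm y < 1" using assms by auto
  hence "norm x * norm y \<le> 1 * 1" by (intro mult_mono) auto
  hence "norm x * norm y \<le> 1" by simp
  have "(1 - (norm x)\<^sup>2) * (1 - (norm y)\<^sup>2) = (1 - norm x * norm y)\<^sup>2 - (norm x - norm y)\<^sup>2"
    by (simp add: power2_eq_square algebra_simps)
  also have "\<dots> \<le> (1 - norm x * norm y)\<^sup>2" by simp
  finally have "sqrt ((1 - (norm x)\<^sup>2) * (1 - (norm y)\<^sup>2)) \<le> 1 - norm x * norm y"
    using \<open>norm x * norm y \<le> 1\<close> by (intro real_le_lsqrt) auto
  with xy show ?thesis by linarith
qed

lemma klein_form_pos: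
  fixes x y :: "'a::euclidean_space"
  assumes "x \<in> hspace" "y \<in> hspace"
  shows "0 < 1 - x \<bullet> y"
  using klein_form_ge[OF assms] one_minus_norm_sq_pos[OF assms(1)] one_minus_norm_sq_pos[OF assms(2)]
  by (smt (verit) mult_pos_pos real_sqrt_gt_zero)

lemma cosh_hdist:
  fixes x y :: "'a::euclidean_space"
  assumes "x \<in> hspace" "y \<in> hspace"
  shows "cosh (hdist x y) = (1 - x \<bullet> y) / sqrt ((1 - (norm x)\<^sup>2) * (1 - (norm y)\<^sup>2))"
proof -
  have "0 < sqrt ((1 - (norm x)\<^sup>2) * (1 - (norm y)\<^sup>2))"
    by (rule klein_denom_pos[OF assms])
  hence "1 \<le> (1 - x \<bullet> y) / sqrt ((1 - (norm x)\<^sup>2) * (1 - (norm y)\<^sup>2))"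
    using klein_form_ge[OF assms] by simp
  thus ?thesis unfolding hdist_def by (rule cosh_arcosh_real)
qed

lemma hdist_nonneg:
  fixes x y :: "'a::euclidean_space"
  assumes "x \<in> hspace" "y \<in> hspace"
  shows "0 \<le> hdist x y"
proof -
  have "0 < sqrt ((1 - (norm x)\<^sup>2) * (1 - (norm y)\<^sup>2))"
    by (rule klein_denom_pos[OF assms])
  hence "1 \<le> (1 - x \<bullet> y) / sqrt ((1 - (norm x)\<^sup>2) * (1 - (norm y)\<^sup>2))"
    using klein_form_ge[OF assms] by simp
  thus ?thesis unfolding hdist_def by simp
qed

lemma hdist_commute: "hdist x y = hdist y x"
  by (simp add: hdist_def inner_commute mult.commute)

lemma cosh_le_cosh_iff: "0 \<le> x \<Longrightarrow> 0 \<le> y \<Longrightarrow> cosh x \<le> cosh y \<longleftrightarrow> x \<le> (y::real)"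
  using cosh_real_nonneg_le_iff by auto

lemma cosh_eq_cosh_iff: "0 \<le> x \<Longrightarrow> 0 \<le> y \<Longrightarrow> cosh x = cosh y \<longleftrightarrow> x = (y::real)"
  by (metis cosh_le_cosh_iff nle_le order_refl)

lemma hdist_refl [simp]: "x \<in> hspace \<Longrightarrow> hdist x x = 0"
proof -
  assume x: "x \<in> hspace"
  have "cosh (hdist x x) = cosh 0"
    using one_minus_norm_sq_pos[OF x] cosh_hdist[OF x x] by (simp add: dot_square_norm)
  thus ?thesis using cosh_eq_cosh_iff[of "hdist x x" 0] hdist_nonneg[OF x x] by simp
qed

text \<open>
  The Lorentz form is negative definite on the Lorentz complement of \<open>(1, y)\<close>; \<open>klein_inner y\<close> is its
  negative in the coordinates of the spatial component.
\<close>
definition klein_inner :: "'a::euclidean_space \<Rightarrow> 'a \<Rightarrow> 'a \<Rightarrow> real"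
  where "klein_inner y p q = p \<bullet> q - (p \<bullet> y) * (q \<bullet> y)"

lemma klein_inner_scaleR [simp]:
  "klein_inner y (r *\<^sub>R p) q = r * klein_inner y p q"
  "klein_inner y p (r *\<^sub>R q) = r * klein_inner y p q"
  by (simp_all add: klein_inner_def algebra_simps)

lemma klein_inner_diff:
  "klein_inner y (p - p') q = klein_inner y p q - klein_inner y p' q"
  "klein_inner y q (p - p') = klein_inner y q p - klein_inner y q p'"
  by (simp_all add: klein_inner_def algebra_simps)

lemma klein_inner_commute: "klein_inner y p q = klein_inner y q p"
  by (simp add: klein_inner_def inner_commute)

lemma klein_inner_self_ge:
  "(1 - (norm y)\<^sup>2) * (norm p)\<^sup>2 \<le> klein_inner y p p"
proof -
  have "(p \<bullet> y)\<^sup>2 \<le> (p \<bullet> p) * (y \<bullet> y)" by (rule Cauchy_Schwarz_ineq)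
  thus ?thesis
    unfolding klein_inner_def power2_norm_eq_inner by (simp add: power2_eq_square algebra_simps)
qed

lemma klein_inner_self_nonneg:
  assumes "y \<in> hspace" shows "0 \<le> klein_inner y p p"
  using klein_inner_self_ge[of y p] one_minus_norm_sq_pos[OF assms]
  by (smt (verit) mult_nonneg_nonneg zero_le_power2)

lemma klein_inner_self_eq_0:
  assumes "y \<in> hspace" "klein_inner y p p = 0" shows "p = 0"
  using klein_inner_self_ge[of y p] one_minus_norm_sq_pos[OF assms(1)] assms(2)
  by (smt (verit) mult_pos_pos norm_eq_zero zero_less_power2)

text \<open>The vector is the component of \<open>p\<close> orthogonal to \<open>q\<close>, scaled
  to avoid division. Cauchy-Schwarz and its equality case are both read off from this
  identity.\<close>

lemma klein_inner_expand:
  "klein_inner y (klein_inner y q q *\<^sub>R p - klein_inner y p q *\<^sub>R q)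
                 (klein_inner y q q *\<^sub>R p - klein_inner y p q *\<^sub>R q)
   = klein_inner y q q * (klein_inner y p p * klein_inner y q q - (klein_inner y p q)\<^sup>2)"
  by (simp add: klein_inner_diff klein_inner_commute[of y q p] power2_eq_square algebra_simps)

lemma klein_inner_Cauchy_Schwarz:
  assumes y: "y \<in> hspace"
  shows "(klein_inner y p q)\<^sup>2 \<le> klein_inner y p p * klein_inner y q q"
proof (cases "klein_inner y q q = 0")
  case True
  hence "q = 0" using klein_inner_self_eq_0[OF y] by simp
  thus ?thesis by (simp add: klein_inner_def)
next
  case False
  hence pos: "0 < klein_inner y q q" using klein_inner_self_nonneg[OF y, of q] by linarith
  show ?thesis
    using klein_inner_expand[of y q p] klein_inner_self_nonneg[OF y] pos
    by (metis diff_ge_0_iff_ge zero_le_mult_iff less_le_not_le)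
qed

lemma klein_inner_Cauchy_Schwarz_eq:
  assumes y: "y \<in> hspace" and "(klein_inner y p q)\<^sup>2 = klein_inner y p p * klein_inner y q q"
  shows "klein_inner y q q *\<^sub>R p = klein_inner y p q *\<^sub>R q"
  using klein_inner_expand[of y q p] assms klein_inner_self_eq_0[OF y] by fastforce

text \<open>The spatial part of the Lorentz projection of the unit vector over \<open>x\<close> to the complement of \<open>y\<close>.\<close>
definition klein_proj :: "'a::euclidean_space \<Rightarrow> 'a \<Rightarrow> 'a"
  where "klein_proj y x = (1 / sqrt (1 - (norm x)\<^sup>2)) *\<^sub>R x
     - (cosh (hdist x y) / sqrt (1 - (norm y)\<^sup>2)) *\<^sub>R y"

text \<open>The right side is the time coordinate of the projected vector; the identity expresses
  its Lorentz orthogonality to \<open>(1, y)\<close>.\<close>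

lemma klein_proj_inner:
  fixes x y :: "'a::euclidean_space"
  assumes "x \<in> hspace" "y \<in> hspace"
  shows "klein_proj y x \<bullet> y =
    1 / sqrt (1 - (norm x)\<^sup>2) - cosh (hdist x y) / sqrt (1 - (norm y)\<^sup>2)"
proof -
  define u v where "u = sqrt (1 - (norm x)\<^sup>2)" and "v = sqrt (1 - (norm y)\<^sup>2)"
  have uv: "u > 0" "v > 0" "v\<^sup>2 = 1 - (norm y)\<^sup>2"
    using one_minus_norm_sq_pos[OF assms(1)] one_minus_norm_sq_pos[OF assms(2)]
    by (auto simp: u_def v_def)
  have c: "cosh (hdist x y) = (1 - x \<bullet> y) / (u * v)"
    using cosh_hdist[OF assms] by (simp add: u_def v_def real_sqrt_mult)
  have yy: "y \<bullet> y = 1 - v\<^sup>2" using uv(3) by (simp add: power2_norm_eq_inner)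
  show ?thesis
    unfolding klein_proj_def u_def[symmetric] v_def[symmetric] c
    using uv(1,2) by (simp add: inner_diff_left yy field_simps power2_eq_square)
qed

text \<open>The hyperbolic law of cosines at \<open>y\<close>: the projections have lengths
  \<open>sinh\<close> of the two sides, so the left side is the product of these lengths and the
  cosine of the angle.\<close>

lemma klein_inner_proj:
  fixes x y z :: "'a::euclidean_space"
  assumes "x \<in> hspace" "y \<in> hspace" "z \<in> hspace"
  shows "klein_inner y (klein_proj y x) (klein_proj y z) =
    cosh (hdist x y) * cosh (hdist y z) - cosh (hdist x z)"
proof -
  define u v w where "u = 1 / sqrt (1 - (norm x)\<^sup>2)" and "v = 1 / sqrt (1 - (norm y)\<^sup>2)"
    and "w = 1 / sqrt (1 - (norm z)\<^sup>2)"
  have pos: "u > 0" "v > 0" "w > 0"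
    using one_minus_norm_sq_pos assms by (auto simp: u_def v_def w_def)
  have v2: "v\<^sup>2 * (1 - y \<bullet> y) = 1"
    using one_minus_norm_sq_pos[OF assms(2)]
    by (simp add: v_def power_divide flip: power2_norm_eq_inner)
  define c d where "c = cosh (hdist x y)" and "d = cosh (hdist y z)"
  have c: "c = u * v * (1 - x \<bullet> y)" and d: "d = v * w * (1 - z \<bullet> y)"
    and e: "cosh (hdist x z) = u * w * (1 - x \<bullet> z)"
    using cosh_hdist assms
    by (simp_all add: c_def d_def u_def v_def w_def real_sqrt_mult inner_commute)
  have px: "klein_proj y x = u *\<^sub>R x - (c * v) *\<^sub>R y" and pz: "klein_proj y z = w *\<^sub>R z - (d * v) *\<^sub>R y"
    by (simp_all add: klein_proj_def u_def v_def w_def c_def d_def hdist_commute)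
  have ix: "klein_proj y x \<bullet> y = u - c * v" and iz: "klein_proj y z \<bullet> y = w - d * v"
    using klein_proj_inner[OF assms(1,2)] klein_proj_inner[OF assms(3,2)]
    by (simp_all add: u_def v_def w_def c_def d_def hdist_commute)
  have pp: "klein_proj y x \<bullet> klein_proj y z =
      u * w * (x \<bullet> z) - d * v * u * (x \<bullet> y) - c * v * w * (z \<bullet> y) + c * d * (v\<^sup>2 * (y \<bullet> y))"
    unfolding px pz by (simp add: inner_diff_left inner_diff_right inner_commute power2_eq_square algebra_simps)
  have v2': "v\<^sup>2 * (y \<bullet> y) = v\<^sup>2 - 1" using v2 by (simp add: algebra_simps)
  have dx: "d * v * u * (x \<bullet> y) = d * v * u - d * c" unfolding c by (simp add: algebra_simps)
  have cz: "c * v * w * (z \<bullet> y) = c * v * w - c * d" unfolding d by (simp add: algebra_simps)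
  have "klein_inner y (klein_proj y x) (klein_proj y z) =
     u * w * (x \<bullet> z) - (d * v * u - d * c) - (c * v * w - c * d) + c * d * (v\<^sup>2 - 1) - (u - c * v) * (w - d * v)"
    unfolding klein_inner_def pp ix iz v2' dx cz by simp
  also have "\<dots> = c * d - u * w * (1 - x \<bullet> z)"
    by (simp add: power2_eq_square algebra_simps)
  finally show ?thesis by (simp add: e c_def d_def)
qed

lemma klein_inner_proj_self:
  fixes x y :: "'a::euclidean_space"
  assumes "x \<in> hspace" "y \<in> hspace"
  shows "klein_inner y (klein_proj y x) (klein_proj y x) = (sinh (hdist x y))\<^sup>2"
  using klein_inner_proj[OF assms(1,2,1)] assms
  by (simp add: hdist_commute[of y x] sinh_square_eq) (simp add: power2_eq_square)

lemma sinh_hdist_nonneg: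
  "x \<in> hspace \<Longrightarrow> y \<in> hspace \<Longrightarrow> 0 \<le> sinh (hdist x y)"
  using hdist_nonneg by simp

text \<open>Cauchy-Schwarz in the law of cosines bounds the \<open>cosh\<close> of the third side by
  the addition formula for the sum of the other two.\<close>

lemma hdist_triangle:
  fixes x y z :: "'a::euclidean_space"
  assumes "x \<in> hspace" "y \<in> hspace" "z \<in> hspace"
  shows "hdist x z \<le> hdist x y + hdist y z"
proof -
  have "(cosh (hdist x y) * cosh (hdist y z) - cosh (hdist x z))\<^sup>2
      \<le> (sinh (hdist x y) * sinh (hdist y z))\<^sup>2"
    using klein_inner_Cauchy_Schwarz[OF assms(2), of "klein_proj y x" "klein_proj y z"]
    unfolding klein_inner_proj[OF assms] klein_inner_proj_self[OF assms(1,2)]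
      klein_inner_proj_self[OF assms(3,2)]
    by (simp add: power_mult_distrib hdist_commute[of z y])
  hence "\<bar>cosh (hdist x y) * cosh (hdist y z) - cosh (hdist x z)\<bar> \<le> sinh (hdist x y) * sinh (hdist y z)"
    using sinh_hdist_nonneg[OF assms(1,2)] sinh_hdist_nonneg[OF assms(2,3)]
    by (metis abs_le_square_iff abs_of_nonneg mult_nonneg_nonneg)
  hence "cosh (hdist x z) \<le> cosh (hdist x y + hdist y z)"
    by (simp add: cosh_add)
  thus ?thesis using cosh_le_cosh_iff hdist_nonneg assms by (metis add_nonneg_nonneg)
qed

lemma hdist_eq_0:
  fixes x y :: "'a::euclidean_space"
  assumes "x \<in> hspace" "y \<in> hspace" "hdist x y = 0"
  shows "x = y"
proof -
  have "klein_inner y (klein_proj y x) (klein_proj y x) = 0"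
    using klein_inner_proj_self[OF assms(1,2)] assms(3) by simp
  hence p: "klein_proj y x = 0" using klein_inner_self_eq_0 assms by blast
  hence "1 / sqrt (1 - (norm x)\<^sup>2) = 1 / sqrt (1 - (norm y)\<^sup>2)"
    using klein_proj_inner[OF assms(1,2)] assms(3) by simp
  moreover have "1 / sqrt (1 - (norm x)\<^sup>2) \<noteq> 0" using one_minus_norm_sq_pos[OF assms(1)] by simp
  ultimately show ?thesis using p assms(3) unfolding klein_proj_def by simp
qed

text \<open>From a point of the chord the endpoints are seen in opposite directions. Cauchy-Schwarz
  is then an equality with negative sign, and the law of cosines becomes the addition formula for
  \<open>cosh\<close>.\<close>

lemma closed_segment_additive:
  fixes x y z :: "'a::euclidean_space"
  assumes x: "x \<in> hspace" and z: "z \<in> hspace" and yin: "y \<in> closed_segment x z"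
  shows "y \<in> hspace" "hdist x y + hdist y z = hdist x z"
proof -
  show y: "y \<in> hspace"
    using yin x z convex_ball[of "0::'a" 1] by (meson closed_segment_subset subsetD)
  obtain t where t: "0 \<le> t" "t \<le> 1" "y = (1 - t) *\<^sub>R x + t *\<^sub>R z"
    using yin by (auto simp: in_segment)
  define u v w where "u = sqrt (1 - (norm x)\<^sup>2)" and "v = sqrt (1 - (norm y)\<^sup>2)"
    and "w = sqrt (1 - (norm z)\<^sup>2)"
  have pos: "u > 0" "v > 0" "w > 0"
    using one_minus_norm_sq_pos x y z by (auto simp: u_def v_def w_def)
  \<comment> \<open>These are the coefficients with which the unit vectors over \<open>x\<close> and
    \<open>z\<close> combine to \<open>(1, y)\<close>.\<close>
  define A B where "A = (1 - t) * u" and "B = t * w"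
  have AB: "A \<ge> 0" "B \<ge> 0" using t pos by (auto simp: A_def B_def)
  define p q where "p = klein_proj y x" and "q = klein_proj y z"
  define c where "c = A * cosh (hdist x y) / v + B * cosh (hdist z y) / v"
  have "A *\<^sub>R p + B *\<^sub>R q = y - c *\<^sub>R y"
    unfolding p_def q_def klein_proj_def u_def[symmetric] v_def[symmetric] w_def[symmetric] A_def B_def c_def
    using pos(1,3) t(3) by (simp add: algebra_simps)
  moreover have "A * (p \<bullet> y) + B * (q \<bullet> y) = 1 - c"
    unfolding p_def q_def klein_proj_inner[OF x y] klein_proj_inner[OF z y]
      u_def[symmetric] v_def[symmetric] w_def[symmetric] A_def B_def c_def
    using pos by (simp add: field_simps)
  ultimately have cy: "A *\<^sub>R p + B *\<^sub>R q = (1 - c) *\<^sub>R y" "A * (p \<bullet> y) + B * (q \<bullet> y) = 1 - c"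
    by (simp_all add: algebra_simps)
  \<comment> \<open>Pairing with \<open>y\<close> multiplies \<open>1 - c\<close> by
    \<open>y \<bullet> y < 1\<close> without changing it, which forces \<open>c = 1\<close>.\<close>
  have "(A *\<^sub>R p + B *\<^sub>R q) \<bullet> y = 1 - c" using cy(2) by (simp add: inner_add_left)
  hence "(1 - c) * (y \<bullet> y) = 1 - c" using cy(1) by simp
  moreover have "y \<bullet> y < 1" using one_minus_norm_sq_pos[OF y] by (simp add: power2_norm_eq_inner)
  ultimately have pq: "A *\<^sub>R p + B *\<^sub>R q = 0" using cy(1) by auto
  define E where "E = klein_inner y p q"
  have Epp: "klein_inner y p p = (sinh (hdist x y))\<^sup>2" and Eqq: "klein_inner y q q = (sinh (hdist y z))\<^sup>2"
    using klein_inner_proj_self[OF x y] klein_inner_proj_self[OF z y] by (simp_all add: p_def q_def hdist_commute)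
  have lin: "A *\<^sub>R p = (- B) *\<^sub>R q" using pq by (simp add: add_eq_0_iff2)
  have 1: "A * E = - B * klein_inner y q q"
    unfolding E_def by (metis lin klein_inner_scaleR(1))
  have 2: "A * klein_inner y p p = - B * E"
    unfolding E_def by (metis lin klein_inner_scaleR(1) klein_inner_commute)
  have AB0: "A > 0 \<or> B > 0" using t pos unfolding A_def B_def
    by (metis diff_gt_0_iff_gt less_eq_real_def mult_pos_pos zero_less_one)
  have EE: "E * E = klein_inner y p p * klein_inner y q q"
  proof (cases "A > 0")
    case True
    have "A * (E * E) = (A * E) * E" by simp
    also have "\<dots> = (- B * E) * klein_inner y q q" unfolding 1 by simp
    also have "\<dots> = (A * klein_inner y p p) * klein_inner y q q" by (simp add: 2)
    also have "\<dots> = A * (klein_inner y p p * klein_inner y q q)" by simp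
    finally show ?thesis using True by simp
  next
    case False
    hence "B > 0" using AB0 by simp
    have "- B * (E * E) = (- B * E) * E" by simp
    also have "\<dots> = (A * E) * klein_inner y p p" unfolding 2[symmetric] by simp
    also have "\<dots> = - B * (klein_inner y p p * klein_inner y q q)" unfolding 1 by simp
    finally show ?thesis using \<open>B > 0\<close> by simp
  qed
  have "E \<le> 0"
  proof (cases "A > 0")
    case True
    have "A * E \<le> 0" using 1 AB(2) klein_inner_self_nonneg[OF y, of q] by simp
    thus ?thesis using True by (simp add: mult_le_0_iff)
  next
    case False
    hence "B > 0" using AB0 by simp
    have "0 \<le> A * klein_inner y p p" using AB klein_inner_self_nonneg[OF y] by simp
    hence "B * E \<le> 0" using 2 by simp
    thus ?thesis using \<open>B > 0\<close> by (simp add: mult_le_0_iff)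
  qed
  moreover have "(- E)\<^sup>2 = (sinh (hdist x y) * sinh (hdist y z))\<^sup>2"
    using EE Epp Eqq by (simp add: power2_eq_square)
  ultimately have "- E = sinh (hdist x y) * sinh (hdist y z)"
    using sinh_hdist_nonneg[OF x y] sinh_hdist_nonneg[OF y z]
    by (simp add: power2_eq_imp_eq)
  hence "cosh (hdist x z) = cosh (hdist x y + hdist y z)"
    using klein_inner_proj[OF x y z] by (simp add: E_def p_def q_def cosh_add)
  thus "hdist x y + hdist y z = hdist x z"
    using cosh_eq_cosh_iff hdist_nonneg x y z by (metis add_nonneg_nonneg)
qed

text \<open>Additivity is the equality case of Cauchy-Schwarz, so the two projections are
  antiparallel; solving their linear relation for \<open>y\<close> exhibits it as a convex
  combination.\<close>

lemma additive_closed_segment: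
  fixes x y z :: "'a::euclidean_space"
  assumes x: "x \<in> hspace" and y: "y \<in> hspace" and z: "z \<in> hspace"
    and add: "hdist x y + hdist y z = hdist x z"
  shows "y \<in> closed_segment x z"
proof (cases "y = z")
  case True thus ?thesis by simp
next
  case False
  define p q where "p = klein_proj y x" and "q = klein_proj y z"
  define s r where "s = sinh (hdist x y)" and "r = sinh (hdist y z)"
  have Epp: "klein_inner y p p = s\<^sup>2" and Eqq: "klein_inner y q q = r\<^sup>2"
    using klein_inner_proj_self[OF x y] klein_inner_proj_self[OF z y]
    by (simp_all add: p_def q_def s_def r_def hdist_commute)
  have Epq: "klein_inner y p q = - (s * r)"
    using klein_inner_proj[OF x y z] cosh_add[of "hdist x y" "hdist y z"]
    by (simp add: add p_def q_def s_def r_def)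
  have s: "s \<ge> 0" using sinh_hdist_nonneg x y by (simp add: s_def)
  have r: "r > 0" using False hdist_eq_0[OF y z] hdist_nonneg[OF y z] unfolding r_def
    by (metis order_le_less sinh_real_pos_iff)
  have "r\<^sup>2 *\<^sub>R p = (- (s * r)) *\<^sub>R q"
    using klein_inner_Cauchy_Schwarz_eq[OF y, of p q] Epp Eqq Epq by (simp add: power_mult_distrib)
  hence "r *\<^sub>R (r *\<^sub>R p + s *\<^sub>R q) = 0" by (simp add: power2_eq_square mult.commute scaleR_add_right)
  hence pq: "r *\<^sub>R p + s *\<^sub>R q = 0" using r by simp
  define u v w where "u = 1 / sqrt (1 - (norm x)\<^sup>2)" and "v = 1 / sqrt (1 - (norm y)\<^sup>2)"
    and "w = 1 / sqrt (1 - (norm z)\<^sup>2)"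
  have pos: "u > 0" "v > 0" "w > 0"
    using one_minus_norm_sq_pos x y z by (auto simp: u_def v_def w_def)
  define T where "T = r * u + s * w"
  have T: "T > 0" using r s pos by (simp add: T_def add_pos_nonneg)
  define c where "c = (r * cosh (hdist x y) + s * cosh (hdist z y)) * v"
  have "r * (p \<bullet> y) + s * (q \<bullet> y) = 0" using pq by (metis inner_add_left inner_scaleR_left inner_zero_left)
  hence cT: "c = T"
    unfolding p_def q_def klein_proj_inner[OF x y] klein_proj_inner[OF z y] c_def T_def u_def v_def w_def
    by (simp add: algebra_simps)
  have "(r * u) *\<^sub>R x + (s * w) *\<^sub>R z = c *\<^sub>R y"
    using pq unfolding p_def q_def klein_proj_def c_def u_def v_def w_def
    by (simp add: algebra_simps)
  hence "(1 / T) *\<^sub>R ((r * u) *\<^sub>R x + (s * w) *\<^sub>R z) = y" using T cT by simp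
  moreover have "r * u / T = 1 - s * w / T" using T by (simp add: T_def field_simps)
  ultimately have "y = (1 - s * w / T) *\<^sub>R x + (s * w / T) *\<^sub>R z"
    by (simp add: scaleR_add_right)
  moreover have "0 \<le> s * w / T" "s * w / T \<le> 1"
    using T s r pos by (auto simp: T_def field_simps)
  ultimately show ?thesis unfolding in_segment by blast
qed

section \<open>The four-point inequality\<close>

text \<open>\<open>sqrt (1 - x \<bullet> y)\<close> satisfies the triangle inequality because \<open>2 (1 - x \<bullet> y)\<close> is the sum of the squares of
  \<open>norm (x - y)\<close> and of the hypotenuse of \<open>sqrt (1 - |x|\<^sup>2)\<close> and \<open>sqrt (1 - |y|\<^sup>2)\<close>.\<close>
lemma sqrt_klein_form_triangle:
  fixes x y z :: "'a::euclidean_space"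
  assumes "x \<in> hspace" "y \<in> hspace" "z \<in> hspace"
  shows "sqrt (1 - x \<bullet> z) \<le> sqrt (1 - x \<bullet> y) + sqrt (1 - y \<bullet> z)"
proof -
  define u v w where "u = 1 - (norm x)\<^sup>2" and "v = 1 - (norm y)\<^sup>2" and "w = 1 - (norm z)\<^sup>2"
  have pos: "u > 0" "v > 0" "w > 0"
    using one_minus_norm_sq_pos assms by (auto simp: u_def v_def w_def)
  have two: "2 * (1 - p \<bullet> q) = (norm (p - q))\<^sup>2 + ((1 - (norm p)\<^sup>2) + (1 - (norm q)\<^sup>2))" for p q :: 'a
    by (simp add: power2_norm_eq_inner inner_diff_left inner_diff_right inner_commute)
  note [simp del] = distrib_left_numeral right_diff_distrib_numeral
  have key: "sqrt (2 * (1 - p \<bullet> q)) = sqrt ((norm (p - q))\<^sup>2 + (sqrt ((1 - (norm p)\<^sup>2) + (1 - (norm q)\<^sup>2)))\<^sup>2)"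
    if "p \<in> hspace" "q \<in> hspace" for p q :: 'a
    using one_minus_norm_sq_pos[OF that(1)] one_minus_norm_sq_pos[OF that(2)]
    by (simp add: two real_sqrt_pow2)
  have "norm (x - z) \<le> norm (x - y) + norm (y - z)" by (metis dist_norm dist_triangle)
  moreover have "sqrt (u + w) \<le> sqrt (u + v) + sqrt (v + w)"
  proof -
    have "sqrt (u + w) \<le> sqrt ((u + v) + (v + w))" using pos by simp
    also have "\<dots> \<le> sqrt (u + v) + sqrt (v + w)" using pos by (intro sqrt_add_le_add_sqrt) auto
    finally show ?thesis .
  qed
  ultimately have "sqrt (2 * (1 - x \<bullet> z)) \<le>
      sqrt ((norm (x - y) + norm (y - z))\<^sup>2 + (sqrt (u + v) + sqrt (v + w))\<^sup>2)"
    unfolding key[OF assms(1,3)] u_def[symmetric] w_def[symmetric]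
    using pos by (intro real_sqrt_le_mono add_mono power_mono) auto
  also have "\<dots> \<le> sqrt (2 * (1 - x \<bullet> y)) + sqrt (2 * (1 - y \<bullet> z))"
    unfolding key[OF assms(1,2)] key[OF assms(2,3)] u_def[symmetric] v_def[symmetric] w_def[symmetric]
    by (rule real_sqrt_sum_squares_triangle_ineq)
  finally show ?thesis by (simp add: real_sqrt_mult flip: distrib_left)
qed

text \<open>A weak Ptolemy inequality: each diagonal is at most twice one of the two neighbours of
  the shortest side, and these neighbours are opposite to each other.\<close>

lemma four_point_mult:
  fixes d1 d2 d3 d4 D1 D2 :: real
  assumes "0 \<le> d1" "0 \<le> d2" "0 \<le> d3" "0 \<le> d4" "0 \<le> D1" "0 \<le> D2"
    and "D1 \<le> d1 + d2" "D1 \<le> d3 + d4" "D2 \<le> d2 + d3" "D2 \<le> d4 + d1"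
  shows "D1 * D2 \<le> 4 * max (d1 * d3) (d2 * d4)"
proof -
  have *: "D1 * D2 \<le> 4 * (p * q)" if "D1 \<le> 2 * p" "D2 \<le> 2 * q" for p q
  proof -
    have "0 \<le> 2 * p" using that assms by linarith
    thus ?thesis using mult_mono[OF that] assms by simp
  qed
  have "D1 * D2 \<le> 4 * (d1 * d3) \<or> D1 * D2 \<le> 4 * (d2 * d4)"
  proof -
    consider "d1 \<le> d2 \<and> d1 \<le> d3 \<and> d1 \<le> d4" | "d2 \<le> d1 \<and> d2 \<le> d3 \<and> d2 \<le> d4"
      | "d3 \<le> d1 \<and> d3 \<le> d2 \<and> d3 \<le> d4" | "d4 \<le> d1 \<and> d4 \<le> d2 \<and> d4 \<le> d3"
      by linarith
    thus ?thesis
    proof cases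
      case 1 with *[of d2 d4] assms show ?thesis by linarith
    next
      case 2 with *[of d1 d3] assms show ?thesis by linarith
    next
      case 3 with *[of d4 d2] assms show ?thesis by (simp add: mult.commute)
    next
      case 4 with *[of d3 d1] assms show ?thesis by (simp add: mult.commute)
    qed
  qed
  thus ?thesis by linarith
qed

lemma ln_64_less: "ln (64::real) < 5"
proof -
  have "(5 / 2 :: real) ^ 5 \<le> exp 1 ^ 5"
    by (intro power_mono) (use exp_lower_Taylor_quadratic[of 1] in auto)
  moreover have "exp (1::real) ^ 5 = exp 5" using exp_of_nat_mult[of 5 "1::real"] by simp
  ultimately have "64 < exp (5::real)" by (simp add: power_divide)
  thus ?thesis by (metis exp_gt_zero exp_less_cancel_iff exp_ln zero_less_numeral)
qed

text \<open>The weak Ptolemy inequality is applied to \<open>f\<close>, whose square is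
  \<open>cosh\<close> of the distance times a factor for each endpoint. Every point occurs once in
  each of the three products, so these factors cancel. Squaring costs 16, the bounds exp/2 \<le>
  cosh \<le> exp cost 4, and ln 64 < 5.\<close>

lemma hdist_four_point:
  fixes x y z w :: "'a::euclidean_space"
  assumes "x \<in> hspace" "y \<in> hspace" "z \<in> hspace" "w \<in> hspace"
  shows "hdist x z + hdist y w \<le> max (hdist x y + hdist z w) (hdist y z + hdist x w) + 5"
proof -
  define f where "f p q = sqrt (1 - p \<bullet> q)" for p q :: 'a
  define u where "u p = sqrt (1 - (norm p)\<^sup>2)" for p :: 'a
  have upos: "u p > 0" if "p \<in> hspace" for p using one_minus_norm_sq_pos[OF that] by (simp add: u_def)
  have f0: "f p q \<ge> 0" if "p \<in> hspace" "q \<in> hspace" for p q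
    using klein_form_pos[OF that] by (simp add: f_def)
  have fc: "f p q = f q p" for p q by (simp add: f_def inner_commute)
  have f2: "(f p q)\<^sup>2 = u p * u q * cosh (hdist p q)" if "p \<in> hspace" "q \<in> hspace" for p q
    using klein_form_pos[OF that] upos[OF that(1)] upos[OF that(2)]
    by (simp add: f_def u_def cosh_hdist[OF that] real_sqrt_mult)
  have tri: "f p r \<le> f p q + f q r" if "p \<in> hspace" "q \<in> hspace" "r \<in> hspace" for p q r
    unfolding f_def by (rule sqrt_klein_form_triangle[OF that])
  have "f x z * f y w \<le> 4 * max (f x y * f z w) (f y z * f x w)"
  proof (rule four_point_mult)
    show "f y w \<le> f y z + f z w" "f x z \<le> f x y + f y z" using tri assms by auto
    show "f x z \<le> f z w + f x w" using tri[of x w z] assms fc by simp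
    show "f y w \<le> f x w + f x y" using tri[of y x w] assms fc by simp
  qed (use f0 assms in auto)
  hence "(f x z * f y w)\<^sup>2 \<le> (4 * max (f x y * f z w) (f y z * f x w))\<^sup>2"
    using f0 assms by (intro power_mono) auto
  moreover have "(4 * max (f x y * f z w) (f y z * f x w))\<^sup>2 =
      16 * max ((f x y * f z w)\<^sup>2) ((f y z * f x w)\<^sup>2)"
  proof -
    have "0 \<le> p \<Longrightarrow> 0 \<le> q \<Longrightarrow> (4 * max p q)\<^sup>2 = 16 * max (p\<^sup>2) (q\<^sup>2)" for p q :: real
      using power_mono[of p q 2] power_mono[of q p 2] by (auto simp: max_def power_mult_distrib)
    thus ?thesis using f0 assms by (meson mult_nonneg_nonneg)
  qed
  ultimately have "(f x z)\<^sup>2 * (f y w)\<^sup>2 \<le> 16 * max ((f x y)\<^sup>2 * (f z w)\<^sup>2) ((f y z)\<^sup>2 * (f x w)\<^sup>2)"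
    by (simp add: power_mult_distrib)
  moreover define U where "U = u x * u y * u z * u w"
  have U: "U > 0" using upos assms by (simp add: U_def)
  moreover have "(f x z)\<^sup>2 * (f y w)\<^sup>2 = U * (cosh (hdist x z) * cosh (hdist y w))"
    "(f x y)\<^sup>2 * (f z w)\<^sup>2 = U * (cosh (hdist x y) * cosh (hdist z w))"
    "(f y z)\<^sup>2 * (f x w)\<^sup>2 = U * (cosh (hdist y z) * cosh (hdist x w))"
    using f2 assms by (simp_all add: U_def)
  ultimately have "U * (cosh (hdist x z) * cosh (hdist y w)) \<le>
      16 * max (U * (cosh (hdist x y) * cosh (hdist z w))) (U * (cosh (hdist y z) * cosh (hdist x w)))"
    by simp
  also have "\<dots> = U * (16 * max (cosh (hdist x y) * cosh (hdist z w)) (cosh (hdist y z) * cosh (hdist x w)))"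
    using U by (simp add: max_mult_distrib_left)
  finally have main: "cosh (hdist x z) * cosh (hdist y w) \<le>
      16 * max (cosh (hdist x y) * cosh (hdist z w)) (cosh (hdist y z) * cosh (hdist x w))"
    using U by simp
  have lo: "exp d / 2 \<le> cosh d" for d :: real by (simp add: cosh_def)
  have up: "cosh d \<le> exp d" if "0 \<le> d" for d :: real using that by (simp add: cosh_def)
  define m where "m = max (hdist x y + hdist z w) (hdist y z + hdist x w)"
  have "exp (hdist x z) / 2 * (exp (hdist y w) / 2) \<le> cosh (hdist x z) * cosh (hdist y w)"
    by (intro mult_mono lo) auto
  also note main
  also have "16 * max (cosh (hdist x y) * cosh (hdist z w)) (cosh (hdist y z) * cosh (hdist x w))
      \<le> 16 * exp m"
  proof -
    have "cosh (hdist x y) * cosh (hdist z w) \<le> exp (hdist x y) * exp (hdist z w)"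
      "cosh (hdist y z) * cosh (hdist x w) \<le> exp (hdist y z) * exp (hdist x w)"
      using hdist_nonneg assms by (auto intro!: mult_mono up)
    hence "cosh (hdist x y) * cosh (hdist z w) \<le> exp m" "cosh (hdist y z) * cosh (hdist x w) \<le> exp m"
      unfolding m_def by (smt (verit) exp_add exp_le_cancel_iff)+
    thus ?thesis by simp
  qed
  finally have "exp (hdist x z + hdist y w) \<le> 64 * exp m" by (simp add: exp_add)
  also have "\<dots> = exp (ln 64 + m)" by (simp add: exp_add)
  finally show ?thesis using ln_64_less by (simp add: m_def)
qed

section \<open>Comparison with the Euclidean topology\<close>

lemma continuous_on_hdist:
  fixes f g :: "'b::topological_space \<Rightarrow> 'a::euclidean_space"
  assumes "continuous_on S f" "continuous_on S g" "f ` S \<subseteq> hspace" "g ` S \<subseteq> hspace"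
  shows "continuous_on S (\<lambda>s. hdist (f s) (g s))"
proof -
  have fg: "f s \<in> hspace" "g s \<in> hspace" if "s \<in> S" for s using assms that by auto
  have nz: "0 < sqrt ((1 - (norm (f s))\<^sup>2) * (1 - (norm (g s))\<^sup>2))" if "s \<in> S" for s
    using klein_denom_pos[OF fg[OF that]] .
  have ge: "(1 - f s \<bullet> g s) / sqrt ((1 - (norm (f s))\<^sup>2) * (1 - (norm (g s))\<^sup>2)) \<in> {1..}"
    if "s \<in> S" for s
    using klein_form_ge[OF fg[OF that]] nz[OF that] by simp
  have "continuous_on S (\<lambda>s. (1 - f s \<bullet> g s) / sqrt ((1 - (norm (f s))\<^sup>2) * (1 - (norm (g s))\<^sup>2)))"
    using nz by (intro continuous_intros assms) force
  thus ?thesis unfolding hdist_def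
    using ge by (intro continuous_on_compose2[OF continuous_on_arcosh[of "{1..}"]]) auto
qed

text \<open>Since \<open>1 - x\<^sub>0 \<bullet> z\<close> is at least
  \<open>1 - norm x\<^sub>0\<close>, a bound on \<open>cosh\<close> of the distance keeps
  \<open>1 - (norm z)\<^sup>2\<close> above the constant \<open>c\<close>.\<close>

lemma hdist_cball_compact:
  fixes x\<^sub>0 :: "'a::euclidean_space"
  assumes x0: "x\<^sub>0 \<in> hspace"
  shows "\<exists>L \<subseteq> hspace. compact L \<and> {z \<in> hspace. hdist x\<^sub>0 z \<le> r} \<subseteq> L"
proof -
  define u where "u = 1 - (norm x\<^sub>0)\<^sup>2"
  have u: "u > 0" using one_minus_norm_sq_pos[OF x0] by (simp add: u_def)
  have nx: "norm x\<^sub>0 < 1" using x0 by simp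
  define c where "c = ((1 - norm x\<^sub>0) / cosh r)\<^sup>2 / u"
  have c: "c > 0" using nx u by (simp add: c_def)
  show ?thesis
  proof (intro exI conjI)
    show "cball (0::'a) (sqrt (max 0 (1 - c))) \<subseteq> hspace"
    proof -
      have "sqrt (max 0 (1 - c)) < 1" using c by (simp add: max_def)
      thus ?thesis by (simp add: cball_subset_ball_iff)
    qed
    show "compact (cball (0::'a) (sqrt (max 0 (1 - c))))" by simp
    show "{z \<in> hspace. hdist x\<^sub>0 z \<le> r} \<subseteq> cball 0 (sqrt (max 0 (1 - c)))"
    proof clarify
      fix z :: 'a assume z: "z \<in> hspace" and d: "hdist x\<^sub>0 z \<le> r"
      define v where "v = 1 - (norm z)\<^sup>2"
      have v: "v > 0" using one_minus_norm_sq_pos[OF z] by (simp add: v_def)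
      have r: "0 \<le> r" using d hdist_nonneg[OF x0 z] by linarith
      have "x\<^sub>0 \<bullet> z \<le> norm x\<^sub>0 * norm z" by (rule norm_cauchy_schwarz)
      also have "\<dots> \<le> norm x\<^sub>0" using z by (simp add: mult_left_le)
      finally have "1 - norm x\<^sub>0 \<le> 1 - x\<^sub>0 \<bullet> z" by simp
      also have "\<dots> = cosh (hdist x\<^sub>0 z) * sqrt (u * v)"
        using cosh_hdist[OF x0 z] u v by (simp add: u_def v_def)
      also have "\<dots> \<le> cosh r * sqrt (u * v)"
        using cosh_le_cosh_iff[of "hdist x\<^sub>0 z" r] d r hdist_nonneg[OF x0 z] u v by (intro mult_right_mono) auto
      finally have "(1 - norm x\<^sub>0) / cosh r \<le> sqrt (u * v)"
        by (simp add: field_simps)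
      hence "((1 - norm x\<^sub>0) / cosh r)\<^sup>2 \<le> (sqrt (u * v))\<^sup>2"
        using nx by (intro power_mono) auto
      hence "c \<le> v" using u v by (simp add: c_def field_simps)
      hence "(norm z)\<^sup>2 \<le> max 0 (1 - c)" by (simp add: v_def)
      hence "norm z \<le> sqrt (max 0 (1 - c))" by (rule real_le_rsqrt)
      thus "z \<in> cball 0 (sqrt (max 0 (1 - c)))" by simp
    qed
  qed
qed

text \<open>Sets of bounded hyperbolic diameter shrink in Euclidean size towards the sphere, because
  \<open>2 * (1 - y \<bullet> z)\<close> dominates the squared Euclidean distance.\<close>

lemma norm_diff_le_hdist:
  fixes y z :: "'a::euclidean_space"
  assumes y: "y \<in> hspace" and z: "z \<in> hspace" and d: "hdist y z \<le> D"
  shows "(norm (y - z))\<^sup>2 \<le> 2 * cosh D * sqrt (1 - (norm z)\<^sup>2)"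
proof -
  define u v where "u = 1 - (norm y)\<^sup>2" and "v = 1 - (norm z)\<^sup>2"
  have uv: "u > 0" "v > 0" "u \<le> 1" using one_minus_norm_sq_pos y z by (auto simp: u_def v_def)
  have "(norm (y - z))\<^sup>2 + (u + v) = 2 * (1 - y \<bullet> z)"
    by (simp add: power2_norm_eq_inner inner_diff_left inner_diff_right inner_commute u_def v_def)
  hence "(norm (y - z))\<^sup>2 \<le> 2 * (1 - y \<bullet> z)" using uv by linarith
  also have "\<dots> = 2 * cosh (hdist y z) * sqrt (u * v)"
    using cosh_hdist[OF y z] uv by (simp add: u_def v_def)
  also have "\<dots> \<le> 2 * cosh D * sqrt v"
    using cosh_le_cosh_iff[of "hdist y z" D] d hdist_nonneg[OF y z] uv
    by (intro mult_mono) (auto simp: mult_left_le_one_le)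
  finally show ?thesis by (simp add: v_def)
qed

lemma compact_in_smaller_ball:
  fixes Q :: "'a::euclidean_space set"
  assumes "compact Q" "Q \<subseteq> hspace"
  obtains r where "r < 1" "Q \<subseteq> cball 0 r"
proof (cases "Q = {}")
  case True
  thus ?thesis using that[of 0] by simp
next
  case False
  obtain q where q: "q \<in> Q" "\<And>z. z \<in> Q \<Longrightarrow> norm z \<le> norm q"
    using continuous_attains_sup[OF assms(1) False, of norm] continuous_on_norm_id by blast
  show ?thesis by (rule that[of "norm q"]) (use q assms(2) in auto)
qed

lemma hdist_uniformly_small:
  fixes Q :: "'a::euclidean_space set"
  assumes Q: "compact Q" "Q \<subseteq> hspace" and e: "e > 0"
  obtains d where "d > 0" "\<And>z w. z \<in> Q \<Longrightarrow> norm (z - w) < d \<Longrightarrow> w \<in> hspace \<and> hdist z w < e"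
proof -
  obtain r where r: "r < 1" "Q \<subseteq> cball 0 r" using compact_in_smaller_ball[OF Q] .
  \<comment> \<open>A concentric ball halfway between radius \<open>r\<close> and the sphere leaves
    room for points \<open>w\<close> slightly outside \<open>Q\<close>.\<close>
  define Q' where "Q' = cball (0::'a) ((1 + r) / 2)"
  have Q': "Q' \<subseteq> hspace" "compact Q'" using r by (auto simp: Q'_def)
  have "uniformly_continuous_on (Q' \<times> Q') (\<lambda>s. hdist (fst s) (snd s))"
    using Q' by (intro compact_uniformly_continuous continuous_on_hdist continuous_intros compact_Times) auto
  then obtain d where d: "d > 0" "\<And>s t. s \<in> Q' \<times> Q' \<Longrightarrow> t \<in> Q' \<times> Q' \<Longrightarrow> dist t s < d \<Longrightarrow>
      dist (hdist (fst t) (snd t)) (hdist (fst s) (snd s)) < e"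
    unfolding uniformly_continuous_on_def using e by blast
  show ?thesis
  proof (rule that[of "min d ((1 - r) / 2)"])
    show "0 < min d ((1 - r) / 2)" using d r by simp
  next
    fix z w assume z: "z \<in> Q" and zw: "norm (z - w) < min d ((1 - r) / 2)"
    have nz: "norm z \<le> r" using z r by auto
    have "norm w \<le> norm z + norm (z - w)" by (metis norm_minus_commute norm_triangle_sub)
    hence w: "w \<in> Q'" using nz zw by (simp add: Q'_def)
    have z': "z \<in> Q'" using nz r by (simp add: Q'_def)
    have "dist (z, w) (z, z) < d" using zw by (simp add: dist_Pair_Pair dist_norm norm_minus_commute)
    from d(2)[of "(z, z)" "(z, w)", OF _ _ this] z' w
    have "dist (hdist z w) (hdist z z) < e" by simp
    thus "w \<in> hspace \<and> hdist z w < e" using w z' Q' by (auto simp: dist_real_def)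
  qed
qed

declare mem_ball_0 [simp del] mem_ball [simp del]

section \<open>Gromov products and local quasi-geodesics\<close>

lemma gromov_product_double:
  "2 * gromov_product v x y = hdist v x + hdist v y - hdist x y"
  by (simp add: gromov_product_def hdist_commute)

lemma gromov_product_commute: "gromov_product v x y = gromov_product v y x"
  by (simp add: gromov_product_def hdist_commute)

lemma gromov_product_nonneg:
  "\<lbrakk>v \<in> hspace; x \<in> hspace; y \<in> hspace\<rbrakk> \<Longrightarrow> 0 \<le> gromov_product v x y"
  using hdist_triangle[of x v y] by (simp add: gromov_product_def)

text \<open>The four-point inequality divided by 2; hyperbolicity holds with constant 5/2.\<close>

lemma gromov_product_four_point:
  assumes "v \<in> hspace" "x \<in> hspace" "y \<in> hspace" "z \<in> hspace"
  shows "min (gromov_product v x y) (gromov_product v y z) \<le> gromov_product v x z + 5 / 2"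
  using hdist_four_point[of x y z v] assms
    gromov_product_double[of v x y] gromov_product_double[of v y z] gromov_product_double[of v x z]
    hdist_commute[of z v] hdist_commute[of y v] hdist_commute[of x v] hdist_commute[of z y]
  by linarith

text \<open>Take the point \<open>z\<close> of the segment whose distance from \<open>x\<close> is
  the product of \<open>v\<close> and \<open>y\<close> based at \<open>x\<close>. Based at
  \<open>z\<close>, the products of \<open>v\<close> with \<open>x\<close> and with \<open>y\<close>
  both equal half of \<open>hdist v z - gromov_product v x y\<close>, and the product of
  \<open>x\<close> and \<open>y\<close> is 0, so hyperbolicity bounds this difference by 5.\<close>

lemma near_geodesic:
  fixes x y v :: "'a::euclidean_space"
  assumes x: "x \<in> hspace" and y: "y \<in> hspace" and v: "v \<in> hspace"
  obtains z where "z \<in> closed_segment x y" "hdist v z \<le> gromov_product v x y + 5"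
proof -
  define g where "g t = x + t *\<^sub>R (y - x)" for t :: real
  have gin: "g t \<in> closed_segment x y" if "t \<in> {0..1}" for t
    using that by (auto simp: g_def in_segment algebra_simps)
  have gh: "g t \<in> hspace" if "t \<in> {0..1}" for t
    using closed_segment_additive(1)[OF x y gin[OF that]] .
  define T where "T = gromov_product x v y"
  have "T \<ge> 0" "T \<le> hdist x y"
    using gromov_product_nonneg[OF x v y] hdist_triangle[OF y v x] hdist_triangle[OF v x y] hdist_triangle[OF v y x]
      gromov_product_double[of x v y] hdist_commute[of v x] hdist_commute[of y v] hdist_commute[of y x]
    unfolding T_def by linarith+
  moreover have "continuous_on {0..1} (\<lambda>t. hdist x (g t))"
    using gh x by (intro continuous_on_hdist) (auto simp: g_def intro!: continuous_intros)
  moreover have "hdist x (g 0) = 0" "hdist x (g 1) = hdist x y"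
    using x by (simp_all add: g_def)
  ultimately obtain t where t: "0 \<le> t" "t \<le> 1" "hdist x (g t) = T"
    using IVT'[of "\<lambda>t. hdist x (g t)" 0 T 1] by auto
  define z where "z = g t"
  have zin: "z \<in> closed_segment x y" and z: "z \<in> hspace"
    using gin[of t] gh[of t] t by (auto simp: z_def)
  have add: "hdist x z + hdist z y = hdist x y"
    using closed_segment_additive(2)[OF x y zin] .
  have xz: "hdist x z = T" using t by (simp add: z_def)
  show thesis
  proof (rule that[OF zin])
    show "hdist v z \<le> gromov_product v x y + 5"
      using gromov_product_four_point[OF z x v y] add xz
        gromov_product_double[of z x v] gromov_product_double[of z v y] gromov_product_double[of z x y]
        gromov_product_double[of v x y] gromov_product_double[of x v y]
        hdist_commute[of z x] hdist_commute[of z v] hdist_commute[of v x]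
      unfolding T_def by linarith
  qed
qed

section \<open>Local chains are global quasi-geodesics\<close>

definition local_chain :: "real \<Rightarrow> real \<Rightarrow> 'a::euclidean_space list \<Rightarrow> bool"
  where "local_chain L c ps \<longleftrightarrow> set ps \<subseteq> hspace \<and>
    (\<forall>i. i + 1 < length ps \<longrightarrow> L \<le> hdist (ps ! i) (ps ! (i + 1))) \<and>
    (\<forall>i. i + 2 < length ps \<longrightarrow> gromov_product (ps ! (i + 1)) (ps ! i) (ps ! (i + 2)) \<le> c)"

text \<open>An overlap of two points suffices: every window of three consecutive points then lies in
  one of the two chains.\<close>

lemma local_chain_append:
  assumes 1: "local_chain L c (xs @ [u, v])" and 2: "local_chain L c (u # v # ys)"
  shows "local_chain L c (xs @ u # v # ys)"
proof -
  define ps where "ps = xs @ u # v # ys"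
  have first: "ps ! i = (xs @ [u, v]) ! i" if "i < length xs + 2" for i
    using that by (auto simp: ps_def nth_append nth_Cons split: nat.splits)
  have second: "ps ! (length xs + i) = (u # v # ys) ! i" for i
    by (simp add: ps_def nth_append)
  have len: "length ps = length xs + length (u # v # ys)" by (simp add: ps_def)
  have "L \<le> hdist (ps ! i) (ps ! (i + 1))" if "i + 1 < length ps" for i
  proof (cases "i < length xs")
    case True
    thus ?thesis using 1 first[of i] first[of "i + 1"] by (simp add: local_chain_def)
  next
    case False
    then obtain j where "i = length xs + j" using le_Suc_ex not_less by blast
    thus ?thesis using 2 second[of j] second[of "j + 1"] that len by (simp add: local_chain_def)
  qed
  moreover have "gromov_product (ps ! (i + 1)) (ps ! i) (ps ! (i + 2)) \<le> c" if "i + 2 < length ps" for i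
  proof (cases "i < length xs")
    case True
    thus ?thesis using 1 first[of i] first[of "i + 1"] first[of "i + 2"] by (simp add: local_chain_def)
  next
    case False
    then obtain j where "i = length xs + j" using le_Suc_ex not_less by blast
    thus ?thesis using 2 second[of j] second[of "j + 1"] second[of "j + 2"] that len
      by (simp add: local_chain_def)
  qed
  moreover have "set ps \<subseteq> hspace" using 1 2 by (auto simp: ps_def local_chain_def)
  ultimately show ?thesis by (simp add: local_chain_def ps_def)
qed

lemma local_chain_rev:
  assumes "local_chain L c ps" shows "local_chain L c (rev ps)"
  unfolding local_chain_def
proof (intro conjI allI impI)
  show "set (rev ps) \<subseteq> hspace" using assms by (simp add: local_chain_def)
next
  fix i assume i: "i + 1 < length (rev ps)"
  define j where "j = length ps - i - 2"
  have "length ps = i + j + 2" using i by (simp add: j_def)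
  hence "rev ps ! i = ps ! (j + 1)" "rev ps ! (i + 1) = ps ! j" "j + 1 < length ps"
    by (simp_all add: rev_nth)
  thus "L \<le> hdist (rev ps ! i) (rev ps ! (i + 1))"
    using assms by (simp add: local_chain_def hdist_commute)
next
  fix i assume i: "i + 2 < length (rev ps)"
  define j where "j = length ps - i - 3"
  have "length ps = i + j + 3" using i by (simp add: j_def)
  hence "rev ps ! i = ps ! (j + 2)" "rev ps ! (i + 1) = ps ! (j + 1)" "rev ps ! (i + 2) = ps ! j"
    "j + 2 < length ps"
    by (simp_all add: rev_nth)
  thus "gromov_product (rev ps ! (i + 1)) (rev ps ! i) (rev ps ! (i + 2)) \<le> c"
    using assms by (simp add: local_chain_def gromov_product_commute)
qed

text \<open>Induction along the chain: a small product at a point and the long next edge give a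
  large product of the start and the previous point, seen from the next point. The local product
  there is at most \<open>c\<close>, so the four-point inequality bounds the new one by
  \<open>c + 5 / 2\<close>, with no accumulation of errors.\<close>

lemma local_chain_forward:
  assumes chain: "local_chain L c ps" and L: "2 * c + 5 < L"
  shows "i + k + 2 < length ps \<Longrightarrow>
    gromov_product (ps ! (i + k + 1)) (ps ! i) (ps ! (i + k + 2)) \<le> c + 5 / 2"
proof (induction k)
  case 0
  have "gromov_product (ps ! (i + 1)) (ps ! i) (ps ! (i + 2)) \<le> c"
    using chain 0 unfolding local_chain_def by simp
  thus ?case by simp
next
  case (Suc k)
  define n where "n = i + k + 1"
  have in_h: "ps ! j \<in> hspace" if "j < length ps" for j
    using that chain by (auto simp: local_chain_def)
  have n: "n + 2 < length ps" using Suc.prems by (simp add: n_def)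
  have IH: "gromov_product (ps ! n) (ps ! i) (ps ! (n + 1)) \<le> c + 5 / 2"
    using Suc by (simp add: n_def)
  have "L \<le> hdist (ps ! n) (ps ! (n + 1))" using chain n by (simp add: local_chain_def)
  hence "c + 5 / 2 < gromov_product (ps ! (n + 1)) (ps ! i) (ps ! n)"
    using IH L gromov_product_double[of "ps ! n" "ps ! i" "ps ! (n + 1)"]
      gromov_product_double[of "ps ! (n + 1)" "ps ! i" "ps ! n"]
      hdist_commute[of "ps ! (n + 1)" "ps ! n"] hdist_commute[of "ps ! (n + 1)" "ps ! i"]
      hdist_commute[of "ps ! n" "ps ! i"] by linarith
  moreover have "gromov_product (ps ! (n + 1)) (ps ! n) (ps ! (n + 2)) \<le> c"
    using chain n unfolding local_chain_def by blast
  moreover have "min (gromov_product (ps ! (n + 1)) (ps ! n) (ps ! i)) (gromov_product (ps ! (n + 1)) (ps ! i) (ps ! (n + 2)))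
      \<le> gromov_product (ps ! (n + 1)) (ps ! n) (ps ! (n + 2)) + 5 / 2"
    using n by (intro gromov_product_four_point in_h) (auto simp: n_def)
  ultimately have "gromov_product (ps ! (n + 1)) (ps ! i) (ps ! (n + 2)) \<le> c + 5 / 2"
    by (simp add: gromov_product_commute min_def split: if_splits)
  thus ?case by (simp add: n_def)
qed

text \<open>The forward estimate ends at the successor \<open>j + 1\<close>; the same estimate on
  the reversed chain shows that \<open>j + 1\<close> and \<open>k\<close> lie in nearly the same
  direction from \<open>j\<close>. One more four-point inequality replaces \<open>j + 1\<close> by
  \<open>k\<close>.\<close>

lemma local_chain_gromov_product:
  assumes chain: "local_chain L c ps" and L: "2 * c + 15 / 2 < L"
    and ijk: "i < j" "j < k" "k < length ps"
  shows "gromov_product (ps ! j) (ps ! i) (ps ! k) \<le> c + 5"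
proof -
  have in_h: "ps ! j \<in> hspace" if "j < length ps" for j
    using that chain by (auto simp: local_chain_def)
  have fwd: "gromov_product (ps ! j) (ps ! i) (ps ! (j + 1)) \<le> c + 5 / 2"
    using local_chain_forward[OF chain, of i "j - i - 1"] L ijk by simp
  show ?thesis
  proof (cases "k = j + 1")
    case True thus ?thesis using fwd by simp
  next
    case False
    have r: "local_chain L c (rev ps)" using local_chain_rev[OF chain] .
    \<comment> \<open>In the reversed list, \<open>k\<close> has index \<open>i'\<close> and
      \<open>j + 1\<close> has index \<open>i' + k' + 1\<close>.\<close>
    define i' k' where "i' = length ps - 1 - k" and "k' = k - j - 2"
    have "i' + k' + 2 < length (rev ps)" using ijk False by (simp add: i'_def k'_def)
    from local_chain_forward[OF r _ this] L
    have "gromov_product (rev ps ! (i' + k' + 1)) (rev ps ! i') (rev ps ! (i' + k' + 2)) \<le> c + 5 / 2"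
      by simp
    moreover have "length ps = i' + k + 1" "k = k' + j + 2" using ijk False by (auto simp: i'_def k'_def)
    hence "rev ps ! i' = ps ! k" "rev ps ! (i' + k' + 1) = ps ! (j + 1)" "rev ps ! (i' + k' + 2) = ps ! j"
      by (simp_all add: rev_nth)
    ultimately have bwd: "gromov_product (ps ! (j + 1)) (ps ! k) (ps ! j) \<le> c + 5 / 2" by simp
    have "L \<le> hdist (ps ! j) (ps ! (j + 1))" using chain ijk by (simp add: local_chain_def)
    hence "c + 5 < gromov_product (ps ! j) (ps ! (j + 1)) (ps ! k)"
      using bwd L gromov_product_double[of "ps ! j" "ps ! (j + 1)" "ps ! k"]
        gromov_product_double[of "ps ! (j + 1)" "ps ! k" "ps ! j"]
        hdist_commute[of "ps ! (j + 1)" "ps ! j"] hdist_commute[of "ps ! k" "ps ! j"] by linarith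
    moreover have "min (gromov_product (ps ! j) (ps ! i) (ps ! k)) (gromov_product (ps ! j) (ps ! k) (ps ! (j + 1)))
      \<le> gromov_product (ps ! j) (ps ! i) (ps ! (j + 1)) + 5 / 2"
      using ijk by (intro gromov_product_four_point in_h) auto
    ultimately show ?thesis using fwd by (simp add: gromov_product_commute min_def split: if_splits)
  qed
qed

text \<open>In the four-point inequality with diagonals from \<open>v\<close> to \<open>w\<close>
  and from \<open>x\<close> to \<open>y\<close>, almost-additivity turns distances to
  \<open>y\<close> into differences of distances from \<open>x\<close>.\<close>

lemma hdist_le_of_positions:
  assumes "x \<in> hspace" "y \<in> hspace" "v \<in> hspace" "w \<in> hspace"
    and "gromov_product v x y \<le> k" "gromov_product w x y \<le> k"
  shows "hdist v w \<le> \<bar>hdist x v - hdist x w\<bar> + 2 * k + 5"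
  using hdist_four_point[of v x w y] assms
    gromov_product_double[of v x y] gromov_product_double[of w x y] hdist_commute[of x v]
    hdist_commute[of w x] hdist_commute[of v y] hdist_commute[of w y]
  by (smt (verit))

section \<open>The action\<close>

context proper_isometric_action
begin

sublocale group G
  using group_hom by (rule group_hom.axioms(1))

abbreviation orb :: "'g \<Rightarrow> 'a" where "orb g \<equiv> act g x\<^sub>0"
abbreviation nrm :: "'g \<Rightarrow> real" where "nrm g \<equiv> disp act x\<^sub>0 g"

lemma act_in [intro]: "\<lbrakk>g \<in> carrier G; x \<in> hspace\<rbrakk> \<Longrightarrow> act g x \<in> hspace"
  using element_image by blast

lemma orb_in [intro]: "g \<in> carrier G \<Longrightarrow> orb g \<in> hspace"
  using act_in base_point by blast

lemma act_mult: "\<lbrakk>g \<in> carrier G; h \<in> carrier G; x \<in> hspace\<rbrakk> \<Longrightarrow> act (g \<otimes> h) x = act g (act h x)"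
  by (rule composition_rule)

lemma act_one: "x \<in> hspace \<Longrightarrow> act \<one> x = x"
  using id_eq_one by (metis restrict_apply')

lemma act_inv_cancel:
  assumes "g \<in> carrier G" "x \<in> hspace"
  shows "act (inv g) (act g x) = x" "act g (act (inv g) x) = x"
  using act_mult[of "inv g" g x] act_mult[of g "inv g" x] act_one assms by auto

lemma hdist_orb: "\<lbrakk>g \<in> carrier G; h \<in> carrier G\<rbrakk> \<Longrightarrow> hdist (orb g) (orb (g \<otimes> h)) = nrm h"
  using isometric act_mult base_point orb_in by (simp add: disp_def)

lemma nrm_nonneg: "g \<in> carrier G \<Longrightarrow> 0 \<le> nrm g"
  using hdist_nonneg[OF base_point orb_in[of g]] by (simp add: disp_def)

lemma nrm_mult: "\<lbrakk>g \<in> carrier G; h \<in> carrier G\<rbrakk> \<Longrightarrow> nrm (g \<otimes> h) \<le> nrm g + nrm h"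
  using hdist_triangle[of x\<^sub>0 "orb g" "orb (g \<otimes> h)"] hdist_orb[of g h] base_point orb_in
  by (simp add: disp_def)

lemma nrm_inv: "g \<in> carrier G \<Longrightarrow> nrm (inv g) = nrm g"
  using hdist_orb[of g "inv g"] act_one base_point by (simp add: disp_def hdist_commute)

lemma gromov_product_act:
  assumes "g \<in> carrier G" "v \<in> hspace" "x \<in> hspace" "y \<in> hspace"
  shows "gromov_product (act g v) (act g x) (act g y) = gromov_product v x y"
  using assms by (simp add: gromov_product_def isometric)

text \<open>Segments are characterised by additivity of distances, which isometries preserve;
  \<open>inv g\<close> supplies the other inclusion.\<close>

lemma act_closed_segment:
  assumes g: "g \<in> carrier G" and x: "x \<in> hspace" and y: "y \<in> hspace"
  shows "act g ` closed_segment x y = closed_segment (act g x) (act g y)"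
proof -
  have sub: "act g ` closed_segment x y \<subseteq> closed_segment (act g x) (act g y)"
    if g: "g \<in> carrier G" and x: "x \<in> hspace" and y: "y \<in> hspace" for g x y
  proof clarify
    fix z assume z: "z \<in> closed_segment x y"
    note za = closed_segment_additive[OF x y z]
    show "act g z \<in> closed_segment (act g x) (act g y)"
      using za by (intro additive_closed_segment act_in g x y) (simp_all add: isometric g x y)
  qed
  have "closed_segment (act g x) (act g y) \<subseteq> act g ` closed_segment x y"
  proof
    fix z assume z: "z \<in> closed_segment (act g x) (act g y)"
    have zh: "z \<in> hspace" using closed_segment_additive(1)[OF _ _ z] g x y by blast
    have "act (inv g) z \<in> closed_segment (act (inv g) (act g x)) (act (inv g) (act g y))"
      using sub[of "inv g" "act g x" "act g y"] g x y z by blast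
    hence "act (inv g) z \<in> closed_segment x y" using act_inv_cancel g x y by simp
    moreover have "z = act g (act (inv g) z)" using act_inv_cancel g zh by simp
    ultimately show "z \<in> act g ` closed_segment x y" by blast
  qed
  with sub[OF g x y] show ?thesis by blast
qed

lemma finite_norm_ball: "finite {g \<in> carrier G. nrm g \<le> r}"
proof -
  \<comment> \<open>The maximum with 0 guarantees that \<open>x\<^sub>0\<close> itself lies in
    \<open>L\<close>.\<close>
  obtain L where L: "L \<subseteq> hspace" "compact L" "{z \<in> hspace. hdist x\<^sub>0 z \<le> max r 0} \<subseteq> L"
    using hdist_cball_compact[OF base_point] by blast
  have "x\<^sub>0 \<in> L" using L(3) base_point by auto
  have "{g \<in> carrier G. nrm g \<le> r} \<subseteq> {g \<in> carrier G. act g ` L \<inter> L \<noteq> {}}"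
  proof clarify
    fix g assume g: "g \<in> carrier G" "nrm g \<le> r" "act g ` L \<inter> L = {}"
    have "orb g \<in> L" using L(3) g orb_in by (auto simp: disp_def)
    thus False using g(3) \<open>x\<^sub>0 \<in> L\<close> by blast
  qed
  thus ?thesis using proper[OF L(1,2)] finite_subset by blast
qed

text \<open>Left translation by \<open>h\<close>. The cardinality bound is independent of
  \<open>h\<close>, which later makes multiplicities uniform.\<close>

lemma finite_hdist_ball: 
  assumes "h \<in> carrier G" shows "finite {g \<in> carrier G. hdist (orb h) (orb g) \<le> r}"
    "card {g \<in> carrier G. hdist (orb h) (orb g) \<le> r} \<le> card {g \<in> carrier G. nrm g \<le> r}"
proof -
  have sub: "{g \<in> carrier G. hdist (orb h) (orb g) \<le> r} \<subseteq> (\<lambda>g. h \<otimes> g) ` {g \<in> carrier G. nrm g \<le> r}"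
  proof clarify
    fix g assume g: "g \<in> carrier G" "hdist (orb h) (orb g) \<le> r"
    have e: "g = h \<otimes> (inv h \<otimes> g)" using g assms by (simp flip: m_assoc)
    hence "nrm (inv h \<otimes> g) \<le> r" using hdist_orb[of h "inv h \<otimes> g"] g assms by simp
    thus "g \<in> (\<lambda>g. h \<otimes> g) ` {g \<in> carrier G. nrm g \<le> r}" using e g assms by blast
  qed
  show "finite {g \<in> carrier G. hdist (orb h) (orb g) \<le> r}"
    using finite_subset[OF sub] finite_norm_ball by blast
  show "card {g \<in> carrier G. hdist (orb h) (orb g) \<le> r} \<le> card {g \<in> carrier G. nrm g \<le> r}"
    using surj_card_le[OF finite_norm_ball sub] .
qed

end

section \<open>Property (A)\<close>

context property_A_setting
begin

definition PA :: "'g set" where "PA = {h. property_A G act x\<^sub>0 a h}"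

lemma SUP_a_b_nonneg: "0 \<le> (SUP (n::int, m::int). gromov_product x\<^sub>0 (orb (a [^] n)) (orb (b [^] m)))"
proof -
  have "gromov_product x\<^sub>0 (orb (a [^] (0::int))) (orb (b [^] (0::int))) = 0"
    using base_point act_one by (simp add: gromov_product_def)
  thus ?thesis using cSUP_upper[OF UNIV_I a_b_bounded, of "(0, 0)"] by simp
qed

text \<open>The supremum is nonnegative, as \<open>n = m = 0\<close> shows, so the additive
  constants of hyperbolicity are negligible compared with \<open>C\<close>.\<close>

lemma C_large: "3000 < C" and nrm_a: "nrm a = 1000 * C" and nrm_b: "nrm b \<le> C"
  and a_b_gromov_product: "gromov_product x\<^sub>0 (orb (a [^] (n::int))) (orb (b [^] (m::int))) \<le> C / 1000"
proof -
  define S where "S = (SUP (n::int, m::int). gromov_product x\<^sub>0 (orb (a [^] n)) (orb (b [^] m)))"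
  show "nrm a = 1000 * C" "nrm b \<le> C" using C_eq a_large by auto
  have 1: "1000 * (3 + S) < C" using C_eq a_large b_large[folded S_def] by simp
  with SUP_a_b_nonneg[folded S_def] show "3000 < C" by simp
  have "gromov_product x\<^sub>0 (orb (a [^] n)) (orb (b [^] m)) \<le> S"
    using cSUP_upper[OF UNIV_I a_b_bounded, of "(n, m)"] by (simp add: S_def)
  also have "\<dots> \<le> C / 1000" using 1 by simp
  finally show "gromov_product x\<^sub>0 (orb (a [^] n)) (orb (b [^] m)) \<le> C / 1000" .
qed

text \<open>Property (A) in terms of \<open>C\<close>: the length bound \<open>nrm a\<close> is
  \<open>1000 * C\<close>, and its millionth part is \<open>C / 1000\<close>.\<close>

definition A_path :: "'g \<Rightarrow> 'a list \<Rightarrow> bool"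
  where "A_path h zs \<longleftrightarrow> 2 \<le> length zs \<and> hd zs = x\<^sub>0 \<and> last zs = orb h \<and>
    local_chain (1000 * C) (C / 1000) (orb (inv a) # zs @ [orb (h \<otimes> a)])"

lemma PA_iff: "h \<in> PA \<longleftrightarrow> h \<in> carrier G \<and> (\<exists>zs. A_path h zs)"
proof -
  have 1: "disp act x\<^sub>0 a / 10 ^ 6 = C / 1000" by (simp add: nrm_a)
  have 2: "orb (inv a) \<in> hspace" "h \<in> carrier G \<Longrightarrow> orb (h \<otimes> a) \<in> hspace"
    using a_in by auto
  show ?thesis
  proof
    assume "h \<in> PA"
    hence "property_A G act x\<^sub>0 a h" by (simp add: PA_def)
    then obtain zs ps where h: "h \<in> carrier G"
      and zs: "2 \<le> length zs" "set zs \<subseteq> hspace" "hd zs = x\<^sub>0" "last zs = orb h"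
      and ps: "ps = orb (inv a) # zs @ [orb (h \<otimes> a)]"
        "\<forall>i. i + 1 < length ps \<longrightarrow> 1000 * C \<le> hdist (ps ! i) (ps ! (i + 1))"
        "\<forall>i. i + 2 < length ps \<longrightarrow> gromov_product (ps ! (i + 1)) (ps ! i) (ps ! (i + 2)) \<le> C / 1000"
      unfolding property_A_def 1 unfolding nrm_a by blast
    have "set ps \<subseteq> hspace" unfolding ps(1) using zs(2) 2 h by simp
    hence "local_chain (1000 * C) (C / 1000) ps" unfolding local_chain_def using ps(2,3) by blast
    thus "h \<in> carrier G \<and> (\<exists>zs. A_path h zs)" unfolding A_path_def using h zs ps(1) by blast
  next
    assume r: "h \<in> carrier G \<and> (\<exists>zs. A_path h zs)"
    then obtain zs where zs: "2 \<le> length zs" "hd zs = x\<^sub>0" "last zs = orb h"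
      "local_chain (1000 * C) (C / 1000) (orb (inv a) # zs @ [orb (h \<otimes> a)])"
      unfolding A_path_def by blast
    define ps where "ps = orb (inv a) # zs @ [orb (h \<otimes> a)]"
    have zh: "set zs \<subseteq> hspace" using zs(4) by (simp add: local_chain_def)
    have ch: "(\<forall>i. i + 1 < length ps \<longrightarrow> 1000 * C \<le> hdist (ps ! i) (ps ! (i + 1)))"
      "(\<forall>i. i + 2 < length ps \<longrightarrow> gromov_product (ps ! (i + 1)) (ps ! i) (ps ! (i + 2)) \<le> C / 1000)"
      using zs(4) unfolding local_chain_def ps_def[symmetric] by blast+
    have "property_A G act x\<^sub>0 a h"
      unfolding property_A_def 1 unfolding nrm_a using r zs(1-3) zh ch ps_def by blast
    thus "h \<in> PA" by (simp add: PA_def)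
  qed
qed

lemma PA_carrier: "h \<in> PA \<Longrightarrow> h \<in> carrier G"
  using PA_iff by blast

lemma local_chain_act:
  assumes g: "g \<in> carrier G" and ps: "local_chain L c ps"
  shows "local_chain L c (map (act g) ps)"
proof -
  have "ps ! i \<in> hspace" if "i < length ps" for i using that ps by (auto simp: local_chain_def)
  thus ?thesis using ps g unfolding local_chain_def
    by (auto simp: isometric gromov_product_act)
qed

lemma A_path_decomp:
  assumes "A_path h zs"
  obtains us where "us \<noteq> []" "zs = us @ [orb h]" "hd us = x\<^sub>0"
proof -
  have "2 \<le> length zs" "hd zs = x\<^sub>0" "last zs = orb h" using assms by (auto simp: A_path_def)
  thus thesis using that[of "butlast zs"]
    by (cases zs rule: rev_cases) (auto simp: hd_append Suc_le_eq)
qed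

text \<open>Translation by \<open>h1 \<otimes> a\<close> moves the padding point and the base point
  of the second path to \<open>orb h1\<close> and \<open>orb (h1 \<otimes> a)\<close>, the last two
  points of the padded first path. The two chains thus overlap as \<open>local_chain_append\<close>
  requires.\<close>

lemma A_path_mult:
  assumes h1: "h1 \<in> carrier G" "A_path h1 (us @ [orb h1])" and h2: "h2 \<in> carrier G" "A_path h2 zs"
    and us: "us \<noteq> []" "hd us = x\<^sub>0"
  shows "A_path (h1 \<otimes> a \<otimes> h2) (us @ orb h1 # map (act (h1 \<otimes> a)) zs)"
proof -
  obtain vs where vs: "zs = x\<^sub>0 # vs" "vs \<noteq> []"
    using h2 unfolding A_path_def by (cases zs) (auto simp: Suc_le_eq)
  define k where "k = h1 \<otimes> a"
  have k: "k \<in> carrier G" using h1 a_in by (simp add: k_def)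
  have ka: "act k (orb (inv a)) = orb h1"
    using act_mult[of k "inv a" x\<^sub>0] h1 a_in base_point k by (simp add: k_def m_assoc)
  have kh: "act k (orb h2) = orb (k \<otimes> h2)" "act k (orb (h2 \<otimes> a)) = orb (k \<otimes> h2 \<otimes> a)"
    using act_mult k h2 a_in base_point by (simp_all add: m_assoc)
  have "local_chain (1000 * C) (C / 1000) (map (act k) (orb (inv a) # zs @ [orb (h2 \<otimes> a)]))"
    using h2 k local_chain_act unfolding A_path_def by blast
  hence "local_chain (1000 * C) (C / 1000) (orb h1 # orb k # map (act k) vs @ [orb (k \<otimes> h2 \<otimes> a)])"
    by (simp add: vs ka kh)
  moreover have "local_chain (1000 * C) (C / 1000) ((orb (inv a) # us) @ [orb h1, orb k])"
    using h1 unfolding A_path_def k_def by simp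
  ultimately have "local_chain (1000 * C) (C / 1000)
     ((orb (inv a) # us) @ orb h1 # orb k # map (act k) vs @ [orb (k \<otimes> h2 \<otimes> a)])"
    by (rule local_chain_append[rotated])
  moreover have "last (map (act k) vs) = orb (k \<otimes> h2)"
    using h2 vs kh by (simp add: A_path_def last_map)
  ultimately show ?thesis using us vs
    by (cases us) (auto simp: A_path_def k_def)
qed

lemma PA_mult:
  assumes "h1 \<in> PA" "h2 \<in> PA" shows "h1 \<otimes> a \<otimes> h2 \<in> PA"
proof -
  obtain zs1 zs2 where z: "A_path h1 zs1" "A_path h2 zs2" "h1 \<in> carrier G" "h2 \<in> carrier G"
    using assms unfolding PA_iff by blast
  obtain us where "us \<noteq> []" "zs1 = us @ [orb h1]" "hd us = x\<^sub>0" using A_path_decomp[OF z(1)] .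
  with A_path_mult[of h1 us h2 zs2] z a_in show ?thesis unfolding PA_iff by auto
qed

text \<open>The constant \<open>c + 5\<close> of \<open>local_chain_gromov_product\<close> at
  \<open>c = C / 1000\<close>.\<close>

definition \<kappa> :: real where "\<kappa> = C / 1000 + 5"

lemma \<kappa>_bounds: "0 < \<kappa>" "\<kappa> \<le> C / 300"
  using C_large by (auto simp: \<kappa>_def)

lemma chain_\<kappa>:
  assumes "local_chain (1000 * C) (C / 1000) ps" "i < j" "j < k" "k < length ps"
  shows "gromov_product (ps ! j) (ps ! i) (ps ! k) \<le> \<kappa>"
  using local_chain_gromov_product[OF assms(1) _ assms(2-4)] C_large by (simp add: \<kappa>_def)

lemma PA_gromov_single:
  assumes "h \<in> PA" shows "gromov_product (orb h) x\<^sub>0 (orb (h \<otimes> a)) \<le> \<kappa>"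
proof -
  obtain zs where zs: "A_path h zs" using assms unfolding PA_iff by blast
  obtain us where us: "us \<noteq> []" "zs = us @ [orb h]" "hd us = x\<^sub>0" using A_path_decomp[OF zs] .
  define ps where "ps = orb (inv a) # zs @ [orb (h \<otimes> a)]"
  have "local_chain (1000 * C) (C / 1000) ps" using zs unfolding A_path_def ps_def by blast
  from chain_\<kappa>[OF this, of 1 "length us + 1" "length us + 2"]
  show ?thesis using us by (cases us) (auto simp: ps_def nth_append)
qed

text \<open>All points involved lie on the padded path of the product, a single local chain.\<close>

lemma PA_gromov_pair:
  assumes "h1 \<in> PA" "h2 \<in> PA"
  shows "gromov_product (orb h1) x\<^sub>0 (orb (h1 \<otimes> a \<otimes> h2)) \<le> \<kappa>"
    "gromov_product (orb (h1 \<otimes> a)) x\<^sub>0 (orb (h1 \<otimes> a \<otimes> h2)) \<le> \<kappa>"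
    "gromov_product (orb h1) x\<^sub>0 (orb (h1 \<otimes> a \<otimes> h2 \<otimes> a)) \<le> \<kappa>"
    "gromov_product (orb (h1 \<otimes> a)) x\<^sub>0 (orb (h1 \<otimes> a \<otimes> h2 \<otimes> a)) \<le> \<kappa>"
proof -
  obtain zs1 zs2 where z: "A_path h1 zs1" "A_path h2 zs2" "h1 \<in> carrier G" "h2 \<in> carrier G"
    using assms unfolding PA_iff by blast
  obtain us where us: "us \<noteq> []" "zs1 = us @ [orb h1]" "hd us = x\<^sub>0" using A_path_decomp[OF z(1)] .
  obtain vs where vs: "vs \<noteq> []" "zs2 = vs @ [orb h2]" "hd vs = x\<^sub>0" using A_path_decomp[OF z(2)] .
  define ps where "ps = orb (inv a) # (us @ orb h1 # map (act (h1 \<otimes> a)) zs2) @ [orb (h1 \<otimes> a \<otimes> h2 \<otimes> a)]"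
  have ch: "local_chain (1000 * C) (C / 1000) ps"
    using A_path_mult[of h1 us h2 zs2] z us unfolding A_path_def[of "h1 \<otimes> a \<otimes> h2"] ps_def by simp
  obtain us' vs' where uv: "us = x\<^sub>0 # us'" "vs = x\<^sub>0 # vs'"
    using us vs by (metis list.collapse)
  define n m where "n = length us'" and "m = length vs'"
  \<comment> \<open>Index 0 is the padding point \<open>orb (inv a)\<close>, so
    \<open>x\<^sub>0\<close> stands at index 1.\<close>
  have pos: "ps ! 1 = x\<^sub>0" "ps ! (n + 2) = orb h1" "ps ! (n + 3) = orb (h1 \<otimes> a)"
    by (simp_all add: ps_def uv vs n_def nth_append)
  have pos2: "ps ! (n + m + 4) = orb (h1 \<otimes> a \<otimes> h2)" "ps ! (n + m + 5) = orb (h1 \<otimes> a \<otimes> h2 \<otimes> a)"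
    using z a_in base_point by (simp_all add: ps_def uv vs n_def m_def nth_append act_mult)
  have len: "length ps = n + m + 6" by (simp add: ps_def uv vs n_def m_def)
  show "gromov_product (orb h1) x\<^sub>0 (orb (h1 \<otimes> a \<otimes> h2)) \<le> \<kappa>"
    "gromov_product (orb (h1 \<otimes> a)) x\<^sub>0 (orb (h1 \<otimes> a \<otimes> h2)) \<le> \<kappa>"
    "gromov_product (orb h1) x\<^sub>0 (orb (h1 \<otimes> a \<otimes> h2 \<otimes> a)) \<le> \<kappa>"
    "gromov_product (orb (h1 \<otimes> a)) x\<^sub>0 (orb (h1 \<otimes> a \<otimes> h2 \<otimes> a)) \<le> \<kappa>"
    using chain_\<kappa>[OF ch, of 1 "n + 2" "n + m + 4"] chain_\<kappa>[OF ch, of 1 "n + 3" "n + m + 4"]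
      chain_\<kappa>[OF ch, of 1 "n + 2" "n + m + 5"] chain_\<kappa>[OF ch, of 1 "n + 3" "n + m + 5"]
    by (auto simp: pos[simplified] pos2 len pos)
qed

lemma PA_nrm_a: "h \<in> PA \<Longrightarrow> nrm h + nrm a - 2 * \<kappa> \<le> nrm (h \<otimes> a)"
  using PA_gromov_single[of h] hdist_orb[of h a] PA_carrier[of h] a_in
    gromov_product_double[of "orb h" x\<^sub>0 "orb (h \<otimes> a)"] hdist_commute[of x\<^sub>0 "orb h"]
  by (simp add: disp_def)

lemma PA_nrm_mult:
  assumes "h1 \<in> PA" "h2 \<in> PA"
  shows "nrm h1 + nrm a + nrm h2 - 4 * \<kappa> \<le> nrm (h1 \<otimes> a \<otimes> h2)"
  using PA_gromov_pair(2)[OF assms] PA_nrm_a[OF assms(1)] hdist_orb[of "h1 \<otimes> a" h2]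
    PA_carrier[OF assms(1)] PA_carrier[OF assms(2)] a_in
    gromov_product_double[of "orb (h1 \<otimes> a)" x\<^sub>0 "orb (h1 \<otimes> a \<otimes> h2)"] hdist_commute[of x\<^sub>0 "orb (h1 \<otimes> a)"]
  by (simp add: disp_def)

text \<open>The connecting \<open>a\<close> contributes \<open>1000 * C\<close>, far more than the
  loss \<open>4 * \<kappa>\<close>; norms become superadditive without error, which bounds weights
  of products by products of weights.\<close>

lemma PA_nrm_add:
  assumes "h1 \<in> PA" "h2 \<in> PA"
  shows "nrm h1 + nrm h2 \<le> nrm (h1 \<otimes> a \<otimes> h2)"
  using PA_nrm_mult[OF assms] \<kappa>_bounds nrm_a C_large by linarith

end

section \<open>Words in the generators\<close>

context property_A_setting
begin

text \<open>Every letter is followed by \<open>a\<close>, the last one included, so that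
  concatenation becomes multiplication. Elements of \<open>F\<close> are such words followed by one
  bare letter.\<close>

primrec word :: "'g list \<Rightarrow> 'g"
  where "word [] = \<one>" | "word (x # xs) = x \<otimes> a \<otimes> word xs"

lemma word_carrier [simp]: "set xs \<subseteq> carrier G \<Longrightarrow> word xs \<in> carrier G"
  using a_in by (induction xs) auto

lemma word_append:
  "\<lbrakk>set xs \<subseteq> carrier G; set ys \<subseteq> carrier G\<rbrakk> \<Longrightarrow> word (xs @ ys) = word xs \<otimes> word ys"
  using a_in by (induction xs) (auto simp: m_assoc)

lemma word_snoc:
  "\<lbrakk>set xs \<subseteq> carrier G; x \<in> carrier G\<rbrakk> \<Longrightarrow> word (xs @ [x]) = word xs \<otimes> x \<otimes> a"
  using a_in by (simp add: word_append m_assoc)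

lemma PA_subset_carrier: "PA \<subseteq> carrier G"
  using PA_carrier by blast

lemma a_products_word:
  assumes "T \<subseteq> carrier G"
  shows "a_products G a T = {word xs \<otimes> x | xs x. set xs \<subseteq> T \<and> x \<in> T}"
proof (intro equalityI subsetI)
  fix f assume "f \<in> a_products G a T"
  thus "f \<in> {word xs \<otimes> x | xs x. set xs \<subseteq> T \<and> x \<in> T}"
  proof induction
    case (single g)
    thus ?case using assms by (auto intro!: exI[of _ "[]"] exI[of _ g])
  next
    case (step g w)
    then obtain xs x where x: "w = word xs \<otimes> x" "set xs \<subseteq> T" "x \<in> T" by blast
    hence "g \<otimes> a \<otimes> w = word (g # xs) \<otimes> x"
      using assms step.hyps a_in word_carrier[of xs] by (auto simp: m_assoc subset_iff)
    moreover have "set (g # xs) \<subseteq> T" using x step.hyps by simp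
    ultimately show ?case using x(3) by blast
  qed
next
  fix f assume "f \<in> {word xs \<otimes> x | xs x. set xs \<subseteq> T \<and> x \<in> T}"
  then obtain xs x where x: "f = word xs \<otimes> x" "set xs \<subseteq> T" "x \<in> T" by blast
  have "set xs \<subseteq> T \<Longrightarrow> word xs \<otimes> x \<in> a_products G a T" for xs
  proof (induction xs)
    case Nil
    thus ?case using x assms a_products.single[of x T G a] by (auto simp: subset_iff)
  next
    case (Cons g xs)
    have "word (g # xs) \<otimes> x = g \<otimes> a \<otimes> (word xs \<otimes> x)"
      using Cons.prems assms a_in x(3) word_carrier[of xs] by (auto simp: m_assoc subset_iff)
    thus ?case using Cons a_products.step[of g T "word xs \<otimes> x" G a] by simp
  qed
  thus "f \<in> a_products G a T" using x by blast
qed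

lemma word_last_PA:
  "\<lbrakk>set xs \<subseteq> PA; x \<in> PA\<rbrakk> \<Longrightarrow> word xs \<otimes> x \<in> PA"
proof (induction xs)
  case Nil
  thus ?case using PA_carrier by simp
next
  case (Cons g xs)
  have "word (g # xs) \<otimes> x = g \<otimes> a \<otimes> (word xs \<otimes> x)"
    using Cons.prems PA_subset_carrier a_in word_carrier[of xs] by (auto simp: m_assoc subset_iff)
  moreover have "word xs \<otimes> x \<in> PA" using Cons by simp
  ultimately show ?case using Cons.prems PA_mult[of g "word xs \<otimes> x"] by simp
qed

lemma word_PA_a:
  assumes "set xs \<subseteq> PA" "xs \<noteq> []"
  obtains w where "w \<in> PA" "word xs = w \<otimes> a"
proof -
  obtain ys y where xs: "xs = ys @ [y]" using assms(2) by (metis rev_exhaust)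
  have "word xs = word ys \<otimes> y \<otimes> a"
    unfolding xs using assms xs PA_subset_carrier by (intro word_snoc) auto
  moreover have "word ys \<otimes> y \<in> PA" using assms xs by (intro word_last_PA) auto
  ultimately show thesis using that by blast
qed

lemma gromov_product_end [simp]:
  "x \<in> hspace \<Longrightarrow> y \<in> hspace \<Longrightarrow> gromov_product y x y = 0"
  "x \<in> hspace \<Longrightarrow> y \<in> hspace \<Longrightarrow> gromov_product x x y = 0"
  by (simp_all add: gromov_product_def hdist_commute)

text \<open>There are two kinds of breakpoints: this one lies between a letter and its
  \<open>a\<close>; \<open>word_gromov\<close> treats the one behind the \<open>a\<close>.\<close>

lemma word_gromov_after:
  assumes "set xs \<subseteq> PA" "x \<in> PA" "set ys \<subseteq> PA"
  shows "gromov_product (orb (word xs \<otimes> x)) x\<^sub>0 (orb (word (xs @ x # ys))) \<le> \<kappa>"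
proof -
  define w where "w = word xs \<otimes> x"
  have w: "w \<in> PA" using assms by (simp only: w_def word_last_PA)
  have c: "set xs \<subseteq> carrier G" "x \<in> carrier G" "set ys \<subseteq> carrier G" "w \<in> carrier G"
    using assms w PA_subset_carrier by blast+
  have e: "word (xs @ x # ys) = w \<otimes> a \<otimes> word ys"
    using c a_in by (simp add: word_append w_def m_assoc)
  show ?thesis
  proof (cases "ys = []")
    case True
    thus ?thesis using PA_gromov_single[OF w] c a_in by (simp add: word_snoc w_def)
  next
    case False
    then obtain u where u: "u \<in> PA" "word ys = u \<otimes> a" using word_PA_a assms by blast
    have "word (xs @ x # ys) = w \<otimes> a \<otimes> u \<otimes> a"
      using c u PA_carrier[OF u(1)] a_in by (simp add: e m_assoc)
    thus ?thesis using PA_gromov_pair(3)[OF w u(1)] by (simp add: w_def)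
  qed
qed

lemma word_gromov:
  assumes "set xs \<subseteq> PA" "set ys \<subseteq> PA"
  shows "gromov_product (orb (word xs)) x\<^sub>0 (orb (word (xs @ ys))) \<le> \<kappa>"
proof -
  have c: "set xs \<subseteq> carrier G" "set ys \<subseteq> carrier G" using assms PA_subset_carrier by blast+
  show ?thesis
  proof (cases "xs = [] \<or> ys = []")
    case True
    thus ?thesis using \<kappa>_bounds(1) base_point c by (auto simp: act_one orb_in)
  next
    case False
    then obtain w where w: "w \<in> PA" "word xs = w \<otimes> a" using word_PA_a assms by blast
    obtain u where u: "u \<in> PA" "word ys = u \<otimes> a" using word_PA_a assms False by blast
    have "word (xs @ ys) = w \<otimes> a \<otimes> u \<otimes> a"
      using c w u PA_carrier[OF u(1)] PA_carrier[OF w(1)] a_in by (simp add: word_append m_assoc)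
    thus ?thesis using PA_gromov_pair(4)[OF w(1) u(1)] w by simp
  qed
qed

lemma nrm_word_letter:
  assumes "set xs \<subseteq> PA" "x \<in> PA"
  shows "nrm (word xs) + nrm x - 2 * \<kappa> \<le> nrm (word xs \<otimes> x)"
proof (cases "xs = []")
  case True
  thus ?thesis using \<kappa>_bounds(1) PA_carrier[OF assms(2)] base_point by (simp add: disp_def act_one)
next
  case False
  then obtain w where w: "w \<in> PA" "word xs = w \<otimes> a" using word_PA_a assms by blast
  thus ?thesis using PA_gromov_pair(2)[OF w(1) assms(2)] hdist_orb[of "w \<otimes> a" x]
      PA_carrier[OF w(1)] PA_carrier[OF assms(2)] a_in
      gromov_product_double[of "orb (w \<otimes> a)" x\<^sub>0 "orb (w \<otimes> a \<otimes> x)"] hdist_commute[of x\<^sub>0 "orb (w \<otimes> a)"]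
    by (simp add: disp_def)
qed

text \<open>The constant \<open>900 * C\<close> is \<open>nrm a = 1000 * C\<close> with ample room
  for the errors, which are small multiples of \<kappa>.\<close>

lemma nrm_word_snoc:
  assumes "set xs \<subseteq> PA" "x \<in> PA"
  shows "nrm (word xs) + nrm x + 900 * C \<le> nrm (word (xs @ [x]))"
    "nrm (word xs \<otimes> x) + 900 * C \<le> nrm (word (xs @ [x]))"
    "nrm (word (xs @ [x])) \<le> nrm (word xs \<otimes> x) + 1000 * C"
    "nrm (word (xs @ [x])) \<le> nrm (word xs) + nrm x + 1000 * C"
proof -
  have c: "set xs \<subseteq> carrier G" "x \<in> carrier G" using assms PA_subset_carrier by blast+
  have e: "word (xs @ [x]) = word xs \<otimes> x \<otimes> a" using word_snoc c by blast
  note f = PA_nrm_a[OF word_last_PA[OF assms]] nrm_word_letter[OF assms] nrm_a \<kappa>_bounds C_large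
    nrm_mult[of "word xs" x] nrm_mult[of "word xs \<otimes> x" a] c a_in
  show "nrm (word xs) + nrm x + 900 * C \<le> nrm (word (xs @ [x]))"
    "nrm (word xs \<otimes> x) + 900 * C \<le> nrm (word (xs @ [x]))"
    "nrm (word (xs @ [x])) \<le> nrm (word xs \<otimes> x) + 1000 * C"
    "nrm (word (xs @ [x])) \<le> nrm (word xs) + nrm x + 1000 * C"
    using f unfolding e by auto
qed

lemma nrm_word_mono:
  assumes "set xs \<subseteq> PA" "set ys \<subseteq> PA"
  shows "nrm (word xs) \<le> nrm (word (xs @ ys))"
  using assms(2)
proof (induction ys rule: rev_induct)
  case (snoc y ys)
  have "nrm (word (xs @ ys)) + nrm y + 900 * C \<le> nrm (word ((xs @ ys) @ [y]))"
    using snoc assms by (intro nrm_word_snoc) auto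
  thus ?case using snoc C_large nrm_nonneg[OF PA_carrier, of y] by simp
qed simp

end

lemma list_first_failure:
  assumes "Q []" "\<not> Q ys"
  obtains ys1 t ys2 where "ys = ys1 @ t # ys2" "Q ys1" "\<not> Q (ys1 @ [t])"
proof -
  have "\<not> Q ys \<Longrightarrow> \<exists>ys1 t ys2. ys = ys1 @ t # ys2 \<and> Q ys1 \<and> \<not> Q (ys1 @ [t])"
  proof (induction ys rule: rev_induct)
    case Nil thus ?case using assms(1) by simp
  next
    case (snoc y ys)
    thus ?case by (cases "Q ys") fastforce+
  qed
  thus thesis using assms(2) that by blast
qed

section \<open>Geometry of the generators\<close>

context F_construction
begin

definition Gens :: "'g set" where "Gens = K \<union> gen ` {1..}"

lemma gen_Gens [simp]: "k \<ge> 1 \<Longrightarrow> gen k \<in> Gens"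
  by (simp add: Gens_def)

abbreviation \<psi> :: "nat \<Rightarrow> 'g" where "\<psi> k \<equiv> \<Phi> (\<phi> k)"

lemma \<phi>_carrier: "k \<ge> 1 \<Longrightarrow> \<phi> k \<in> carrier G"
  using \<phi>[of k] by (auto simp: outside_orbit_def)

lemma gam_carrier: "k \<ge> 1 \<Longrightarrow> gam k \<in> carrier G"
  using enumeration by (metis atLeast_iff imageI)

lemma \<psi>_PA: "k \<ge> 1 \<Longrightarrow> \<psi> k \<in> PA" and \<Phi>_gam_PA: "k \<ge> 1 \<Longrightarrow> \<Phi> (gam k) \<in> PA"
  using \<Phi>_A \<phi>_carrier gam_carrier by (auto simp: PA_def)

lemma gen_PA: "k \<ge> 1 \<Longrightarrow> gen k \<in> PA"
  using PA_mult[OF \<psi>_PA \<Phi>_gam_PA] gen_eq by simp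

lemma Gens_PA: "Gens \<subseteq> PA"
  using K_sub \<Phi>_A gen_PA by (auto simp: Gens_def PA_def)

lemma Gens_carrier: "Gens \<subseteq> carrier G"
  using Gens_PA PA_subset_carrier by blast

text \<open>For \<open>R 0 \<le> 0\<close> the norm ball would be empty, against the positive lower
  bound on its cardinality in \<open>R\<^sub>0_count\<close>.\<close>

lemma R_pos: "0 < R k"
proof (induction k)
  case 0
  show ?case
  proof (rule ccontr)
    assume "\<not> 0 < R 0"
    hence "norm_ball G act x\<^sub>0 (R 0) = {}"
      using nrm_nonneg by (force simp: norm_ball_def)
    thus False using R\<^sub>0_count
      by (metis card.empty exp_gt_zero inf_bot_left not_le of_nat_0)
  qed
next
  case (Suc k)
  thus ?case using R_growth[of "Suc k"] by simp
qed

lemma nrm_\<phi>: "k \<ge> 1 \<Longrightarrow> R k + 2500 * C \<le> nrm (\<phi> k)"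
  using \<phi>[of k] \<phi>_carrier[of k] by (auto simp: norm_ball_def)

text \<open>All cases of \<open>\<Phi>\<close> on long elements are covered uniformly by letting
  \<open>b1\<close> and \<open>b2\<close> be \<open>\<one>\<close> or \<open>b\<close>.\<close>

lemma \<Phi>_form:
  assumes "g \<in> carrier G" "1000 * C \<le> nrm g"
  obtains b1 b2 where "b1 \<in> carrier G" "b2 \<in> carrier G" "nrm b1 \<le> C" "nrm b2 \<le> C" "\<Phi> g = b1 \<otimes> g \<otimes> b2"
proof -
  have n1: "nrm \<one> \<le> C" using C_large base_point by (simp add: disp_def act_one)
  have "\<Phi> g \<in> {\<one> \<otimes> g \<otimes> \<one>, b \<otimes> g \<otimes> \<one>, \<one> \<otimes> g \<otimes> b, b \<otimes> g \<otimes> b}"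
    using \<Phi>_id[of g] \<Phi>_long[of g] assms nrm_a b_in by auto
  thus thesis using that n1 nrm_b b_in one_closed by blast
qed

lemma nrm_\<psi>:
  assumes k: "k \<ge> 1" shows "R k + 2498 * C \<le> nrm (\<psi> k)"
proof -
  have large: "1000 * C \<le> nrm (\<phi> k)" using nrm_\<phi>[OF k] R_pos[of k] C_large by linarith
  obtain b1 b2 where b: "b1 \<in> carrier G" "b2 \<in> carrier G" "nrm b1 \<le> C" "nrm b2 \<le> C" "\<psi> k = b1 \<otimes> \<phi> k \<otimes> b2"
    using \<Phi>_form[OF \<phi>_carrier[OF k] large] .
  have "\<phi> k = inv b1 \<otimes> \<psi> k \<otimes> inv b2"
    using b(1,2) \<phi>_carrier[OF k] by (simp add: b(5) m_assoc inv_solve_left)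
  hence "nrm (\<phi> k) \<le> nrm (inv b1) + nrm (\<psi> k) + nrm (inv b2)"
    using nrm_mult[of "inv b1 \<otimes> \<psi> k" "inv b2"] nrm_mult[of "inv b1" "\<psi> k"] b(1,2) PA_carrier[OF \<psi>_PA[OF k]]
    by simp
  thus ?thesis using nrm_\<phi>[OF k] b nrm_inv by simp
qed

text \<open>The orbit-avoiding segment of \<open>\<phi> k\<close>, moved by
  \<open>p \<otimes> b1\<close>, has its ends \<open>x'\<close>, \<open>y'\<close> near
  \<open>p\<close> and \<open>p \<otimes> \<psi> k\<close>. Avoidance and
  \<open>near_geodesic\<close> make the product of \<open>x'\<close> and \<open>y'\<close> at
  \<open>v\<close> at least \<open>10 * C - 5\<close>. If \<open>v\<close> were far from both ends,
  two four-point inequalities would transfer a bound \<open>C - 5\<close> to the product of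
  \<open>p\<close> and \<open>p \<otimes> \<psi> k\<close>.\<close>

lemma outside_middle:
  assumes k: "k \<ge> 1" and p: "p \<in> carrier G" and v: "v \<in> carrier G"
    and gp: "gromov_product (orb v) (orb p) (orb (p \<otimes> \<psi> k)) \<le> C / 2"
  shows "hdist (orb v) (orb p) < 12 * C \<or> hdist (orb v) (orb (p \<otimes> \<psi> k)) < 12 * C"
proof (rule ccontr)
  assume "\<not> ?thesis"
  hence far: "12 * C \<le> hdist (orb v) (orb p)" "12 * C \<le> hdist (orb v) (orb (p \<otimes> \<psi> k))" by auto
  have large: "1000 * C \<le> nrm (\<phi> k)" using nrm_\<phi>[OF k] R_pos[of k] C_large by linarith
  obtain b1 b2 where b: "b1 \<in> carrier G" "b2 \<in> carrier G" "nrm b1 \<le> C" "nrm b2 \<le> C" "\<psi> k = b1 \<otimes> \<phi> k \<otimes> b2"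
    using \<Phi>_form[OF \<phi>_carrier[OF k] large] .
  note \<phi>c = \<phi>_carrier[OF k]
  obtain x y where x: "x \<in> hspace" "hdist x x\<^sub>0 \<le> 10 * C" and y: "y \<in> hspace" "hdist y (orb (\<phi> k)) \<le> 10 * C"
    and out: "\<And>z p. z \<in> closed_segment x y \<Longrightarrow> p \<in> orbit G act x\<^sub>0 \<Longrightarrow> 10 * C \<le> hdist z p"
    using \<phi>[OF k] unfolding outside_orbit_def geodesic_segment_def by blast
  define q where "q = p \<otimes> b1"
  have q: "q \<in> carrier G" using p b by (simp add: q_def)
  define x' y' where "x' = act q x" and "y' = act q y"
  have h: "x' \<in> hspace" "y' \<in> hspace" "orb v \<in> hspace" "orb p \<in> hspace" "orb q \<in> hspace"
    "orb (q \<otimes> \<phi> k) \<in> hspace" "orb (p \<otimes> \<psi> k) \<in> hspace"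
    using x y q v p \<phi>c PA_carrier[OF \<psi>_PA[OF k]] by (auto simp: x'_def y'_def)
  \<comment> \<open>The \<open>11 * C\<close> consists of \<open>10 * C\<close> from
    \<open>outside_orbit\<close> and \<open>C\<close> from the correction \<open>b1\<close>;
    likewise \<open>b2\<close> at the other end.\<close>
  have dx: "hdist x' (orb p) \<le> 11 * C"
  proof -
    have "hdist x' (orb q) \<le> 10 * C" using x q base_point by (simp add: x'_def isometric)
    moreover have "hdist (orb q) (orb p) \<le> C"
      using hdist_orb[of p b1] p b by (simp add: q_def hdist_commute)
    ultimately show ?thesis using hdist_triangle[OF h(1,5,4)] by linarith
  qed
  have dy: "hdist y' (orb (p \<otimes> \<psi> k)) \<le> 11 * C"
  proof -
    have "hdist y' (orb (q \<otimes> \<phi> k)) \<le> 10 * C"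
      using y q base_point \<phi>c by (simp add: y'_def isometric act_mult orb_in)
    moreover have "p \<otimes> \<psi> k = q \<otimes> \<phi> k \<otimes> b2" using p b \<phi>c by (simp add: q_def m_assoc)
    hence "hdist (orb (q \<otimes> \<phi> k)) (orb (p \<otimes> \<psi> k)) \<le> C"
      using hdist_orb[of "q \<otimes> \<phi> k" b2] q b \<phi>c by simp
    ultimately show ?thesis using hdist_triangle[OF h(2,6,7)] by linarith
  qed
  obtain z where z: "z \<in> closed_segment x' y'" "hdist (orb v) z \<le> gromov_product (orb v) x' y' + 5"
    using near_geodesic[OF h(1-3)] .
  obtain z' where z': "z' \<in> closed_segment x y" "z = act q z'"
    using z(1) act_closed_segment[OF q x(1) y(1)] unfolding x'_def y'_def by blast
  have "orb v = act q (orb (inv q \<otimes> v))"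
    using q v base_point by (simp add: m_assoc[symmetric] flip: act_mult)
  hence "hdist (orb v) z = hdist (orb (inv q \<otimes> v)) z'"
    using q v z' closed_segment_additive(1)[OF x(1) y(1) z'(1)] by (simp add: isometric orb_in)
  moreover have "orb (inv q \<otimes> v) \<in> orbit G act x\<^sub>0" using q v by (auto simp: orbit_def)
  ultimately have "10 * C \<le> gromov_product (orb v) x' y' + 5"
    using out[OF z'(1), of "orb (inv q \<otimes> v)"] z(2) hdist_commute[of z' "orb (inv q \<otimes> v)"] by simp
  moreover have "C \<le> gromov_product (orb v) (orb p) x'"
    using far(1) dx hdist_triangle[OF h(3,1,4)] gromov_product_double[of "orb v" "orb p" x']
      hdist_commute[of x' "orb p"] by linarith
  moreover have "C \<le> gromov_product (orb v) y' (orb (p \<otimes> \<psi> k))"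
    using far(2) dy hdist_triangle[OF h(3,2,7)] gromov_product_double[of "orb v" y' "orb (p \<otimes> \<psi> k)"]
    by linarith
  moreover note gromov_product_four_point[OF h(3,4,1,2)] gromov_product_four_point[OF h(3,4,2,7)]
  ultimately show False using gp C_large by linarith
qed

text \<open>As \<open>gen i\<close> is itself a product of two elements with Property (A), the end
  of its part \<open>\<psi> i\<close> counts as a breakpoint too.\<close>

lemma word_gen_split:
  assumes "set zs1 \<subseteq> Gens" "set zs2 \<subseteq> Gens" "i \<ge> 1"
  shows "word (zs1 @ gen i # zs2) = word (zs1 @ \<psi> i # \<Phi> (gam i) # zs2)"
proof -
  have "set zs1 \<subseteq> carrier G" "set zs2 \<subseteq> carrier G" using assms Gens_carrier by blast+
  thus ?thesis using assms(3) PA_carrier[OF \<psi>_PA] PA_carrier[OF \<Phi>_gam_PA] a_in gen_eq gen_PA PA_carrier[OF gen_PA]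
    by (simp add: word_append m_assoc)
qed

text \<open>The points of \<open>v\<close>, \<open>P\<close> and \<open>Q\<close> are all almost on
  the geodesic to \<open>Y\<close>, so their norms act as positions and \<open>v\<close> is almost
  between \<open>P\<close> and \<open>Q\<close>. Then \<open>outside_middle\<close> puts
  \<open>v\<close> within \<open>12 * C\<close> of one of them, while the positions differ by about
  \<open>13 * C\<close>.\<close>

lemma no_middle_breakpoint:
  assumes zs: "set zs1 \<subseteq> Gens" "set zs2 \<subseteq> Gens" "i \<ge> 1" and v: "v \<in> carrier G"
    and on: "gromov_product (orb v) x\<^sub>0 (orb (word (zs1 @ gen i # zs2))) \<le> \<kappa>"
    and pos: "nrm (word zs1) + 13 * C \<le> nrm v" "nrm v \<le> nrm (word zs1) + nrm (\<psi> i) - 13 * C"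
  shows False
proof -
  define Y where "Y = orb (word (zs1 @ gen i # zs2))"
  define P where "P = word zs1"
  define Q where "Q = P \<otimes> \<psi> i"
  have PAs: "set zs1 \<subseteq> PA" "set zs2 \<subseteq> PA" using zs Gens_PA by blast+
  hence cs: "set zs1 \<subseteq> carrier G" "set zs2 \<subseteq> carrier G" using PA_subset_carrier by blast+
  hence c: "P \<in> carrier G" "\<psi> i \<in> carrier G" "Q \<in> carrier G" "set zs1 \<subseteq> PA" "set zs2 \<subseteq> PA"
    "set zs1 \<subseteq> carrier G" "set zs2 \<subseteq> carrier G"
    using PAs PA_carrier[OF \<psi>_PA[OF zs(3)]] unfolding P_def Q_def by auto
  have Ysplit: "Y = orb (word (zs1 @ \<psi> i # \<Phi> (gam i) # zs2))"
    using word_gen_split[OF zs] by (simp add: Y_def)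
  have h: "orb P \<in> hspace" "orb Q \<in> hspace" "orb v \<in> hspace" "Y \<in> hspace"
    using c v zs PA_carrier[OF gen_PA[OF zs(3)]] by (auto simp: Y_def)
  have onP: "gromov_product (orb P) x\<^sub>0 Y \<le> \<kappa>"
    unfolding Ysplit P_def using c \<psi>_PA \<Phi>_gam_PA zs by (intro word_gromov) auto
  have onQ: "gromov_product (orb Q) x\<^sub>0 Y \<le> \<kappa>"
    unfolding Ysplit P_def Q_def using c \<psi>_PA \<Phi>_gam_PA zs by (intro word_gromov_after) auto
  have onv: "gromov_product (orb v) x\<^sub>0 Y \<le> \<kappa>" using on by (simp add: Y_def)
  have PQ: "hdist (orb P) (orb Q) = nrm (\<psi> i)" using hdist_orb c by (simp add: Q_def)
  have Qpos: "nrm P + nrm (\<psi> i) - 2 * \<kappa> \<le> nrm Q" "nrm Q \<le> nrm P + nrm (\<psi> i)"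
    using nrm_word_letter[OF c(4) \<psi>_PA[OF zs(3)]] nrm_mult c by (simp_all add: P_def Q_def)
  have dP: "hdist (orb v) (orb P) \<le> \<bar>nrm v - nrm P\<bar> + 2 * \<kappa> + 5"
    using hdist_le_of_positions[OF base_point h(4,3,1) onv onP] by (simp add: disp_def)
  have dQ: "hdist (orb v) (orb Q) \<le> \<bar>nrm v - nrm Q\<bar> + 2 * \<kappa> + 5"
    using hdist_le_of_positions[OF base_point h(4,3,2) onv onQ] by (simp add: disp_def)
  have pos': "nrm P + 13 * C \<le> nrm v" "nrm v \<le> nrm P + nrm (\<psi> i) - 13 * C" using pos by (auto simp: P_def)
  have "gromov_product (orb v) (orb P) (orb Q) \<le> C / 2"
    using dP dQ PQ Qpos pos' gromov_product_double[of "orb v" "orb P" "orb Q"] \<kappa>_bounds C_large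
    by linarith
  hence "hdist (orb v) (orb P) < 12 * C \<or> hdist (orb v) (orb Q) < 12 * C"
    using outside_middle[OF zs(3) c(1) v] by (simp add: Q_def)
  moreover have "nrm v \<le> nrm P + hdist (orb v) (orb P)" "nrm Q \<le> nrm v + hdist (orb v) (orb Q)"
    using hdist_triangle[OF base_point h(1,3)] hdist_triangle[OF base_point h(3,2)]
    by (simp_all add: disp_def hdist_commute)
  ultimately show False using pos' Qpos \<kappa>_bounds C_large by linarith
qed

lemma nrm_letter_less:
  assumes "k \<ge> 1" "t \<in> K \<or> (\<exists>j. 1 \<le> j \<and> j < k \<and> t = gen j)"
  shows "nrm t < R k - 10 ^ 4 * C"
proof -
  have "t \<in> K \<union> gen ` {1..<k}" using assms(2) by auto
  thus ?thesis using R_gens[OF assms(1)] by (auto simp: norm_ball_def)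
qed

lemma nrm_gen: "k \<ge> 1 \<Longrightarrow> nrm (\<psi> k) \<le> nrm (gen k)"
  using PA_nrm_add[OF \<psi>_PA \<Phi>_gam_PA] gen_eq nrm_nonneg[OF PA_carrier[OF \<Phi>_gam_PA]]
  by (smt (verit))

section \<open>Synchronisation of different spellings\<close>

text \<open>
  A position at which one spelling of an element has the letter \<open>gen i\<close> carries that letter in every
  spelling: breakpoints of a spelling lie near the orbit, so none of them is in the middle of the
  segment belonging to \<open>\<phi> i\<close>, and only a letter \<open>gen j\<close> with \<open>j \<ge> i\<close> can cover it.  If that
  letter starts earlier, induction gives it in the first spelling as well, where it overlaps \<open>gen i\<close>.
\<close>
lemma spelling_sync:
  assumes "set xs1 \<subseteq> Gens" "set xs2 \<subseteq> Gens" "set ys \<subseteq> Gens" "i \<ge> 1"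
    and "word (xs1 @ gen i # xs2) = word ys"
  shows "\<exists>ys1 ys2. ys = ys1 @ gen i # ys2 \<and> \<bar>nrm (word xs1) - nrm (word ys1)\<bar> \<le> 13 * C"
  using assms
\<comment> \<open>The position is measured in units of \<open>C\<close> and rounded up, so moving
  back by more than \<open>13 * C\<close> decreases the measure.\<close>
proof (induction "nat \<lceil>nrm (word xs1) / C\<rceil>" arbitrary: xs1 xs2 ys i rule: less_induct)
  case less
  note xs = less.prems(1,2) and ys = less.prems(3) and i = less.prems(4) and eq = less.prems(5)
  define P where "P = nrm (word xs1)"
  note Gi = gen_PA[OF i]
  have PAs: "set xs1 \<subseteq> PA" "set xs2 \<subseteq> PA" "set ys \<subseteq> PA" using xs ys Gens_PA by blast+
  have ps: "R i + 2498 * C \<le> nrm (\<psi> i)" "nrm (\<psi> i) \<le> nrm (gen i)" "0 < R i"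
    using nrm_\<psi> nrm_gen i R_pos by auto
  have end_i: "P + nrm (gen i) + 900 * C \<le> nrm (word (xs1 @ [gen i]))"
    "nrm (word (xs1 @ [gen i])) \<le> P + nrm (gen i) + 1000 * C"
    using nrm_word_snoc[OF PAs(1) Gi] by (simp_all add: P_def)
  have "nrm (word (xs1 @ [gen i])) \<le> nrm (word ((xs1 @ [gen i]) @ xs2))"
    using PAs Gi by (intro nrm_word_mono) auto
  hence total: "P + 13 * C < nrm (word ys)" using end_i ps C_large eq by simp
  have "nrm (word []) \<le> P + 13 * C"
    using base_point C_large nrm_nonneg[of "word xs1"] PAs PA_subset_carrier
    by (simp add: P_def disp_def act_one)
  \<comment> \<open>The letter \<open>t\<close> is the one that crosses the position
    \<open>P + 13 * C\<close>, just inside the segment of \<open>\<psi> i\<close>.\<close>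
  then obtain ys1 t ys2 where split: "ys = ys1 @ t # ys2"
    and Q_le: "nrm (word ys1) \<le> P + 13 * C" and next_gt: "P + 13 * C < nrm (word (ys1 @ [t]))"
    using list_first_failure[of "\<lambda>l. nrm (word l) \<le> P + 13 * C" ys] total by (metis not_le)
  have t: "t \<in> Gens" "t \<in> PA" "set ys1 \<subseteq> Gens" "set ys2 \<subseteq> Gens" "set ys1 \<subseteq> PA" "set ys2 \<subseteq> PA"
    using ys PAs split by auto
  have tc: "t \<in> carrier G" "set ys1 \<subseteq> carrier G" using t PA_subset_carrier by auto
  define Q where "Q = nrm (word ys1)"
  define e where "e = word ys1 \<otimes> t"
  have ec: "e \<in> carrier G" using tc by (simp add: e_def)
  have on_e: "gromov_product (orb e) x\<^sub>0 (orb (word (xs1 @ gen i # xs2))) \<le> \<kappa>"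
    unfolding eq split e_def using t by (intro word_gromov_after)
  have on_next: "gromov_product (orb (word (ys1 @ [t]))) x\<^sub>0 (orb (word (xs1 @ gen i # xs2))) \<le> \<kappa>"
    using word_gromov[of "ys1 @ [t]" ys2] t unfolding eq split by simp
  have nc: "word (ys1 @ [t]) \<in> carrier G" using tc by simp
  \<comment> \<open>A breakpoint beyond the beginning of the forbidden zone must be beyond its end.
    The same is then shown for \<open>e\<close>, the breakpoint before the final \<open>a\<close> of
    \<open>t\<close>.\<close>
  have next_ge: "P + nrm (\<psi> i) - 13 * C < nrm (word (ys1 @ [t]))"
    using no_middle_breakpoint[OF xs i nc on_next] next_gt by (fastforce simp: P_def)
  have "nrm (word (ys1 @ [t])) \<le> nrm e + 1000 * C"
    unfolding e_def using nrm_word_snoc(3) t by blast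
  hence "P + 13 * C \<le> nrm e" using next_ge ps C_large by linarith
  hence e_ge: "P + nrm (\<psi> i) - 13 * C < nrm e"
    using no_middle_breakpoint[OF xs i ec on_e] by (fastforce simp: P_def)
  have e_le: "nrm e \<le> Q + nrm t" using nrm_mult[of "word ys1" t] tc by (simp add: e_def Q_def)
  \<comment> \<open>So \<open>t\<close> spans nearly all of \<open>\<psi> i\<close>, which letters
    of earlier stages are too short to do.\<close>
  have "R i \<le> nrm t" using e_ge e_le Q_le ps C_large unfolding Q_def by linarith
  hence short: "\<not> (t \<in> K \<or> (\<exists>j. 1 \<le> j \<and> j < i \<and> t = gen j))"
    using nrm_letter_less[OF i, of t] C_large by auto
  then obtain j where j: "t = gen j" "j \<ge> 1" "i \<le> j"
    using t(1) unfolding Gens_def by (auto simp: not_less)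
  show ?case
  proof (cases "Q < P - 13 * C")
    case True
    have cpos: "0 < C" using C_large by simp
    have "0 \<le> Q" using nrm_nonneg tc by (simp add: Q_def)
    have "(Q + 13 * C) / C < P / C" using True cpos by (intro divide_strict_right_mono) auto
    hence "Q / C + 13 < P / C" using cpos by (simp add: add_divide_distrib)
    moreover have "0 \<le> Q / C" using \<open>0 \<le> Q\<close> cpos by simp
    ultimately have "\<lceil>Q / C\<rceil> < \<lceil>P / C\<rceil>" "0 \<le> \<lceil>Q / C\<rceil>" by linarith+
    hence "nat \<lceil>nrm (word ys1) / C\<rceil> < nat \<lceil>nrm (word xs1) / C\<rceil>"
      unfolding P_def Q_def by linarith
    \<comment> \<open>The roles of the spellings are exchanged: the early letter
      \<open>gen j\<close> of \<open>ys\<close> must recur in the first spelling, starting before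
      \<open>P\<close>.\<close>
    from less.hyps[OF this t(3,4) _ j(2), of "xs1 @ gen i # xs2"]
    obtain us1 us2 where us: "xs1 @ gen i # xs2 = us1 @ gen j # us2" "\<bar>Q - nrm (word us1)\<bar> \<le> 13 * C"
      using xs i eq split j(1) unfolding Q_def by auto
    have us1_lt: "nrm (word us1) < P" using us(2) True by linarith
    have usG: "set us1 \<subseteq> PA" using us(1) PAs Gi
      by (metis (mono_tags, lifting) Un_subset_iff insert_subset list.simps(15) set_append)
    consider w where "us1 = xs1 @ w" | w where "xs1 = us1 @ w" "gen j # us2 = w @ gen i # xs2"
      using us(1) by (metis append_eq_append_conv2)
    thus ?thesis
    proof cases
      case 1
      hence "P \<le> nrm (word us1)" using nrm_word_mono[OF PAs(1), of w] usG by (simp add: P_def)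
      thus ?thesis using us1_lt by simp
    next
      case 2
      show ?thesis
      proof (cases w)
        case Nil
        thus ?thesis using 2 us1_lt by (simp add: P_def)
      next
        case (Cons w1 ws)
        hence xs1: "xs1 = (us1 @ [gen j]) @ ws" using 2 by simp
        have "nrm (word (us1 @ [gen j])) \<le> P"
          using nrm_word_mono[of "us1 @ [gen j]" ws] PAs(1) xs1 by (simp add: P_def)
        \<comment> \<open>In the first spelling \<open>gen j\<close> ends before position
          \<open>P\<close>, yet in \<open>ys\<close> it reaches almost to
          \<open>P + nrm (\<psi> i)\<close> from nearly the same start.\<close>
        moreover have "nrm (word us1) + nrm (gen j) + 900 * C \<le> nrm (word (us1 @ [gen j]))"
          using nrm_word_snoc(1)[OF usG gen_PA[OF j(2)]] .
        ultimately show ?thesis using e_ge e_le us(2) ps C_large unfolding j(1) by linarith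
      qed
    qed
  next
    case False
    \<comment> \<open>If \<open>j\<close> were larger, then \<open>gen i\<close>, much shorter than
      \<open>\<psi> j\<close>, would end inside the forbidden zone of \<open>gen j\<close>.\<close>
    have "j = i"
    proof (rule ccontr)
      assume "j \<noteq> i"
      hence ij: "i < j" using j by simp
      define v where "v = word (xs1 @ [gen i])"
      have vc: "v \<in> carrier G" using PAs(1) Gi PA_subset_carrier unfolding v_def by (intro word_carrier) auto
      have "gromov_product (orb v) x\<^sub>0 (orb (word ((xs1 @ [gen i]) @ xs2))) \<le> \<kappa>"
        unfolding v_def using PAs Gi by (intro word_gromov) auto
      hence on_v: "gromov_product (orb v) x\<^sub>0 (orb (word (ys1 @ gen j # ys2))) \<le> \<kappa>"
        using eq split j(1) by simp
      have "nrm (gen i) < R j - 10 ^ 4 * C" using nrm_letter_less[OF j(2)] i ij by blast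
      moreover have "R j + 2498 * C \<le> nrm (\<psi> j)" using nrm_\<psi>[OF j(2)] .
      ultimately show False
        using no_middle_breakpoint[OF t(3,4) j(2) vc on_v] end_i ps False Q_le C_large
        unfolding v_def[symmetric] Q_def by simp
    qed
    thus ?thesis using False Q_le split j(1) unfolding P_def Q_def by fastforce
  qed
qed

text \<open>By \<open>spelling_sync\<close> the first \<open>gen k\<close> of one spelling is
  matched in the other, where it cannot come before the end of the prefix avoiding
  \<open>gen k\<close>. By symmetry the norms of both prefixes differ by at most
  \<open>13 * C\<close>, and prefixes almost on one geodesic at similar positions are close.\<close>

lemma first_gen_close:
  assumes w: "set xs \<subseteq> Gens - {gen k}" "set xs' \<subseteq> Gens - {gen k}" "set zs \<subseteq> Gens" "set zs' \<subseteq> Gens" and k: "k \<ge> 1"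
    and eq: "word (xs @ gen k # zs) = word (xs' @ gen k # zs')"
  shows "hdist (orb (word xs)) (orb (word xs')) \<le> 14 * C"
proof -
  have half: "nrm (word us') \<le> nrm (word us) + 13 * C"
    if w: "set us \<subseteq> Gens - {gen k}" "set us' \<subseteq> Gens - {gen k}" "set vs \<subseteq> Gens" "set vs' \<subseteq> Gens"
    and eq: "word (us @ gen k # vs) = word (us' @ gen k # vs')" for us us' vs vs'
  proof -
    obtain ys1 ys2 where ys: "us' @ gen k # vs' = ys1 @ gen k # ys2" "\<bar>nrm (word us) - nrm (word ys1)\<bar> \<le> 13 * C"
      using spelling_sync[of us vs "us' @ gen k # vs'" k] w eq k by auto
    obtain w' where "ys1 = us' @ w'"
    proof -
      from ys(1) consider w' where "ys1 = us' @ w'" | w' where "us' = ys1 @ w'" "gen k # ys2 = w' @ gen k # vs'"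
        by (metis append_eq_append_conv2)
      thus thesis
      proof cases
        case 2
        thus thesis using that[of "[]"] w(2) by (cases w') auto
      qed (use that in blast)
    qed
    moreover have "set ys1 \<subseteq> Gens"
    proof -
      have "set ys1 \<subseteq> set (us' @ gen k # vs')" unfolding ys(1) by auto
      also have "\<dots> \<subseteq> Gens" using w gen_Gens[OF k] by auto
      finally show ?thesis .
    qed
    ultimately have "nrm (word us') \<le> nrm (word ys1)"
      using nrm_word_mono[of us' w'] Gens_PA by auto
    thus ?thesis using ys(2) by linarith
  qed
  have PAs: "set xs \<subseteq> PA" "set xs' \<subseteq> PA" "set zs \<subseteq> PA" "set zs' \<subseteq> PA" "gen k \<in> PA"
    using w Gens_PA gen_PA[OF k] by auto
  define Y where "Y = orb (word (xs @ gen k # zs))"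
  have on: "gromov_product (orb (word xs)) x\<^sub>0 Y \<le> \<kappa>" "gromov_product (orb (word xs')) x\<^sub>0 Y \<le> \<kappa>"
    using word_gromov[of xs "gen k # zs"] word_gromov[of xs' "gen k # zs'"] PAs eq by (auto simp: Y_def)
  have h: "orb (word xs) \<in> hspace" "orb (word xs') \<in> hspace" "Y \<in> hspace"
    using PAs PA_subset_carrier by (auto simp: Y_def subset_iff intro!: orb_in word_carrier)
  have "hdist (orb (word xs)) (orb (word xs')) \<le> \<bar>nrm (word xs) - nrm (word xs')\<bar> + 2 * \<kappa> + 5"
    using hdist_le_of_positions[OF base_point h(3,1,2) on] by (simp add: disp_def)
  thus ?thesis using half[OF w(1,2,3,4) eq] half[OF w(2,1,4,3) eq[symmetric]] \<kappa>_bounds C_large by linarith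
qed

end

section \<open>Rays and the Myrberg property\<close>

lemma compact_hcball:
  fixes z :: "'a::euclidean_space"
  assumes z: "z \<in> hspace"
  shows "compact {y \<in> hspace. hdist z y \<le> D}"
proof -
  obtain L where L: "L \<subseteq> hspace" "compact L" "{y \<in> hspace. hdist z y \<le> D} \<subseteq> L"
    using hdist_cball_compact[OF z] by blast
  have "{y \<in> hspace. hdist z y \<le> D} = {y \<in> L. hdist z y \<le> D}" using L by blast
  moreover have "continuous_on L (hdist z)"
    using L z by (intro continuous_on_hdist) (auto intro!: continuous_intros)
  hence "closed {y \<in> L. hdist z y \<le> D}"
    using L(2) by (intro continuous_on_closed_Collect_le) (auto simp: compact_imp_closed intro!: continuous_intros)
  ultimately show ?thesis using L(2)
    by (metis (no_types, lifting) compact_Int_closed Int_absorb1 mem_Collect_eq subsetI)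
qed

text \<open>The parameters of the near points on the segments converge along a subsequence. A closed
  hyperbolic ball about \<open>z\<close> is compact inside the open unit ball, so the limit point
  cannot escape to \<xi>.\<close>

lemma near_ray_of_closure:
  fixes x\<^sub>0 \<xi> z :: "'a::euclidean_space"
  assumes x0: "x\<^sub>0 \<in> hspace" and \<xi>: "\<xi> \<in> closure A" "\<xi> \<in> hboundary" and z: "z \<in> hspace"
    and A: "A \<subseteq> hspace" "\<And>w. w \<in> A \<Longrightarrow> \<exists>y\<in>closed_segment x\<^sub>0 w. hdist z y \<le> D"
  shows "\<exists>y\<in>geodesic_ray x\<^sub>0 \<xi>. hdist z y \<le> D"
proof -
  obtain w where w: "\<And>n. w n \<in> A" "w \<longlonglongrightarrow> \<xi>"
    using \<xi>(1) unfolding closure_sequential by blast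
  have "\<exists>t. 0 \<le> t \<and> t \<le> 1 \<and> hdist z ((1 - t) *\<^sub>R x\<^sub>0 + t *\<^sub>R w n) \<le> D \<and> (1 - t) *\<^sub>R x\<^sub>0 + t *\<^sub>R w n \<in> hspace" for n
    using A(2)[OF w(1), of n] closed_segment_additive(1)[OF x0 subsetD[OF A(1) w(1)[of n]]]
    by (fastforce simp: in_segment)
  then obtain t where t: "\<And>n. 0 \<le> t n" "\<And>n. t n \<le> 1"
    "\<And>n. hdist z ((1 - t n) *\<^sub>R x\<^sub>0 + t n *\<^sub>R w n) \<le> D" "\<And>n. (1 - t n) *\<^sub>R x\<^sub>0 + t n *\<^sub>R w n \<in> hspace"
    by metis
  have "\<forall>n. t n \<in> {0..1}" using t by auto
  then obtain l r where l: "l \<in> {0..1}" "strict_mono r" "(t \<circ> r) \<longlonglongrightarrow> l"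
    using compact_Icc[of "0::real" 1] unfolding compact_def by blast
  define y where "y = (1 - l) *\<^sub>R x\<^sub>0 + l *\<^sub>R \<xi>"
  have wr: "(w \<circ> r) \<longlonglongrightarrow> \<xi>" using LIMSEQ_subseq_LIMSEQ[OF w(2) l(2)] .
  have lim: "(\<lambda>n. (1 - (t \<circ> r) n) *\<^sub>R x\<^sub>0 + (t \<circ> r) n *\<^sub>R (w \<circ> r) n) \<longlonglongrightarrow> y"
    unfolding y_def by (intro tendsto_intros l wr)
  have mem: "(1 - (t \<circ> r) n) *\<^sub>R x\<^sub>0 + (t \<circ> r) n *\<^sub>R (w \<circ> r) n \<in> {y \<in> hspace. hdist z y \<le> D}"
    for n using t by simp
  have "y \<in> {y \<in> hspace. hdist z y \<le> D}"
    by (rule closed_sequentially[OF compact_imp_closed[OF compact_hcball[OF z]] mem lim])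
  moreover have "y \<in> closed_segment x\<^sub>0 \<xi>" using l(1) by (auto simp: y_def in_segment)
  moreover have "\<xi> \<notin> hspace" using \<xi>(2) by (simp add: mem_ball)
  ultimately show ?thesis unfolding geodesic_ray_def by blast
qed

section \<open>A criterion for Myrberg points\<close>

lemma near_boundary:
  assumes "0 < \<tau>"
  obtains \<sigma> where "0 < \<sigma>"
    "\<And>(\<eta>::'a::euclidean_space) x y. \<lbrakk>\<eta> \<in> hboundary; x \<in> hspace; y \<in> hspace; norm (x - \<eta>) < \<sigma>; hdist y x \<le> D\<rbrakk> \<Longrightarrow> norm (y - \<eta>) < \<tau>"
proof -
  define c where "c = cosh D"
  have c: "c > 0" by (simp add: c_def)
  \<comment> \<open>Chosen so that \<open>2 * c * sqrt (2 * s)\<close> is exactly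
    \<open>(\<tau> / 4)\<^sup>2\<close>, the bound needed in
    \<open>norm_diff_le_hdist\<close>.\<close>
  define s where "s = ((\<tau> / 4)\<^sup>2 / (2 * c))\<^sup>2 / 2"
  have s: "s > 0" using assms c by (simp add: s_def)
  show thesis
  proof (rule that[of "min (\<tau> / 2) s"])
    show "0 < min (\<tau> / 2) s" using assms s by simp
  next
    fix \<eta> x y :: 'a
    assume *: "\<eta> \<in> hboundary" "x \<in> hspace" "y \<in> hspace" "norm (x - \<eta>) < min (\<tau> / 2) s" "hdist y x \<le> D"
    have "1 = norm \<eta>" using *(1) by simp
    also have "\<dots> \<le> norm x + norm (x - \<eta>)" by (metis norm_minus_commute norm_triangle_sub)
    finally have n: "1 - norm x \<le> norm (x - \<eta>)" by simp
    have n1: "norm x < 1" using *(2) by (simp add: mem_ball)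
    have "1 - (norm x)\<^sup>2 = (1 + norm x) * (1 - norm x)" by (simp add: power2_eq_square algebra_simps)
    also have "\<dots> \<le> 2 * s" using n n1 *(4) by (intro mult_mono) auto
    finally have "sqrt (1 - (norm x)\<^sup>2) \<le> sqrt (2 * s)" by simp
    also have "sqrt (2 * s) = (\<tau> / 4)\<^sup>2 / (2 * c)" using c by (simp add: s_def)
    finally have "2 * c * sqrt (1 - (norm x)\<^sup>2) \<le> (\<tau> / 4)\<^sup>2" using c by (simp add: field_simps)
    hence "(norm (y - x))\<^sup>2 \<le> (\<tau> / 4)\<^sup>2"
      using norm_diff_le_hdist[OF *(3,2,5)] by (simp add: c_def)
    hence "norm (y - x) \<le> \<tau> / 4" using assms power2_le_imp_le[of "norm (y - x)" "\<tau> / 4"] by simp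
    moreover have "norm (y - \<eta>) \<le> norm (y - x) + norm (x - \<eta>)" using norm_triangle_ineq[of "y - x" "x - \<eta>"] by simp
    ultimately show "norm (y - \<eta>) < \<tau>" using *(4) assms by simp
  qed
qed

lemma between_on_segment:
  fixes x y :: "'a::euclidean_space"
  assumes "s \<le> t" "t \<le> u"
  shows "(1 - t) *\<^sub>R x + t *\<^sub>R y \<in> closed_segment ((1 - s) *\<^sub>R x + s *\<^sub>R y) ((1 - u) *\<^sub>R x + u *\<^sub>R y)"
proof (cases "s = u")
  case True
  thus ?thesis using assms by simp
next
  case False
  define r where "r = (t - s) / (u - s)"
  have r: "0 \<le> r" "r \<le> 1" using assms False by (auto simp: r_def)
  have "r * (u - s) = t - s" using False by (simp add: r_def)
  hence t: "t = (1 - r) * s + r * u" by (simp add: algebra_simps)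
  have "(1 - t) *\<^sub>R x + t *\<^sub>R y = (1 - r) *\<^sub>R ((1 - s) *\<^sub>R x + s *\<^sub>R y) + r *\<^sub>R ((1 - u) *\<^sub>R x + u *\<^sub>R y)"
    unfolding t by (simp add: algebra_simps)
  thus ?thesis using r unfolding in_segment by blast
qed

lemma geodesic_ray_subset:
  assumes "x\<^sub>0 \<in> hspace" "\<xi> \<in> hboundary"
  shows "geodesic_ray x\<^sub>0 \<xi> \<subseteq> hspace"
proof
  fix p assume "p \<in> geodesic_ray x\<^sub>0 \<xi>"
  then obtain t where t: "0 \<le> t" "t \<le> 1" "p = (1 - t) *\<^sub>R x\<^sub>0 + t *\<^sub>R \<xi>" "p \<noteq> \<xi>"
    by (auto simp: geodesic_ray_def in_segment)
  hence "t < 1" by (metis add_0 diff_self less_eq_real_def scaleR_one scaleR_zero_left)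
  have "norm p \<le> (1 - t) * norm x\<^sub>0 + t * norm \<xi>"
    using norm_triangle_ineq[of "(1 - t) *\<^sub>R x\<^sub>0" "t *\<^sub>R \<xi>"] t by simp
  also have "\<dots> < 1"
  proof -
    have "(1 - t) * norm x\<^sub>0 < (1 - t) * 1"
      using assms(1) \<open>t < 1\<close> by (intro mult_strict_left_mono) (auto simp: mem_ball)
    thus ?thesis using assms(2) by simp
  qed
  finally show "p \<in> hspace" by (simp add: mem_ball)
qed

lemma geodesic_ray_segment:
  assumes "p \<in> geodesic_ray x\<^sub>0 \<xi>" "q \<in> geodesic_ray x\<^sub>0 \<xi>" "x\<^sub>0 \<in> hspace" "\<xi> \<in> hboundary"
  shows "closed_segment p q \<subseteq> geodesic_ray x\<^sub>0 \<xi>"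
proof -
  have "closed_segment p q \<subseteq> hspace"
    using geodesic_ray_subset[OF assms(3,4)] assms(1,2) closed_segment_additive(1) by blast
  moreover have "closed_segment p q \<subseteq> closed_segment x\<^sub>0 \<xi>"
    using assms by (simp add: geodesic_ray_def subset_closed_segment)
  moreover have "\<xi> \<notin> hspace" using assms by (simp add: mem_ball)
  ultimately show ?thesis by (auto simp: geodesic_ray_def)
qed

lemma three_on_ray:
  assumes "p \<in> geodesic_ray x\<^sub>0 \<xi>" "q \<in> geodesic_ray x\<^sub>0 \<xi>" "q' \<in> geodesic_ray x\<^sub>0 \<xi>"
  shows "p \<in> closed_segment q q' \<or> q \<in> closed_segment p q' \<or> q' \<in> closed_segment p q"
proof -
  obtain s t u where p: "p = (1 - s) *\<^sub>R x\<^sub>0 + s *\<^sub>R \<xi>" and q: "q = (1 - t) *\<^sub>R x\<^sub>0 + t *\<^sub>R \<xi>"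
    and q': "q' = (1 - u) *\<^sub>R x\<^sub>0 + u *\<^sub>R \<xi>"
    using assms by (auto simp: geodesic_ray_def in_segment)
  define f where "f v = (1 - v) *\<^sub>R x\<^sub>0 + v *\<^sub>R \<xi>" for v :: real
  have b: "f b \<in> closed_segment (f a) (f c) \<and> f b \<in> closed_segment (f c) (f a)" if "a \<le> b" "b \<le> c" for a b c
    using between_on_segment[OF that, of x\<^sub>0 \<xi>] by (simp add: f_def closed_segment_commute)
  have "f s \<in> closed_segment (f t) (f u) \<or> f t \<in> closed_segment (f s) (f u) \<or> f u \<in> closed_segment (f s) (f t)"
    using b[of t s u] b[of u s t] b[of s t u] b[of u t s] b[of s u t] b[of t u s] by linarith
  thus ?thesis by (simp add: p q q' f_def)
qed

text \<open>A point \<open>y\<close> close to the sphere, on a chord from the smaller ball to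
  \<open>y'\<close>, must be close to \<open>y'\<close>; this contradicts the distance of \<eta> and
  \<zeta>. It keeps the parts of a translated ray beyond its two marked points out of a given
  compact set.\<close>

lemma no_long_chord:
  fixes w y y' \<eta> \<zeta> :: "'a::euclidean_space"
  assumes y: "y \<in> closed_segment w y'" and w: "norm w \<le> r" "r < 1" and y': "norm y' \<le> 1"
    and near: "norm (y - \<eta>) < \<tau>" "norm (y' - \<zeta>) < \<tau>" and \<eta>: "norm \<eta> = 1"
    and \<tau>: "0 < \<tau>" "8 * \<tau> \<le> (1 - r) * norm (\<eta> - \<zeta>)"
  shows False
proof -
  have r0: "0 \<le> r" using w norm_ge_zero order_trans by blast
  obtain t where t: "0 \<le> t" "t \<le> 1" "y = (1 - t) *\<^sub>R w + t *\<^sub>R y'" using y by (auto simp: in_segment)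
  have "1 - \<tau> \<le> norm y" using near(1) \<eta> norm_triangle_sub[of \<eta> y] by (simp add: norm_minus_commute)
  also have "\<dots> \<le> (1 - t) * norm w + t * norm y'"
    using norm_triangle_ineq[of "(1 - t) *\<^sub>R w" "t *\<^sub>R y'"] t by simp
  also have "\<dots> \<le> (1 - t) * r + t * 1" using w y' t by (intro add_mono mult_left_mono) auto
  finally have 1: "(1 - t) * (1 - r) \<le> \<tau>" by (simp add: algebra_simps)
  have "y - y' = (1 - t) *\<^sub>R (w - y')" unfolding t(3) by (simp add: algebra_simps)
  hence "norm (y - y') = (1 - t) * norm (w - y')" using t by simp
  also have "\<dots> \<le> (1 - t) * 2"
    using norm_triangle_ineq4[of w y'] w y' t by (intro mult_left_mono) auto
  finally have "(1 - r) * norm (y - y') \<le> (1 - r) * ((1 - t) * 2)"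
    using w by (intro mult_left_mono) auto
  hence 2: "(1 - r) * norm (y - y') \<le> 2 * \<tau>" using 1 by (simp add: algebra_simps)
  have "norm (\<eta> - \<zeta>) \<le> norm (y - y') + norm (y - \<eta>) + norm (y' - \<zeta>)"
  proof -
    have "\<eta> - \<zeta> = (y - y') - (y - \<eta>) + (y' - \<zeta>)" by simp
    thus ?thesis
      using norm_triangle_ineq[of "(y - y') - (y - \<eta>)" "y' - \<zeta>"] norm_triangle_ineq4[of "y - y'" "y - \<eta>"]
      by simp
  qed
  hence "norm (\<eta> - \<zeta>) \<le> norm (y - y') + 2 * \<tau>" using near by linarith
  hence "(1 - r) * norm (\<eta> - \<zeta>) \<le> (1 - r) * (norm (y - y') + 2 * \<tau>)" using w by (intro mult_left_mono) auto
  also have "\<dots> \<le> 2 * \<tau> + 2 * \<tau>" 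
    using 2 mult_nonneg_nonneg[OF r0, of \<tau>] \<tau>(1) by (simp add: algebra_simps)
  finally show False using \<tau> by simp
qed

context proper_isometric_action
begin

text \<open>Orbit points of \<open>g1\<close> and \<open>g2\<close> approximate \<eta> and \<zeta>.
  The covering hypothesis for \<open>inv g1 \<otimes> g2\<close> puts a translate of their segment
  near the ray; moving it back brings two points of the ray within \<open>D\<close> of these orbit
  points, and this error disappears near the sphere.\<close>

lemma myrberg_endpoints:
  assumes \<xi>: "\<xi> \<in> hboundary"
    and cover: "\<And>g. g \<in> carrier G \<Longrightarrow> \<exists>h\<in>carrier G. act h ` geodesic_segment x\<^sub>0 (orb g) \<subseteq> hnbhd D (geodesic_ray x\<^sub>0 \<xi>)"
    and \<eta>: "\<eta> \<in> limit_set act x\<^sub>0 (carrier G)" and \<zeta>: "\<zeta> \<in> limit_set act x\<^sub>0 (carrier G)" and \<tau>: "0 < \<tau>"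
  obtains k p p' where "k \<in> carrier G" "p \<in> geodesic_ray x\<^sub>0 \<xi>" "p' \<in> geodesic_ray x\<^sub>0 \<xi>"
    "norm (act k p - \<eta>) < \<tau>" "norm (act k p' - \<zeta>) < \<tau>"
proof -
  obtain \<sigma> where \<sigma>: "0 < \<sigma>" "\<And>\<eta> x y::'a. \<lbrakk>\<eta> \<in> hboundary; x \<in> hspace; y \<in> hspace; norm (x - \<eta>) < \<sigma>; hdist y x \<le> D\<rbrakk> \<Longrightarrow> norm (y - \<eta>) < \<tau>"
    using near_boundary[OF \<tau>] by metis
  have approach: "\<exists>g\<in>carrier G. norm (orb g - \<theta>) < \<sigma>" if "\<theta> \<in> limit_set act x\<^sub>0 (carrier G)" for \<theta>
    using that \<sigma>(1) unfolding limit_set_def islimpt_approachable by (force simp: dist_norm)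
  obtain g1 g2 where g: "g1 \<in> carrier G" "norm (orb g1 - \<eta>) < \<sigma>" "g2 \<in> carrier G" "norm (orb g2 - \<zeta>) < \<sigma>"
    using approach \<eta> \<zeta> by blast
  define g where "g = inv g1 \<otimes> g2"
  have gc: "g \<in> carrier G" using g by (simp add: g_def)
  obtain h where h: "h \<in> carrier G" "act h ` geodesic_segment x\<^sub>0 (orb g) \<subseteq> hnbhd D (geodesic_ray x\<^sub>0 \<xi>)"
    using cover[OF gc] by blast
  have "orb h \<in> hnbhd D (geodesic_ray x\<^sub>0 \<xi>)" "act h (orb g) \<in> hnbhd D (geodesic_ray x\<^sub>0 \<xi>)"
    using h(2) by (auto simp: geodesic_segment_def)
  then obtain p p' where p: "p \<in> geodesic_ray x\<^sub>0 \<xi>" "hdist (orb h) p < D"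
    and p': "p' \<in> geodesic_ray x\<^sub>0 \<xi>" "hdist (act h (orb g)) p' < D"
    by (auto simp: hnbhd_def)
  have ph: "p \<in> hspace" "p' \<in> hspace" using p p' geodesic_ray_subset[OF base_point \<xi>] by auto
  \<comment> \<open>This element undoes \<open>h\<close> and carries the translated segment to the
    one from \<open>orb g1\<close> to \<open>orb g2\<close>.\<close>
  define k where "k = g1 \<otimes> inv h"
  have kc: "k \<in> carrier G" using g h by (simp add: k_def)
  have k1: "act k (orb h) = orb g1" using g h base_point by (simp add: k_def m_assoc flip: act_mult)
  have "g1 \<otimes> inv h \<otimes> (h \<otimes> (inv g1 \<otimes> g2)) = g2"
  proof -
    have "g1 \<otimes> inv h \<otimes> (h \<otimes> (inv g1 \<otimes> g2)) = g1 \<otimes> (inv h \<otimes> h) \<otimes> (inv g1 \<otimes> g2)"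
      using g h by (simp only: m_assoc inv_closed m_closed)
    also have "\<dots> = g1 \<otimes> (inv g1 \<otimes> g2)" using g h by simp
    also have "\<dots> = g1 \<otimes> inv g1 \<otimes> g2" using g by (simp only: m_assoc inv_closed)
    also have "\<dots> = g2" using g by simp
    finally show ?thesis .
  qed
  hence k2: "act k (act h (orb g)) = orb g2"
    using g h gc base_point kc by (simp add: g_def k_def flip: act_mult)
  have "hdist (act k p) (orb g1) \<le> D" "hdist (act k p') (orb g2) \<le> D"
    using isometric[OF kc ph(1), of "orb h"] isometric[OF kc ph(2), of "act h (orb g)"] p p' k1 k2 h gc
    by (auto simp: hdist_commute orb_in act_in)
  moreover have "\<eta> \<in> hboundary" "\<zeta> \<in> hboundary" using \<eta> \<zeta> by (simp_all add: limit_set_def)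
  ultimately have "norm (act k p - \<eta>) < \<tau>" "norm (act k p' - \<zeta>) < \<tau>"
    using \<sigma>(2)[OF _ orb_in[OF g(1)] act_in[OF kc ph(1)] g(2)]
      \<sigma>(2)[OF _ orb_in[OF g(3)] act_in[OF kc ph(2)] g(4)] by blast+
  thus thesis using that kc p(1) p'(1) by blast
qed

text \<open>The chord between two points of the translated ray near \<eta> and \<zeta> is Euclidean
  close to the line, and on a compact set this implies hyperbolic closeness, whatever the size of
  \<open>D\<close>.\<close>

lemma myrberg_criterion:
  assumes \<xi>: "\<xi> \<in> limit_set act x\<^sub>0 (carrier G)"
    and cover: "\<And>g. g \<in> carrier G \<Longrightarrow> \<exists>h\<in>carrier G. act h ` geodesic_segment x\<^sub>0 (orb g) \<subseteq> hnbhd D (geodesic_ray x\<^sub>0 \<xi>)"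
  shows "myrberg G act x\<^sub>0 \<xi>"
  unfolding myrberg_def
proof (intro conjI ballI impI \<xi>)
  fix \<eta> \<zeta> assume \<eta>: "\<eta> \<in> limit_set act x\<^sub>0 (carrier G)" and \<zeta>: "\<zeta> \<in> limit_set act x\<^sub>0 (carrier G)"
    and ne: "\<eta> \<noteq> \<zeta>"
  have \<xi>b: "\<xi> \<in> hboundary" and \<eta>b: "norm \<eta> = 1" and \<zeta>b: "norm \<zeta> = 1"
    using \<xi> \<eta> \<zeta> by (auto simp: limit_set_def)
  define ray where "ray = geodesic_ray x\<^sub>0 \<xi>"
  show "in_orbit_closure G act (geodesic_ray x\<^sub>0 \<xi>) (geodesic_line \<eta> \<zeta>)"
    unfolding in_orbit_closure_def ray_def[symmetric]
  proof (intro allI impI)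
    fix Q :: "'a set" and e :: real assume Q: "Q \<subseteq> hspace \<and> compact Q \<and> 0 < e"
    obtain d where d: "d > 0" "\<And>z w. z \<in> Q \<Longrightarrow> norm (z - w) < d \<Longrightarrow> w \<in> hspace \<and> hdist z w < e"
      using hdist_uniformly_small[of Q e] Q by metis
    obtain r where r: "r < 1" "Q \<subseteq> cball 0 r" using compact_in_smaller_ball Q by blast
    \<comment> \<open>The bound \<open>d\<close> serves closeness inside \<open>Q\<close>, the other
      one the contradiction in \<open>no_long_chord\<close>.\<close>
    define \<tau> where "\<tau> = min d ((1 - r) * norm (\<eta> - \<zeta>) / 8)"
    have \<tau>: "0 < \<tau>" "\<tau> \<le> d" "8 * \<tau> \<le> (1 - r) * norm (\<eta> - \<zeta>)"
      using d r ne by (auto simp: \<tau>_def)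
    obtain k p p' where k: "k \<in> carrier G" and p: "p \<in> ray" "p' \<in> ray"
      and near: "norm (act k p - \<eta>) < \<tau>" "norm (act k p' - \<zeta>) < \<tau>"
      using myrberg_endpoints[OF \<xi>b cover \<eta> \<zeta> \<tau>(1)] unfolding ray_def by blast
    have rayh: "ray \<subseteq> hspace" using geodesic_ray_subset[OF base_point \<xi>b] by (simp add: ray_def)
    have ph: "p \<in> hspace" "p' \<in> hspace" using p rayh by auto
    define y y' where "y = act k p" and "y' = act k p'"
    have yh: "y \<in> hspace" "y' \<in> hspace" using k ph by (auto simp: y_def y'_def)
    have close: "norm (((1 - t) *\<^sub>R y + t *\<^sub>R y') - ((1 - t) *\<^sub>R \<eta> + t *\<^sub>R \<zeta>)) < d" if "0 \<le> t" "t \<le> 1" for t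
    proof -
      have "((1 - t) *\<^sub>R y + t *\<^sub>R y') - ((1 - t) *\<^sub>R \<eta> + t *\<^sub>R \<zeta>) = (1 - t) *\<^sub>R (y - \<eta>) + t *\<^sub>R (y' - \<zeta>)"
        by (simp add: algebra_simps)
      hence "norm (((1 - t) *\<^sub>R y + t *\<^sub>R y') - ((1 - t) *\<^sub>R \<eta> + t *\<^sub>R \<zeta>)) \<le> (1 - t) * norm (y - \<eta>) + t * norm (y' - \<zeta>)"
        using norm_triangle_ineq[of "(1 - t) *\<^sub>R (y - \<eta>)" "t *\<^sub>R (y' - \<zeta>)"] that by simp
      also have "\<dots> < \<tau>"
        using near that unfolding y_def y'_def by (intro convex_bound_lt) auto
      finally show ?thesis using \<tau> by simp
    qed
    have "Q \<inter> geodesic_line \<eta> \<zeta> \<subseteq> hnbhd e (act k ` ray)"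
    proof
      fix z assume z: "z \<in> Q \<inter> geodesic_line \<eta> \<zeta>"
      then obtain t where t: "0 < t" "t < 1" "z = (1 - t) *\<^sub>R \<eta> + t *\<^sub>R \<zeta>"
        by (auto simp: geodesic_line_def in_segment)
      define z' where "z' = (1 - t) *\<^sub>R y + t *\<^sub>R y'"
      have "norm (z - z') < d" using close[of t] t by (simp add: z'_def norm_minus_commute)
      hence "hdist z z' < e" using d(2) z by blast
      moreover have "z' \<in> closed_segment y y'" 
        unfolding z'_def in_segment using t by (intro exI[of _ t]) simp
      hence "z' \<in> act k ` closed_segment p p'" using act_closed_segment[OF k ph] by (simp add: y_def y'_def)
      hence "z' \<in> act k ` ray"
        using geodesic_ray_segment[OF p[unfolded ray_def] base_point \<xi>b] by (auto simp: ray_def)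
      ultimately show "z \<in> hnbhd e (act k ` ray)" using z Q by (auto simp: hnbhd_def)
    qed
    moreover have "Q \<inter> act k ` ray \<subseteq> hnbhd e (geodesic_line \<eta> \<zeta>)"
    proof
      fix w assume w: "w \<in> Q \<inter> act k ` ray"
      then obtain q where q: "q \<in> ray" "w = act k q" by blast
      have wn: "norm w \<le> r" using w r by auto
      have yn: "norm y \<le> 1" "norm y' \<le> 1" using yh by (auto simp: mem_ball)
      have qh: "q \<in> hspace" using q rayh by blast
      have seg: "act k u \<in> closed_segment (act k v) (act k v')" if "u \<in> closed_segment v v'" "v \<in> hspace" "v' \<in> hspace" for u v v'
        using act_closed_segment[OF k that(2,3)] that(1) by blast
      from three_on_ray[of q x\<^sub>0 \<xi> p p'] q p
      consider "q \<in> closed_segment p p'" | "p \<in> closed_segment q p'" | "p' \<in> closed_segment q p"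
        unfolding ray_def by blast
      thus "w \<in> hnbhd e (geodesic_line \<eta> \<zeta>)"
      proof cases
        case 1
        then obtain t where t: "0 \<le> t" "t \<le> 1" "w = (1 - t) *\<^sub>R y + t *\<^sub>R y'"
          using seg[OF 1 ph] q by (auto simp: y_def y'_def in_segment)
        define z where "z = (1 - t) *\<^sub>R \<eta> + t *\<^sub>R \<zeta>"
        have "norm (w - z) < d" using close[OF t(1,2)] by (simp add: t(3) z_def)
        hence z: "z \<in> hspace" "hdist w z < e" using d(2) w by blast+
        \<comment> \<open>The endpoints \<eta> and \<zeta> lie on the sphere, but \<open>z\<close>
          lies in the open ball.\<close>
        have "t \<noteq> 0" "t \<noteq> 1" using z(1) \<eta>b \<zeta>b by (auto simp: z_def mem_ball)
        hence "0 < t" "t < 1" using t(1,2) by linarith+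
        hence "z \<in> geodesic_line \<eta> \<zeta>"
          unfolding geodesic_line_def in_segment z_def using ne by blast
        moreover have "w \<in> hspace" using w Q by blast
        ultimately show ?thesis using z(2) unfolding hnbhd_def by blast
      next
        case 2
        hence "y \<in> closed_segment w y'" using seg[OF 2 qh ph(2)] q by (simp add: y_def y'_def)
        from no_long_chord[OF this wn r(1) yn(2) near[folded y_def y'_def] \<eta>b \<tau>(1,3)]
        show ?thesis ..
      next
        case 3
        hence "y' \<in> closed_segment w y" using seg[OF 3 qh ph(1)] q by (simp add: y_def y'_def)
        from no_long_chord[OF this wn r(1) yn(1) near(2,1)[folded y_def y'_def] \<zeta>b \<tau>(1)] \<tau>(3)
        show ?thesis unfolding norm_minus_commute[of \<zeta> \<eta>] by blast
      qed
    qed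
    ultimately show "\<exists>h\<in>carrier G. Q \<inter> geodesic_line \<eta> \<zeta> \<subseteq> hnbhd e (act h ` ray) \<and> Q \<inter> act h ` ray \<subseteq> hnbhd e (geodesic_line \<eta> \<zeta>)"
      using k by (intro bexI[of _ k] conjI)
  qed
qed

end

section \<open>Every element is visible in some generator\<close>

context property_A_setting
begin

text \<open>At most one of the directions towards large powers of \<open>a\<close> and \<open>b\<close> can be close to that of \<open>g\<close>.\<close>
lemma long_left_multiple:
  assumes g: "g \<in> carrier G"
  obtains c where "c \<in> carrier G" "1000 * C \<le> nrm (c \<otimes> g)" "gromov_product (orb c) x\<^sub>0 (orb (c \<otimes> g)) \<le> C / 100"
proof -
  have "\<forall>\<^sub>F n in sequentially. 1000 * C + nrm g \<le> nrm (a [^] n) \<and> 1000 * C + nrm g \<le> nrm (b [^] n)"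
    using a_unbounded b_unbounded unfolding filterlim_at_top by (simp add: eventually_conj)
  then obtain n :: nat where n: "1000 * C + nrm g \<le> nrm (a [^] n)" "1000 * C + nrm g \<le> nrm (b [^] n)"
    using eventually_happens'[OF sequentially_bot] by blast
  have ab: "a [^] n \<in> carrier G" "b [^] n \<in> carrier G" using a_in b_in by auto
  have "gromov_product x\<^sub>0 (orb (a [^] n)) (orb (b [^] n)) \<le> C / 1000"
    using a_b_gromov_product[of "int n" "int n"] by (simp add: int_pow_int)
  moreover have "min (gromov_product x\<^sub>0 (orb (a [^] n)) (orb g)) (gromov_product x\<^sub>0 (orb g) (orb (b [^] n)))
     \<le> gromov_product x\<^sub>0 (orb (a [^] n)) (orb (b [^] n)) + 5 / 2"
    using ab g base_point by (intro gromov_product_four_point) auto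
  ultimately have "gromov_product x\<^sub>0 (orb (a [^] n)) (orb g) \<le> C / 100 \<or> gromov_product x\<^sub>0 (orb (b [^] n)) (orb g) \<le> C / 100"
    using C_large gromov_product_commute[of x\<^sub>0 "orb g" "orb (b [^] n)"] by linarith
  then obtain e where e: "e \<in> carrier G" "1000 * C + nrm g \<le> nrm e" "gromov_product x\<^sub>0 (orb e) (orb g) \<le> C / 100"
    using n ab by blast
  \<comment> \<open>Translating by the inverse of the power \<open>e\<close> turns the small product
    at \<open>x\<^sub>0\<close> into one at \<open>orb c\<close>.\<close>
  define c where "c = inv e"
  have c: "c \<in> carrier G" using e by (simp add: c_def)
  have "act c (orb e) = x\<^sub>0" using e base_point by (simp add: c_def act_inv_cancel)
  hence "gromov_product (orb c) x\<^sub>0 (orb (c \<otimes> g)) \<le> C / 100"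
    using gromov_product_act[OF c base_point, of "orb e" "orb g"] e g c base_point
    by (simp add: act_mult orb_in)
  moreover have "nrm c \<le> nrm (c \<otimes> g) + nrm g"
    using nrm_mult[of "c \<otimes> g" "inv g"] c g by (simp add: m_assoc nrm_inv)
  hence "1000 * C \<le> nrm (c \<otimes> g)" using e nrm_inv by (simp add: c_def)
  ultimately show thesis using that c by blast
qed

end

context F_construction
begin

text \<open>Padding \<open>g\<close> on the left to \<open>g' = c \<otimes> g\<close> makes it long,
  so \<open>\<Phi>\<close> alters it only by factors of norm at most \<open>C\<close>, while
  \<open>orb c\<close> stays almost on the geodesic to \<open>orb g'\<close>. The order of
  quantifiers matters: \<open>h\<close> depends on the prefix \<open>us\<close> but not on the
  continuation \<open>u\<close>, so it survives a limit over \<open>u\<close>.\<close>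

lemma gen_contains_translate:
  assumes g: "g \<in> carrier G"
  obtains k where "k \<ge> 1"
    "\<And>us. set us \<subseteq> Gens \<Longrightarrow> \<exists>h\<in>carrier G. \<forall>u\<in>PA. \<forall>z\<in>act h ` closed_segment x\<^sub>0 (orb g).
       \<exists>y\<in>closed_segment x\<^sub>0 (orb (word us \<otimes> gen k \<otimes> a \<otimes> u)). hdist z y \<le> 3 * C"
proof -
  obtain c where c: "c \<in> carrier G" "1000 * C \<le> nrm (c \<otimes> g)" "gromov_product (orb c) x\<^sub>0 (orb (c \<otimes> g)) \<le> C / 100"
    using long_left_multiple[OF g] .
  define g' where "g' = c \<otimes> g"
  have g': "g' \<in> carrier G" using c g by (simp add: g'_def)
  obtain k where k: "k \<ge> 1" "gam k = g'" using enumeration g' by force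
  obtain b1 b2 where b: "b1 \<in> carrier G" "b2 \<in> carrier G" "nrm b1 \<le> C" "nrm b2 \<le> C" "\<Phi> g' = b1 \<otimes> g' \<otimes> b2"
    using \<Phi>_form[OF g'] c(2) unfolding g'_def by blast
  show thesis
  proof (rule that[OF k(1)])
    fix us assume us: "set us \<subseteq> Gens"
    define w where "w = word us \<otimes> \<psi> k"
    have w: "w \<in> PA" using us Gens_PA \<psi>_PA[OF k(1)] unfolding w_def by (intro word_last_PA) auto
    define p where "p = w \<otimes> a"
    have uc: "word us \<in> carrier G" using us Gens_carrier by (intro word_carrier) blast
    have cc: "w \<in> carrier G" "p \<in> carrier G" "\<psi> k \<in> carrier G" "\<Phi> g' \<in> carrier G"
      using PA_carrier[OF w] a_in PA_carrier[OF \<psi>_PA[OF k(1)]] PA_carrier[OF \<Phi>_gam_PA[OF k(1)]] k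
      by (auto simp: p_def)
    define h where "h = p \<otimes> b1 \<otimes> c"
    have hc: "h \<in> carrier G" using cc b c by (simp add: h_def)
    have gPA: "\<Phi> g' \<in> PA" using \<Phi>_gam_PA[OF k(1)] k by simp
    show "\<exists>h\<in>carrier G. \<forall>u\<in>PA. \<forall>z\<in>act h ` closed_segment x\<^sub>0 (orb g).
       \<exists>y\<in>closed_segment x\<^sub>0 (orb (word us \<otimes> gen k \<otimes> a \<otimes> u)). hdist z y \<le> 3 * C"
    proof (intro bexI[OF _ hc] ballI)
      fix u z assume u: "u \<in> PA" and z: "z \<in> act h ` closed_segment x\<^sub>0 (orb g)"
      note uc' = PA_carrier[OF u]
      define f where "f = word us \<otimes> gen k \<otimes> a \<otimes> u"
      have f: "f = w \<otimes> a \<otimes> \<Phi> g' \<otimes> a \<otimes> u"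
        using gen_eq[OF k(1)] k uc cc a_in uc' by (simp add: f_def w_def m_assoc)
      have fc: "f \<in> carrier G" using f cc a_in uc' by simp
      define U U' V V' Y where "U = orb p" and "U' = orb (p \<otimes> b1)" and "V = orb (p \<otimes> \<Phi> g')"
        and "V' = orb (h \<otimes> g)" and "Y = orb f"
      have hsp: "U \<in> hspace" "U' \<in> hspace" "V \<in> hspace" "V' \<in> hspace" "Y \<in> hspace" "orb h \<in> hspace"
        using cc b hc g fc by (auto simp: U_def U'_def V_def V'_def Y_def)
      have onV: "gromov_product V x\<^sub>0 Y \<le> \<kappa>"
        using PA_gromov_pair(1)[OF PA_mult[OF w gPA] u] by (simp add: V_def Y_def f p_def)
      have onU: "gromov_product U x\<^sub>0 V \<le> \<kappa>"
        using PA_gromov_pair(2)[OF w gPA] by (simp add: U_def V_def p_def)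
      have UU': "hdist U U' \<le> C" using hdist_orb[of p b1] cc b by (simp add: U_def U'_def)
      have hg: "h \<otimes> g = p \<otimes> b1 \<otimes> g'" using cc b c g by (simp add: h_def g'_def m_assoc)
      have "p \<otimes> \<Phi> g' = h \<otimes> g \<otimes> b2" using cc b g' by (simp add: hg b(5) m_assoc)
      hence V'V: "hdist V' V \<le> C" using hdist_orb[of "h \<otimes> g" b2] hc g b by (simp add: V'_def V_def)
      have "gromov_product (act (p \<otimes> b1) (orb c)) (act (p \<otimes> b1) x\<^sub>0) (act (p \<otimes> b1) (orb g')) \<le> C / 100"
        using c g' cc b base_point by (subst gromov_product_act) (auto simp: g'_def)
      moreover have "act (p \<otimes> b1) (orb c) = orb h" "act (p \<otimes> b1) (orb g') = V'"
        unfolding V'_def hg unfolding h_def using c(1) g' cc b base_point by (simp_all flip: act_mult)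
      ultimately have onh: "gromov_product (orb h) U' V' \<le> C / 100" by (simp add: U'_def)
      have zseg: "z \<in> closed_segment (orb h) V'"
        using z act_closed_segment[OF hc base_point orb_in[OF g]] hc g base_point
        by (simp add: V'_def act_mult)
      have zh: "z \<in> hspace" and zadd: "hdist (orb h) z + hdist z V' = hdist (orb h) V'"
        using closed_segment_additive[OF hsp(6,4) zseg] by auto
      \<comment> \<open>Lengths are added along \<open>x\<^sub>0\<close>, \<open>U\<close>,
        \<open>U'\<close>, \<open>orb h\<close>, \<open>z\<close>, \<open>V'\<close>,
        \<open>V\<close>, \<open>Y\<close>; the excess over the distance from
        \<open>x\<^sub>0\<close> to \<open>Y\<close> is what the products at \<open>orb h\<close>,
        \<open>U\<close>, \<open>V\<close> and the corrections \<open>b1\<close>, \<open>b2\<close>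
        cost.\<close>
      have "hdist x\<^sub>0 z \<le> hdist x\<^sub>0 U + hdist U U' + hdist U' (orb h) + hdist (orb h) z"
        using hdist_triangle[OF base_point hsp(1) zh] hdist_triangle[OF hsp(1,2) zh] hdist_triangle[OF hsp(2,6) zh]
        by linarith
      moreover have "hdist z Y \<le> hdist z V' + hdist V' V + hdist V Y"
        using hdist_triangle[OF zh hsp(4,5)] hdist_triangle[OF hsp(4,3,5)] by linarith
      moreover have "hdist U' V' \<le> hdist U' U + hdist U V + hdist V V'"
        using hdist_triangle[OF hsp(2,1,4)] hdist_triangle[OF hsp(1,3,4)] by linarith
      moreover note gromov_product_double[of z x\<^sub>0 Y] gromov_product_double[of V x\<^sub>0 Y] gromov_product_double[of U x\<^sub>0 V]
        gromov_product_double[of "orb h" U' V'] hdist_commute[of z x\<^sub>0] hdist_commute[of V x\<^sub>0] hdist_commute[of U x\<^sub>0]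
        hdist_commute[of "orb h" U'] hdist_commute[of U' U] hdist_commute[of V V']
      ultimately have "gromov_product z x\<^sub>0 Y \<le> 2 * C + 2 * \<kappa> + C / 100"
        using UU' V'V onV onU onh zadd by linarith
      moreover obtain y where "y \<in> closed_segment x\<^sub>0 Y" "hdist z y \<le> gromov_product z x\<^sub>0 Y + 5"
        using near_geodesic[OF base_point hsp(5) zh] .
      ultimately show "\<exists>y\<in>closed_segment x\<^sub>0 (orb (word us \<otimes> gen k \<otimes> a \<otimes> u)). hdist z y \<le> 3 * C"
        using \<kappa>_bounds C_large unfolding Y_def f_def[symmetric] by (intro bexI[of _ y]) linarith
    qed
  qed
qed

end

section \<open>Poincare series\<close>

lemma sum_Un_le:
  fixes f :: "'b \<Rightarrow> real"
  assumes "finite A" "finite B" "\<And>x. 0 \<le> f x"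
  shows "sum f (A \<union> B) \<le> sum f A + sum f B"
  using sum.union_inter[OF assms(1,2), of f] sum_nonneg[of "A \<inter> B" f] assms(3) by simp

lemma sum_le_of_image:
  fixes f :: "'c \<Rightarrow> real" and g :: "'b \<Rightarrow> real"
  assumes "finite A" "\<And>x. 0 \<le> f x" "\<And>y. y \<in> A \<Longrightarrow> f (h y) \<le> g y" "sum g A \<le> B"
  shows "sum f (h ` A) \<le> B"
proof -
  have "sum f (h ` A) \<le> sum (f \<circ> h) A" using assms(1,2) by (intro sum_image_le) auto
  also have "\<dots> \<le> sum g A" using assms(3) by (intro sum_mono) simp
  finally show ?thesis using assms(4) by simp
qed

context proper_isometric_action
begin

abbreviation wt :: "real \<Rightarrow> 'g \<Rightarrow> real" where "wt s g \<equiv> exp (- s * nrm g)"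
abbreviation PS :: "'g set \<Rightarrow> real \<Rightarrow> ennreal" where "PS \<equiv> poincare_series act x\<^sub>0"

lemma PS_SUP: "PS A s = (SUP T\<in>{T. finite T \<and> T \<subseteq> A}. ennreal (sum (wt s) T))"
  unfolding poincare_series_def by (subst nonneg_infsum_complete) (simp_all add: sum_ennreal)

lemma sum_le_PS: "\<lbrakk>finite T; T \<subseteq> A\<rbrakk> \<Longrightarrow> ennreal (sum (wt s) T) \<le> PS A s"
  unfolding PS_SUP by (rule SUP_upper) simp

lemma PS_le: "(\<And>T. \<lbrakk>finite T; T \<subseteq> A\<rbrakk> \<Longrightarrow> sum (wt s) T \<le> B) \<Longrightarrow> PS A s \<le> ennreal B"
  unfolding PS_SUP by (rule SUP_least) (auto intro: ennreal_leI)

lemma PS_mono: "A \<subseteq> B \<Longrightarrow> PS A s \<le> PS B s"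
  unfolding PS_SUP by (rule SUP_subset_mono) auto

lemma sum_le_PS_real:
  assumes "PS A s < \<infinity>" "finite T" "T \<subseteq> A" shows "sum (wt s) T \<le> enn2real (PS A s)"
proof -
  have "ennreal (sum (wt s) T) \<le> ennreal (enn2real (PS A s))" using sum_le_PS[OF assms(2,3)] assms(1) by simp
  thus ?thesis by (simp add: ennreal_le_iff)
qed

lemma wt_antimono: "\<lbrakk>g \<in> carrier G; s \<le> t\<rbrakk> \<Longrightarrow> wt t g \<le> wt s g"
  using nrm_nonneg[of g] by (simp add: mult_right_mono)

lemma PS_antimono:
  assumes "A \<subseteq> carrier G" "s \<le> t" shows "PS A t \<le> PS A s"
  unfolding PS_SUP
proof (rule SUP_mono)
  fix T assume "T \<in> {T. finite T \<and> T \<subseteq> A}"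
  moreover from this have "sum (wt t) T \<le> sum (wt s) T"
    using assms wt_antimono by (intro sum_mono) auto
  ultimately show "\<exists>T'\<in>{T. finite T \<and> T \<subseteq> A}. ennreal (sum (wt t) T) \<le> ennreal (sum (wt s) T')"
    by (auto intro: ennreal_leI)
qed

lemma wt_le_of_nrm:
  assumes "nrm x + nrm y \<le> nrm z" "0 \<le> s" shows "wt s z \<le> wt s x * wt s y"
proof -
  have "s * (nrm x + nrm y) \<le> s * nrm z" using assms by (intro mult_left_mono) auto
  thus ?thesis by (simp add: algebra_simps flip: exp_add)
qed

lemma wt_le_shift:
  assumes "nrm x \<le> nrm z + c" "0 \<le> s" shows "wt s z \<le> exp (s * c) * wt s x"
proof -
  have "s * nrm x \<le> s * (nrm z + c)" using assms by (intro mult_left_mono) auto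
  thus ?thesis by (simp add: algebra_simps flip: exp_add)
qed

end

context F_construction
begin

section \<open>Uniform bounds for the series of the stages\<close>

definition W :: "nat \<Rightarrow> 'g set" where "W k = K \<union> gen ` {1..<k}"

lemma W_Gens: "W k \<subseteq> Gens" by (auto simp: W_def Gens_def)

lemma W_mono: "k \<le> l \<Longrightarrow> W k \<subseteq> W l" by (auto simp: W_def)

lemma W_Suc: "k \<ge> 1 \<Longrightarrow> W (Suc k) = insert (gen k) (W k)"
  by (auto simp: W_def atLeastLessThanSuc)

definition spelled :: "'g set \<Rightarrow> 'g set"
  where "spelled T = {word xs \<otimes> x | xs x. set xs \<subseteq> T \<and> x \<in> T}"

lemma spelled_mono: "S \<subseteq> T \<Longrightarrow> spelled S \<subseteq> spelled T"
  unfolding spelled_def by blast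

lemma spelled_PA: "T \<subseteq> Gens \<Longrightarrow> spelled T \<subseteq> PA"
  using Gens_PA word_last_PA unfolding spelled_def by blast

lemma Fs_spelled: "k \<ge> 1 \<Longrightarrow> Fs k = spelled (W k)"
  using a_products_word[OF subset_trans[OF W_Gens Gens_carrier], of k] Fs_eq[of k]
  by (simp add: spelled_def W_def)

lemma finite_subset_W:
  assumes "finite T" "T \<subseteq> Gens" shows "\<exists>k\<ge>1. T \<subseteq> W k"
  using assms
proof (induction T)
  case (insert x T)
  then obtain k where k: "k \<ge> 1" "T \<subseteq> W k" by auto
  obtain l where l: "l \<ge> 1" "x \<in> W l"
    using insert.prems unfolding Gens_def W_def by (force intro: that[of "Suc _"])
  show ?case using k l W_mono[of k "max k l"] W_mono[of l "max k l"]
    by (intro exI[of _ "max k l"]) auto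
qed auto

lemma F_spelled: "F = spelled Gens"
proof
  show "F \<subseteq> spelled Gens" using F_eq Fs_spelled spelled_mono[OF W_Gens] by auto
next
  show "spelled Gens \<subseteq> F"
  proof
    fix f assume "f \<in> spelled Gens"
    then obtain xs x where f: "f = word xs \<otimes> x" "set xs \<subseteq> Gens" "x \<in> Gens" unfolding spelled_def by blast
    obtain k where k: "k \<ge> 1" "insert x (set xs) \<subseteq> W k"
      using finite_subset_W[of "insert x (set xs)"] f by auto
    hence "f \<in> spelled (W k)" using f(1) unfolding spelled_def by blast
    thus "f \<in> F" using k F_eq Fs_spelled by auto
  qed
qed

lemma F_PA: "F \<subseteq> PA" using F_spelled spelled_PA by simp

lemma F_carrier: "F \<subseteq> carrier G" using F_PA PA_subset_carrier by blast

lemma Fs_mono: "\<lbrakk>1 \<le> k; k \<le> l\<rbrakk> \<Longrightarrow> Fs k \<subseteq> Fs l"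
  using Fs_spelled spelled_mono[OF W_mono] by simp

text \<open>Split at the first occurrence of \<open>g\<close>: absent, present only as the final
  bare letter, or followed by a further element.\<close>

lemma spelled_cases:
  assumes "f \<in> spelled (insert g T)" "insert g T \<subseteq> Gens"
  obtains "f \<in> spelled (T - {g})"
  | us where "set us \<subseteq> T - {g}" "f = word us \<otimes> g"
  | us u where "set us \<subseteq> T - {g}" "u \<in> spelled (insert g T)" "f = word us \<otimes> g \<otimes> a \<otimes> u"
proof -
  obtain xs x where f: "f = word xs \<otimes> x" "set xs \<subseteq> insert g T" "x \<in> insert g T"
    using assms(1) unfolding spelled_def by blast
  have c: "insert g T \<subseteq> carrier G" using assms(2) Gens_carrier by blast
  show thesis
  proof (cases "g \<in> set xs")
    case True
    then obtain us vs where xs: "xs = us @ g # vs" "g \<notin> set us" by (meson split_list_first)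
    have "set us \<subseteq> carrier G" "set vs \<subseteq> carrier G" "g \<in> carrier G" "x \<in> carrier G" using xs f c by auto
    hence "f = word us \<otimes> g \<otimes> a \<otimes> (word vs \<otimes> x)"
      using a_in unfolding f(1) xs(1) by (simp add: word_append m_assoc)
    moreover have "word vs \<otimes> x \<in> spelled (insert g T)" using xs f unfolding spelled_def by auto
    moreover have "set us \<subseteq> T - {g}" using xs f by auto
    ultimately show thesis using that(3) by blast
  next
    case False
    show thesis
    proof (cases "x = g")
      case True
      thus thesis using that(2)[of xs] f False by auto
    next
      case neq: False
      hence "f \<in> spelled (T - {g})" using f False unfolding spelled_def by blast
      thus thesis using that(1) by blast
    qed
  qed
qed

lemma word_snoc_spelled: "\<lbrakk>set us \<subseteq> T; us \<noteq> []; T \<subseteq> Gens\<rbrakk> \<Longrightarrow> \<exists>w\<in>spelled T. word us = w \<otimes> a"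
proof -
  assume *: "set us \<subseteq> T" "us \<noteq> []" "T \<subseteq> Gens"
  then obtain vs v where us: "us = vs @ [v]" by (metis rev_exhaust)
  have "set vs \<subseteq> carrier G" "v \<in> carrier G" using * us Gens_carrier by auto
  thus ?thesis using us * word_snoc unfolding spelled_def by auto
qed

text \<open>Bounding the number of letters permits induction: what follows the first occurrence of a
  generator is strictly shorter.\<close>

definition spelled_upto :: "nat \<Rightarrow> 'g set \<Rightarrow> 'g set"
  where "spelled_upto n T = {word xs \<otimes> x | xs x. set xs \<subseteq> T \<and> x \<in> T \<and> length xs < n}"

lemma spelled_upto_subset: "spelled_upto n T \<subseteq> spelled T"
  unfolding spelled_def spelled_upto_def by blast

lemma spelled_upto_mono: "m \<le> n \<Longrightarrow> spelled_upto m T \<subseteq> spelled_upto n T"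
  unfolding spelled_upto_def by force

lemma finite_subset_spelled_upto:
  assumes "finite A" "A \<subseteq> spelled T" shows "\<exists>n. A \<subseteq> spelled_upto n T"
  using assms
proof (induction A)
  case (insert f A)
  then obtain n where n: "A \<subseteq> spelled_upto n T" by auto
  obtain xs x where "f = word xs \<otimes> x" "set xs \<subseteq> T" "x \<in> T" using insert.prems unfolding spelled_def by blast
  hence "f \<in> spelled_upto (Suc (length xs)) T" unfolding spelled_upto_def by auto
  thus ?case using n spelled_upto_mono[of n "max n (Suc (length xs))" T]
      spelled_upto_mono[of "Suc (length xs)" "max n (Suc (length xs))" T]
    by (intro exI[of _ "max n (Suc (length xs))"]) auto
qed simp

text \<open>The same split, with empty and nonempty parts in front of \<open>g\<close> kept apart,
  since only a nonempty one has the form \<open>w \<otimes> a\<close> with \<open>w\<close> in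
  \<open>spelled T\<close>.\<close>

lemma spelled_upto_cases:
  assumes "f \<in> spelled_upto (Suc n) (insert g T)" "insert g T \<subseteq> Gens"
  shows "f \<in> spelled T \<union> {g} \<union> (\<lambda>w. w \<otimes> a \<otimes> g) ` spelled T \<union> (\<lambda>u. g \<otimes> a \<otimes> u) ` spelled_upto n (insert g T)
    \<union> (\<lambda>(w, u). w \<otimes> a \<otimes> g \<otimes> a \<otimes> u) ` (spelled T \<times> spelled_upto n (insert g T))"
proof -
  obtain xs x where f: "f = word xs \<otimes> x" "set xs \<subseteq> insert g T" "x \<in> insert g T" "length xs < Suc n"
    using assms(1) unfolding spelled_upto_def by blast
  have c: "insert g T \<subseteq> carrier G" using assms(2) Gens_carrier by blast
  have T: "T \<subseteq> Gens" using assms by simp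
  have gc: "g \<in> carrier G" "x \<in> carrier G" using c f by auto
  show ?thesis
  proof (cases "g \<in> set xs")
    case True
    then obtain us vs where xs: "xs = us @ g # vs" "g \<notin> set us" by (meson split_list_first)
    have cs: "set us \<subseteq> carrier G" "set vs \<subseteq> carrier G" using xs f c by auto
    have e: "f = word us \<otimes> g \<otimes> a \<otimes> (word vs \<otimes> x)"
      using a_in gc cs unfolding f(1) xs(1) by (simp add: word_append m_assoc)
    have u: "word vs \<otimes> x \<in> spelled_upto n (insert g T)"
      unfolding spelled_upto_def mem_Collect_eq using xs f by (intro exI[of _ vs] exI[of _ x]) auto
    show ?thesis
    proof (cases "us = []")
      case True
      hence "f = g \<otimes> a \<otimes> (word vs \<otimes> x)" using e gc by simp
      thus ?thesis using u by blast
    next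
      case False
      then obtain w where w: "w \<in> spelled T" "word us = w \<otimes> a"
        using word_snoc_spelled[OF _ False T] xs f by auto
      have "f = (\<lambda>(w, u). w \<otimes> a \<otimes> g \<otimes> a \<otimes> u) (w, word vs \<otimes> x)" using e w by simp
      thus ?thesis using u w by blast
    qed
  next
    case False
    hence xsT: "set xs \<subseteq> T" using f by auto
    show ?thesis
    proof (cases "x = g")
      case True
      show ?thesis
      proof (cases "xs = []")
        case True
        thus ?thesis using f \<open>x = g\<close> gc by simp
      next
        case False
        then obtain w where "w \<in> spelled T" "word xs = w \<otimes> a"
          using word_snoc_spelled[OF xsT False T] by auto
        hence "f = w \<otimes> a \<otimes> g" using f \<open>x = g\<close> by simp
        thus ?thesis using \<open>w \<in> spelled T\<close> by blast
      qed
    next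
      case neq: False
      hence "f \<in> spelled T" using f xsT unfolding spelled_def by blast
      thus ?thesis by blast
    qed
  qed
qed

text \<open>Since \<open>exp (- \<beta> j * R j)\<close> is at most \<open>eps j j < 1\<close>, the
  exponent must be negative, and \<open>R j\<close> is positive.\<close>

lemma \<beta>_pos: assumes "1 \<le> j" shows "0 < \<beta> j"
proof -
  have "exp (- \<beta> j * R j) \<le> eps j j" "eps j j < 1 / 2" using R_eps[of j j] eps_range[of j j] assms by auto
  hence "exp (- \<beta> j * R j) < 1" by linarith
  hence "0 < \<beta> j * R j" by simp
  thus ?thesis using R_pos[of j] by (simp add: zero_less_mult_iff)
qed

lemma PS_Fs_diag:
  assumes "1 \<le> j" shows "2 ^ j < PS (Fs j) (\<beta> j)"
proof (cases "j = 1")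
  case True
  thus ?thesis using \<beta>_1(3) by simp
next
  case False
  hence "j = (j - 1) + 1" "1 \<le> j - 1" using assms by auto
  thus ?thesis using \<beta>_Suc[of "j - 1"] by simp
qed

text \<open>As \<open>eps k j\<close> is positive, an infinite series would make the left side of
  \<open>eps_M\<close> infinite.\<close>

lemma PS_Fs_finite:
  assumes "1 \<le> j" "j \<le> k" shows "PS (Fs k) (\<beta> j) < \<infinity>"
proof (rule ccontr)
  assume "\<not> ?thesis"
  hence "PS (Fs k) (\<beta> j) = \<infinity>" by (metis infinity_ennreal_def top.not_eq_extremum)
  thus False using eps_M[OF assms] eps_range[OF assms] by (simp add: ennreal_mult_top ennreal_top_mult mult.assoc)
qed

text \<open>Induction on the number of letters: by superadditivity of norms, the five pieces of
  \<open>spelled_upto_cases\<close> contribute at most \<open>m\<close>, \<open>e\<close>,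
  \<open>m * e\<close>, \<open>e * B\<close> and \<open>m * e * B\<close>. Any \<open>B\<close>
  dominating their sum is therefore an invariant bound.\<close>

lemma sum_spelled_upto_le:
  assumes j: "1 \<le> j" "j \<le> k" and m: "m = enn2real (PS (Fs k) (\<beta> j))" "1 \<le> m"
    and e: "e = eps k j" and B: "0 \<le> B" "m + e + m * e + e * B + m * e * B \<le> B"
  shows "\<lbrakk>finite A; A \<subseteq> spelled_upto n (W (Suc k))\<rbrakk> \<Longrightarrow> sum (wt (\<beta> j)) A \<le> B"
proof (induction n arbitrary: A)
  case 0
  thus ?case using B by (simp add: spelled_upto_def)
next
  case (Suc n)
  have k: "k \<ge> 1" using j by simp
  define g where "g = gen k"
  define s where "s = \<beta> j"
  have s: "0 < s" using \<beta>_pos[OF j(1)] by (simp add: s_def)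
  define U where "U = spelled (W k)"
  define V where "V = spelled_upto n (W (Suc k))"
  have WG: "insert g (W k) \<subseteq> Gens" using W_Gens[of "Suc k"] W_Suc[OF k] by (simp add: g_def)
  have gPA: "g \<in> PA" using gen_PA[OF k] by (simp add: g_def)
  have UPA: "U \<subseteq> PA" using spelled_PA[OF W_Gens] by (simp add: U_def)
  have VPA: "V \<subseteq> PA" using spelled_upto_subset spelled_PA[OF W_Gens] unfolding V_def by blast
  \<comment> \<open>Factors of elements of \<open>A\<close> have norm at most \<open>r\<close>, so
    all sums stay finite.\<close>
  define r where "r = Max (insert 0 (nrm ` A))"
  have r: "nrm f \<le> r" if "f \<in> A" for f using Suc.prems(1) that by (simp add: r_def)
  define U' where "U' = {u \<in> U. nrm u \<le> r}"
  define V' where "V' = {u \<in> V. nrm u \<le> r}"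
  have fin: "finite U'" "finite V'"
    using UPA VPA PA_subset_carrier unfolding U'_def V'_def
    by (auto intro!: finite_subset[OF _ finite_norm_ball[of r]])
  \<comment> \<open>The condition \<open>R_eps\<close> was made for this: the new generator has norm
    at least \<open>R k\<close>.\<close>
  have ge: "wt s g \<le> e"
  proof -
    have "R k \<le> nrm g" using nrm_\<psi>[OF k] nrm_gen[OF k] C_large by (simp add: g_def)
    hence "wt s g \<le> exp (- s * R k)" using s by (simp add: mult_left_mono)
    also have "\<dots> \<le> e" using R_eps[OF j] by (simp add: e s_def)
    finally show ?thesis .
  qed
  have e0: "0 \<le> e" using eps_range[OF j] e by simp
  define X1 X2 X3 where "X1 = (\<lambda>w. w \<otimes> a \<otimes> g) ` U'" and "X2 = (\<lambda>u. g \<otimes> a \<otimes> u) ` V'"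
    and "X3 = (\<lambda>(w, u). w \<otimes> a \<otimes> g \<otimes> a \<otimes> u) ` (U' \<times> V')"
  have sub: "A \<subseteq> U' \<union> {g} \<union> X1 \<union> X2 \<union> X3"
  proof
    fix f assume f: "f \<in> A"
    have "f \<in> spelled_upto (Suc n) (insert g (W k))" using Suc.prems(2) f W_Suc[OF k] by (auto simp: g_def)
    from spelled_upto_cases[OF this WG] consider "f \<in> U" | "f = g" | w where "w \<in> U" "f = w \<otimes> a \<otimes> g"
      | u where "u \<in> V" "f = g \<otimes> a \<otimes> u" | w u where "w \<in> U" "u \<in> V" "f = w \<otimes> a \<otimes> g \<otimes> a \<otimes> u"
      using W_Suc[OF k] by (auto simp: U_def V_def g_def)
    thus "f \<in> U' \<union> {g} \<union> X1 \<union> X2 \<union> X3"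
    proof cases
      case 1 thus ?thesis using r[OF f] by (simp add: U'_def)
    next
      case 2 thus ?thesis by simp
    next
      case 3
      have "nrm w \<le> nrm f" using PA_nrm_add[of w g] 3 UPA gPA nrm_nonneg[OF PA_carrier[OF gPA]] by auto
      hence "w \<in> U'" using r[OF f] 3 by (simp add: U'_def)
      thus ?thesis using 3 unfolding X1_def by blast
    next
      case 4
      have "nrm u \<le> nrm f" using PA_nrm_add[of g u] 4 VPA gPA nrm_nonneg[OF PA_carrier[OF gPA]] by auto
      hence "u \<in> V'" using r[OF f] 4 by (simp add: V'_def)
      thus ?thesis using 4 unfolding X2_def by blast
    next
      case 5
      have wu: "w \<in> PA" "u \<in> PA" using 5 UPA VPA by auto
      have "nrm w \<le> nrm f" "nrm u \<le> nrm f"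
        using PA_nrm_add[OF PA_mult[OF wu(1) gPA] wu(2)] PA_nrm_add[OF wu(1) gPA] 5
          nrm_nonneg[OF PA_carrier[OF gPA]] nrm_nonneg[OF PA_carrier[OF wu(1)]] nrm_nonneg[OF PA_carrier[OF wu(2)]]
        unfolding 5(3) by linarith+
      hence "(w, u) \<in> U' \<times> V'" using r[OF f] 5 by (simp add: U'_def V'_def)
      moreover have "f = (\<lambda>(w, u). w \<otimes> a \<otimes> g \<otimes> a \<otimes> u) (w, u)" using 5 by simp
      ultimately show ?thesis unfolding X3_def by blast
    qed
  qed
  have SU: "sum (wt s) U' \<le> m"
    unfolding m(1) s_def
    by (rule sum_le_PS_real[OF PS_Fs_finite[OF j] fin(1)]) (auto simp: U'_def U_def Fs_spelled[OF k])
  have SV: "sum (wt s) V' \<le> B"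
    unfolding s_def by (rule Suc.IH[OF fin(2)]) (auto simp: V'_def V_def)
  have S1: "sum (wt s) X1 \<le> m * e"
    unfolding X1_def
  proof (rule sum_le_of_image[OF fin(1), where g = "\<lambda>w. wt s w * e"])
    fix w assume "w \<in> U'"
    hence "w \<in> PA" using UPA by (auto simp: U'_def)
    hence "wt s (w \<otimes> a \<otimes> g) \<le> wt s w * wt s g" using PA_nrm_add gPA s by (intro wt_le_of_nrm) auto
    also have "\<dots> \<le> wt s w * e" using ge by (intro mult_left_mono) auto
    finally show "wt s (w \<otimes> a \<otimes> g) \<le> wt s w * e" .
  next
    show "(\<Sum>w\<in>U'. wt s w * e) \<le> m * e" using SU e0 by (simp add: mult_right_mono flip: sum_distrib_right)
  qed simp
  have S2: "sum (wt s) X2 \<le> e * B"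
    unfolding X2_def
  proof (rule sum_le_of_image[OF fin(2), where g = "\<lambda>u. e * wt s u"])
    fix u assume "u \<in> V'"
    hence "u \<in> PA" using VPA by (auto simp: V'_def)
    hence "wt s (g \<otimes> a \<otimes> u) \<le> wt s g * wt s u" using PA_nrm_add gPA s by (intro wt_le_of_nrm) auto
    also have "\<dots> \<le> e * wt s u" using ge by (intro mult_right_mono) auto
    finally show "wt s (g \<otimes> a \<otimes> u) \<le> e * wt s u" .
  next
    show "(\<Sum>u\<in>V'. e * wt s u) \<le> e * B" using SV e0 by (simp add: mult_left_mono flip: sum_distrib_left)
  qed simp
  have S3: "sum (wt s) X3 \<le> m * e * B"
    unfolding X3_def
  proof (rule sum_le_of_image[where g = "\<lambda>(w, u). wt s w * e * wt s u"])
    fix y assume "y \<in> U' \<times> V'"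
    then obtain w u where y: "y = (w, u)" "w \<in> PA" "u \<in> PA" using UPA VPA by (auto simp: U'_def V'_def)
    have "wt s (w \<otimes> a \<otimes> g \<otimes> a \<otimes> u) \<le> wt s (w \<otimes> a \<otimes> g) * wt s u"
      using PA_nrm_add[OF PA_mult[OF y(2) gPA] y(3)] s by (intro wt_le_of_nrm) auto
    also have "\<dots> \<le> wt s w * e * wt s u"
    proof (rule mult_right_mono)
      have "wt s (w \<otimes> a \<otimes> g) \<le> wt s w * wt s g" using PA_nrm_add[OF y(2) gPA] s by (intro wt_le_of_nrm) auto
      also have "\<dots> \<le> wt s w * e" using ge by (intro mult_left_mono) auto
      finally show "wt s (w \<otimes> a \<otimes> g) \<le> wt s w * e" .
    qed simp
    finally show "wt s ((\<lambda>(w, u). w \<otimes> a \<otimes> g \<otimes> a \<otimes> u) y) \<le> (\<lambda>(w, u). wt s w * e * wt s u) y"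
      using y by simp
  next
    have "(\<Sum>y\<in>U' \<times> V'. (\<lambda>(w, u). wt s w * e * wt s u) y) = sum (wt s) U' * e * sum (wt s) V'"
    proof -
      have "(\<Sum>y\<in>U' \<times> V'. (\<lambda>(w, u). wt s w * e * wt s u) y) = (\<Sum>w\<in>U'. \<Sum>u\<in>V'. wt s w * e * wt s u)"
        by (rule sum.cartesian_product[symmetric])
      also have "\<dots> = (\<Sum>w\<in>U'. wt s w * e) * sum (wt s) V'" by (simp only: sum_product)
      finally show ?thesis by (simp only: sum_distrib_right)
    qed
    also have "\<dots> \<le> m * e * B"
      using SU SV e0 B m(2) by (intro mult_mono mult_right_mono) (auto intro: sum_nonneg mult_nonneg_nonneg)
    finally show "(\<Sum>y\<in>U' \<times> V'. (\<lambda>(w, u). wt s w * e * wt s u) y) \<le> m * e * B" .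
  qed (use fin in auto)
  have finX: "finite X1" "finite X2" "finite X3" using fin by (auto simp: X1_def X2_def X3_def)
  have "sum (wt s) A \<le> sum (wt s) (U' \<union> {g} \<union> X1 \<union> X2 \<union> X3)"
    using sub fin finX by (intro sum_mono2) auto
  also have "\<dots> \<le> sum (wt s) U' + wt s g + sum (wt s) X1 + sum (wt s) X2 + sum (wt s) X3"
    using sum_Un_le[of "U' \<union> {g} \<union> X1 \<union> X2" X3 "wt s"] sum_Un_le[of "U' \<union> {g} \<union> X1" X2 "wt s"]
      sum_Un_le[of "U' \<union> {g}" X1 "wt s"] sum_Un_le[of "U'" "{g}" "wt s"] fin finX by simp
  also have "\<dots> \<le> m + e + m * e + e * B + m * e * B"
    using SU ge S1 S2 S3 by linarith
  finally show ?case using B by (simp add: s_def)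
qed

text \<open>The quotient of the construction is a bound \<open>B\<close> as required in
  \<open>sum_spelled_upto_le\<close>. It is compared with stage \<open>j\<close> rather than stage
  \<open>k\<close>, so passing through many stages accumulates no factors.\<close>

lemma PS_Fs_Suc:
  assumes j: "1 \<le> j" "j \<le> k"
  shows "PS (Fs (Suc k)) (\<beta> j) \<le> 2 * PS (Fs j) (\<beta> j)"
proof -
  define m where "m = enn2real (PS (Fs k) (\<beta> j))"
  define e where "e = eps k j"
  have mP: "PS (Fs k) (\<beta> j) = ennreal m" using PS_Fs_finite[OF j] by (simp add: m_def)
  have e: "0 < e" "e < 1 / 2" using eps_range[OF j] by (simp_all add: e_def)
  have "1 < PS (Fs k) (\<beta> j)"
  proof -
    have "(1::ennreal) \<le> 2 ^ j" by (simp add: one_le_power)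
    also have "\<dots> < PS (Fs j) (\<beta> j)" by (rule PS_Fs_diag[OF j(1)])
    also have "\<dots> \<le> PS (Fs k) (\<beta> j)" by (rule PS_mono[OF Fs_mono[OF j]])
    finally show ?thesis .
  qed
  hence m1: "1 < m" unfolding mP by (metis ennreal_1 ennreal_less_iff zero_le_one)
  have "2 * ennreal e * ennreal m = ennreal (2 * e * m)"
    using e m1 by (simp add: ennreal_mult' flip: ennreal_numeral)
  hence em: "2 * e * m < 1"
    using eps_M[OF j] e m1 unfolding mP e_def[symmetric] by (metis ennreal_1 ennreal_less_iff mult_nonneg_nonneg less_eq_real_def order_less_trans zero_less_one zero_less_numeral)
  \<comment> \<open>Here \<open>B * (1 - 2 * e * m)\<close> is the numerator; as
    \<open>m > 1\<close>, the term \<open>e * B\<close> is absorbed into a second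
    \<open>m * e * B\<close>.\<close>
  define B where "B = (m + 2 * e + 4 * m * e) / (1 - 2 * e * m)"
  have B0: "0 \<le> B" using e m1 em by (simp add: B_def)
  have Beq: "B * (1 - 2 * e * m) = m + 2 * e + 4 * m * e" using em by (simp add: B_def)
  have "m + e + m * e + e * B + m * e * B \<le> B"
  proof -
    have "1 * (e * B) \<le> m * (e * B)" using m1 e B0 by (intro mult_right_mono) auto
    moreover have "0 \<le> m * e" "0 \<le> e" using m1 e by auto
    ultimately show ?thesis using Beq by (simp add: algebra_simps)
  qed
  from sum_spelled_upto_le[OF j m_def _ e_def B0 this] m1
  have bound: "\<lbrakk>finite A; A \<subseteq> spelled_upto n (W (Suc k))\<rbrakk> \<Longrightarrow> sum (wt (\<beta> j)) A \<le> B" for A n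
    by simp
  have "PS (Fs (Suc k)) (\<beta> j) \<le> ennreal B"
  proof (rule PS_le)
    fix T assume T: "finite T" "T \<subseteq> Fs (Suc k)"
    then obtain n where "T \<subseteq> spelled_upto n (W (Suc k))"
      using finite_subset_spelled_upto[of T "W (Suc k)"] Fs_spelled[of "Suc k"] by auto
    thus "sum (wt (\<beta> j)) T \<le> B" using bound T by blast
  qed
  also have "ennreal B = (PS (Fs k) (\<beta> j) + 2 * ennreal (eps k j) + 4 * PS (Fs k) (\<beta> j) * ennreal (eps k j))
          / (1 - 2 * ennreal (eps k j) * PS (Fs k) (\<beta> j))"
  proof -
    have num: "PS (Fs k) (\<beta> j) + 2 * ennreal (eps k j) + 4 * PS (Fs k) (\<beta> j) * ennreal (eps k j) = ennreal (m + 2 * e + 4 * m * e)"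
      unfolding mP e_def[symmetric] using e m1
      by (simp add: ennreal_plus ennreal_mult' flip: ennreal_numeral)
    have den: "1 - 2 * ennreal (eps k j) * PS (Fs k) (\<beta> j) = ennreal (1 - 2 * e * m)"
      unfolding mP e_def[symmetric] \<open>2 * ennreal e * ennreal m = ennreal (2 * e * m)\<close>
      using e m1 by (simp add: ennreal_minus flip: ennreal_1)
    show ?thesis unfolding num den B_def
      using e m1 em by (intro divide_ennreal[symmetric]) auto
  qed
  also have "\<dots> \<le> ennreal (2 - 1 / 2 ^ (k + 1 - j)) * PS (Fs j) (\<beta> j)"
    using eps_quotient[OF j] by (rule less_imp_le)
  also have "\<dots> \<le> ennreal 2 * PS (Fs j) (\<beta> j)" by (intro mult_right_mono ennreal_leI) auto
  finally show ?thesis by simp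
qed

text \<open>Each finite subset of \<open>F\<close> lies in a single stage, and the bound of
  \<open>PS_Fs_Suc\<close> does not depend on the stage.\<close>

lemma PS_F_\<beta>:
  assumes j: "1 \<le> j" shows "PS F (\<beta> j) \<le> 2 * PS (Fs j) (\<beta> j)" "PS F (\<beta> j) < \<infinity>" "2 ^ j < PS F (\<beta> j)"
proof -
  have step: "PS (Fs k) (\<beta> j) \<le> 2 * PS (Fs j) (\<beta> j)" if "j \<le> k" for k
  proof (cases "k = j")
    case True
    thus ?thesis by (metis mult_2 le_iff_add)
  next
    case False
    hence "k = Suc (k - 1)" "j \<le> k - 1" using that j by auto
    thus ?thesis using PS_Fs_Suc[OF j] by metis
  qed
  show 1: "PS F (\<beta> j) \<le> 2 * PS (Fs j) (\<beta> j)"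
    unfolding PS_SUP[of F]
  proof (rule SUP_least)
    fix T assume T: "T \<in> {T. finite T \<and> T \<subseteq> F}"
    have "\<exists>k\<ge>j. T \<subseteq> Fs k"
    proof -
      have "finite T" "T \<subseteq> F" using T by auto
      thus ?thesis
      proof (induction T)
        case (insert x T)
        then obtain k where k: "k \<ge> j" "T \<subseteq> Fs k" by auto
        obtain l where l: "l \<ge> 1" "x \<in> Fs l" using insert.prems F_eq by auto
        show ?case using k l j Fs_mono[of k "max k l"] Fs_mono[of l "max k l"]
          by (intro exI[of _ "max k l"]) auto
      qed auto
    qed
    then obtain k where "k \<ge> j" "T \<subseteq> Fs k" by blast
    thus "ennreal (sum (wt (\<beta> j)) T) \<le> 2 * PS (Fs j) (\<beta> j)"
      using sum_le_PS[of T "Fs k" "\<beta> j"] T step[of k] by (auto intro: order_trans)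
  qed
  have "2 * PS (Fs j) (\<beta> j) < \<infinity>" using PS_Fs_finite[OF j order_refl] by (simp add: ennreal_mult_less_top)
  thus "PS F (\<beta> j) < \<infinity>" using 1 by simp
  have "Fs j \<subseteq> F" using F_eq j by auto
  thus "2 ^ j < PS F (\<beta> j)" using PS_Fs_diag[OF j] PS_mono by (metis less_le_trans)
qed

section \<open>Divergence at the critical exponent\<close>

abbreviation \<delta> :: real where "\<delta> \<equiv> critical_exponent act x\<^sub>0 F"

lemma gen_in_F: "k \<ge> 1 \<Longrightarrow> gen k \<in> F"
  unfolding F_spelled spelled_def using gen_PA[of k] PA_carrier
  by (auto intro!: exI[of _ "[]"] exI[of _ "gen k"])

lemma infinite_F: "infinite F"
proof
  assume fin: "finite F"
  have lin: "R 0 * real (Suc k) \<le> R (Suc k)" for k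
  proof (induction k)
    case 0
    thus ?case using R_growth[of 1] R_pos[of 0] by simp
  next
    case (Suc k)
    have "R 0 * real (Suc (Suc k)) \<le> 2 * (R 0 * real (Suc k))" using R_pos[of 0] by (simp add: algebra_simps)
    also have "\<dots> \<le> 100 * R (Suc k)" using Suc R_pos[of "Suc k"] by linarith
    also have "\<dots> \<le> R (Suc (Suc k))" using R_growth[of "Suc (Suc k)"] by simp
    finally show ?case .
  qed
  obtain n :: nat where n: "Max (nrm ` F) < real n * R 0" using reals_Archimedean3[OF R_pos[of 0]] by blast
  have "nrm (gen (Suc n)) \<le> Max (nrm ` F)" using fin gen_in_F[of "Suc n"] by simp
  moreover have "R (Suc n) \<le> nrm (gen (Suc n))"
    using nrm_\<psi>[of "Suc n"] nrm_gen[of "Suc n"] C_large by simp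
  moreover have "real n * R 0 \<le> R 0 * real (Suc n)" using R_pos[of 0] by (simp add: algebra_simps)
  ultimately show False using n lin[of n] by linarith
qed

text \<open>Infinitely many terms are at least 1. Hence 0 is a lower bound for the exponents of
  convergence and their \<open>Inf\<close> is meaningful.\<close>

lemma PS_F_nonpos:
  assumes "s \<le> 0" shows "PS F s = \<infinity>"
proof (rule ccontr)
  assume "PS F s \<noteq> \<infinity>"
  hence fin: "PS F s < \<infinity>" by (metis infinity_ennreal_def top.not_eq_extremum)
  obtain n where n: "enn2real (PS F s) < real n" using reals_Archimedean2 by blast
  obtain T where T: "finite T" "card T = n" "T \<subseteq> F" using infinite_F infinite_arbitrarily_large by metis
  have "real n = (\<Sum>g\<in>T. 1)" using T by simp
  also have "\<dots> \<le> sum (wt s) T"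
    using T F_carrier nrm_nonneg assms by (intro sum_mono) (auto simp: mult_nonpos_nonneg subset_iff)
  also have "\<dots> \<le> enn2real (PS F s)" using sum_le_PS_real[OF fin T(1,3)] .
  finally show False using n by simp
qed

lemma \<delta>_facts: "0 \<le> \<delta>" "1 \<le> j \<Longrightarrow> \<delta> < \<beta> j" "\<delta> < s \<Longrightarrow> PS F s < \<infinity>"
proof -
  define X where "X = {s. PS F s < \<infinity>}"
  have \<delta>: "\<delta> = Inf X" by (simp add: critical_exponent_def X_def)
  have pos: "0 < s" if "s \<in> X" for s using that PS_F_nonpos[of s] by (force simp: X_def)
  have ne: "\<beta> j \<in> X" if "1 \<le> j" for j using PS_F_\<beta>(2)[OF that] by (simp add: X_def)
  have bdd: "bdd_below X" using pos by (meson bdd_belowI less_imp_le)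
  show "0 \<le> \<delta>" unfolding \<delta> using ne[of 1] pos by (intro cInf_greatest) (auto intro: less_imp_le)
  show "\<delta> < \<beta> j" if "1 \<le> j"
  proof -
    \<comment> \<open>Passing to the next exponent yields the strict inequality.\<close>
    have "\<delta> \<le> \<beta> (j + 1)" unfolding \<delta> using ne[of "j + 1"] bdd by (intro cInf_lower) auto
    also have "\<dots> < \<beta> j" using \<beta>_Suc[OF that] by simp
    finally show ?thesis .
  qed
  show "PS F s < \<infinity>" if "\<delta> < s"
  proof -
    have "X \<noteq> {}" using ne[of 1] by auto
    moreover have "Inf X < s" using that by (simp add: \<delta>)
    ultimately obtain t where t: "t \<in> X" "t < s" using cInf_lessD by blast
    thus ?thesis using PS_antimono[OF F_carrier, of t s] by (auto simp: X_def intro: le_less_trans)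
  qed
qed

lemma PS_F_pos: "\<delta> < s \<Longrightarrow> 0 < enn2real (PS F s)"
proof -
  assume s: "\<delta> < s"
  have "0 < sum (wt s) {gen 1}" by simp
  also have "\<dots> \<le> enn2real (PS F s)" using gen_in_F[of 1] \<delta>_facts(3)[OF s] by (intro sum_le_PS_real) auto
  finally show ?thesis .
qed

text \<open>Every \<open>\<beta> j\<close> exceeds \<delta> strictly, so \<open>s n\<close>
  eventually drops below it, and monotonicity in the exponent gives a value above
  \<open>2 ^ j\<close>.\<close>

lemma PS_F_at_top:
  assumes "\<And>n. \<delta> < s n" "s \<longlonglongrightarrow> \<delta>"
  shows "filterlim (\<lambda>n. enn2real (PS F (s n))) at_top sequentially"
  unfolding filterlim_at_top
proof
  fix Z :: real
  obtain n :: nat where n: "Z < real n" using reals_Archimedean2 by blast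
  define j where "j = Suc n"
  have "\<forall>\<^sub>F n in sequentially. s n < \<beta> j" using \<delta>_facts(2)[of j] assms(2) by (auto simp: j_def order_tendsto_iff)
  thus "\<forall>\<^sub>F n in sequentially. Z \<le> enn2real (PS F (s n))"
  proof eventually_elim
    case (elim i)
    have "ennreal (2 ^ j) = 2 ^ j" by (metis ennreal_numeral ennreal_power zero_le_numeral)
    also have "\<dots> \<le> PS F (\<beta> j)" using PS_F_\<beta>(3)[of j] by (simp add: j_def)
    also have "\<dots> \<le> PS F (s i)" using elim by (intro PS_antimono F_carrier) simp
    also have "\<dots> = ennreal (enn2real (PS F (s i)))" using \<delta>_facts(3)[OF assms(1)] by simp
    finally have "2 ^ j \<le> enn2real (PS F (s i))" by (simp add: ennreal_le_iff)
    moreover have "real n < 2 ^ j" using less_exp[of n]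
      by (metis j_def less_exp less_trans lessI of_nat_less_iff of_nat_numeral of_nat_power)
    ultimately show ?case using n by linarith
  qed
qed


section \<open>Prefixes in front of the first occurrence of a generator\<close>

definition Pre :: "nat \<Rightarrow> 'g set"
  where "Pre k = {word xs | xs. set xs \<subseteq> Gens - {gen k}}"

abbreviation after :: "nat \<Rightarrow> 'g \<times> 'g \<Rightarrow> 'g"
  where "after k p \<equiv> fst p \<otimes> gen k \<otimes> a \<otimes> snd p"

lemma Pre_carrier: "Pre k \<subseteq> carrier G"
proof
  fix v assume "v \<in> Pre k"
  then obtain xs where "v = word xs" "set xs \<subseteq> carrier G" unfolding Pre_def using Gens_carrier by blast
  thus "v \<in> carrier G" by simp
qed

lemma one_in_Pre: "\<one> \<in> Pre k"
  unfolding Pre_def mem_Collect_eq by (rule exI[of _ "[]"]) simp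

lemma after_carrier: "\<lbrakk>k \<ge> 1; v \<in> Pre k; u \<in> F\<rbrakk> \<Longrightarrow> after k (v, u) \<in> carrier G"
  using Pre_carrier F_carrier gen_in_F a_in by (auto simp: subset_iff)

lemma after_in_F:
  assumes k: "k \<ge> 1" and v: "v \<in> Pre k" and u: "u \<in> F"
  shows "after k (v, u) \<in> F"
proof -
  obtain xs where xs: "v = word xs" "set xs \<subseteq> Gens" using v unfolding Pre_def by blast
  obtain ys y where y: "u = word ys \<otimes> y" "set ys \<subseteq> Gens" "y \<in> Gens"
    using u unfolding F_spelled spelled_def by blast
  have c: "set xs \<subseteq> carrier G" "set ys \<subseteq> carrier G" "y \<in> carrier G" "gen k \<in> carrier G"
    using xs y Gens_carrier gen_Gens[OF k] by blast+
  have "after k (v, u) = word (xs @ gen k # ys) \<otimes> y"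
    using c a_in by (simp add: xs y word_append m_assoc)
  moreover have "set (xs @ gen k # ys) \<subseteq> Gens" using xs y gen_Gens[OF k] by auto
  ultimately show ?thesis unfolding F_spelled spelled_def using y(3) by blast
qed

text \<open>Multiplication by \<open>a\<close> on the right turns both elements into values of
  \<open>word\<close>, to which \<open>first_gen_close\<close> applies.\<close>

lemma after_fibre_close:
  assumes k: "k \<ge> 1" and v: "v \<in> Pre k" "v' \<in> Pre k" and u: "u \<in> F" "u' \<in> F"
    and eq: "after k (v, u) = after k (v', u')"
  shows "hdist (orb v) (orb v') \<le> 14 * C"
proof -
  obtain xs xs' where xs: "v = word xs" "set xs \<subseteq> Gens - {gen k}" "v' = word xs'" "set xs' \<subseteq> Gens - {gen k}"
    using v unfolding Pre_def by blast
  obtain ys y ys' y' where y: "u = word ys \<otimes> y" "set ys \<subseteq> Gens" "y \<in> Gens" "u' = word ys' \<otimes> y'" "set ys' \<subseteq> Gens" "y' \<in> Gens"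
    using u unfolding F_spelled spelled_def by blast
  have w: "word (ls @ gen k # (zs @ [z])) = after k (word ls, word zs \<otimes> z) \<otimes> a"
    if "set ls \<subseteq> Gens" "set zs \<subseteq> Gens" "z \<in> Gens" for ls zs z
  proof -
    have "set ls \<subseteq> carrier G" "set zs \<subseteq> carrier G" "z \<in> carrier G" "gen k \<in> carrier G"
      using that Gens_carrier gen_Gens[OF k] by blast+
    thus ?thesis using a_in by (simp add: word_append m_assoc)
  qed
  have "word (xs @ gen k # (ys @ [y])) = word (xs' @ gen k # (ys' @ [y']))"
    using w[of xs ys y] w[of xs' ys' y'] xs(2,4) y eq by (simp add: xs(1,3) subset_Diff_insert)
  from first_gen_close[OF xs(2,4) _ _ k this] show ?thesis using xs y by simp
qed

lemma nrm_after:
  assumes "k \<ge> 1" "v \<in> Pre k" "u \<in> F"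
  shows "nrm (after k (v, u)) \<le> nrm v + (nrm (gen k) + nrm a) + nrm u"
    "nrm v + nrm u \<le> nrm (after k (v, u))"
    "nrm v \<le> nrm (v \<otimes> gen k) + nrm (gen k)"
proof -
  obtain xs where xs: "v = word xs" "set xs \<subseteq> PA" using assms(2) Gens_PA unfolding Pre_def by blast
  have c: "v \<in> carrier G" "u \<in> carrier G" "gen k \<in> carrier G" "u \<in> PA" "gen k \<in> PA"
    using assms Pre_carrier F_carrier F_PA gen_PA[OF assms(1)] PA_carrier by blast+
  show "nrm (after k (v, u)) \<le> nrm v + (nrm (gen k) + nrm a) + nrm u"
    using nrm_mult[of "v \<otimes> gen k \<otimes> a" u] nrm_mult[of "v \<otimes> gen k" a] nrm_mult[of v "gen k"] c a_in
    by simp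
  have "nrm (v \<otimes> gen k) + nrm a + nrm u - 4 * \<kappa> \<le> nrm (v \<otimes> gen k \<otimes> a \<otimes> u)"
    using PA_nrm_mult[OF word_last_PA[OF xs(2) c(5)] c(4)] xs by simp
  moreover have "nrm v + nrm (gen k) - 2 * \<kappa> \<le> nrm (v \<otimes> gen k)"
    using nrm_word_letter[OF xs(2) c(5)] xs by simp
  ultimately show "nrm v + nrm u \<le> nrm (after k (v, u))"
    using nrm_nonneg[OF c(3)] \<kappa>_bounds C_large nrm_a by simp
  show "nrm v \<le> nrm (v \<otimes> gen k) + nrm (gen k)"
    using nrm_mult[of "v \<otimes> gen k" "inv (gen k)"] c by (simp add: m_assoc nrm_inv)
qed

lemma PS_approx:
  assumes "PS A s < \<infinity>" "0 \<le> x" "x < enn2real (PS A s)"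
  obtains T where "finite T" "T \<subseteq> A" "x < sum (wt s) T"
proof -
  have "ennreal x < PS A s" using assms by (metis ennreal_enn2real ennreal_lessI enn2real_nonneg infinity_ennreal_def le_less_trans)
  then obtain T where "finite T" "T \<subseteq> A" "ennreal x < ennreal (sum (wt s) T)"
    unfolding PS_SUP by (auto simp: less_SUP_iff)
  thus thesis using that assms(2) by (simp add: ennreal_less_iff)
qed

text \<open>
  The products \<open>v gen\<^sub>k a u\<close> have boundedly many preimages \<open>(v, u)\<close>, so the Poincare series of \<open>F\<close>
  dominates the product of those of \<open>Pre k\<close> and \<open>F\<close>.
\<close>
lemma Pre_sum_le:
  assumes k: "k \<ge> 1" and s: "\<delta> < s" and T: "finite T" "T \<subseteq> Pre k"
  shows "sum (wt s) T \<le>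
    2 * real (card {g \<in> carrier G. nrm g \<le> 14 * C}) * exp (s * (nrm (gen k) + nrm a))"
proof -
  define M where "M = card {g \<in> carrier G. nrm g \<le> 14 * C}"
  define c where "c = nrm (gen k) + nrm a"
  define P where "P = enn2real (PS F s)"
  have P: "0 < P" using PS_F_pos[OF s] by (simp add: P_def)
  have s0: "0 \<le> s" using s \<delta>_facts(1) by simp
  \<comment> \<open>A finite set carrying more than half of the series allows \<open>P\<close> to be
    cancelled at the end and explains the factor 2.\<close>
  obtain T2 where T2: "finite T2" "T2 \<subseteq> F" "P / 2 < sum (wt s) T2"
    using PS_approx[OF \<delta>_facts(3)[OF s], of "P / 2"] P by (auto simp: P_def)
  define S where "S = T \<times> T2"
  have S: "finite S" using T T2 by (simp add: S_def)
  have Smem: "fst p \<in> Pre k" "snd p \<in> F" if "p \<in> S" for p using that T T2 by (auto simp: S_def)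
  have fibre: "card {p \<in> S. after k p = f} \<le> M" for f
  proof (cases "{p \<in> S. after k p = f} = {}")
    case False
    then obtain p0 where p0: "p0 \<in> S" "after k p0 = f" by blast
    \<comment> \<open>By cancellation the prefix determines the rest, so a fibre is counted by
      prefixes in one ball of radius \<open>14 * C\<close>.\<close>
    have inj: "inj_on fst {p \<in> S. after k p = f}"
    proof (rule inj_onI)
      fix p q assume pq: "p \<in> {p \<in> S. after k p = f}" "q \<in> {p \<in> S. after k p = f}" "fst p = fst q"
      have "fst p \<otimes> gen k \<otimes> a \<in> carrier G" "snd p \<in> carrier G" "snd q \<in> carrier G"
        using pq Smem Pre_carrier F_carrier gen_in_F[OF k] a_in by blast+
      moreover have "fst p \<otimes> gen k \<otimes> a \<otimes> snd p = fst p \<otimes> gen k \<otimes> a \<otimes> snd q" using pq by simp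
      ultimately have "snd p = snd q" by (simp only: Units_l_cancel Units_eq)
      thus "p = q" using pq(3) by (simp add: prod_eq_iff)
    qed
    have p0c: "fst p0 \<in> carrier G" using Smem(1)[OF p0(1)] Pre_carrier by blast
    have "fst ` {p \<in> S. after k p = f} \<subseteq> {g \<in> carrier G. hdist (orb (fst p0)) (orb g) \<le> 14 * C}"
    proof
      fix v assume "v \<in> fst ` {p \<in> S. after k p = f}"
      then obtain u where p: "(v, u) \<in> S" "after k (v, u) = f" by force
      have "hdist (orb (fst p0)) (orb v) \<le> 14 * C"
        using after_fibre_close[OF k, of "fst p0" v "snd p0" u] Smem[OF p0(1)] Smem[OF p(1)] p p0 by simp
      thus "v \<in> {g \<in> carrier G. hdist (orb (fst p0)) (orb g) \<le> 14 * C}"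
        using Smem(1)[OF p(1)] Pre_carrier by auto
    qed
    hence "card (fst ` {p \<in> S. after k p = f}) \<le> M"
      using card_mono[OF finite_hdist_ball(1)[OF p0c]] finite_hdist_ball(2)[OF p0c] unfolding M_def
      by (meson order_trans)
    thus ?thesis using card_image[OF inj] by simp
  qed (metis card.empty le0)
  have "sum (wt s) T * sum (wt s) T2 * exp (- s * c) = (\<Sum>p\<in>S. wt s (fst p) * wt s (snd p) * exp (- s * c))"
  proof -
    have "sum (wt s) T * sum (wt s) T2 = (\<Sum>p\<in>S. wt s (fst p) * wt s (snd p))"
      unfolding S_def by (simp only: sum_product sum.cartesian_product case_prod_unfold)
    thus ?thesis by (simp only: sum_distrib_right)
  qed
  also have "\<dots> \<le> (\<Sum>p\<in>S. wt s (after k p))"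
  proof (rule sum_mono)
    fix p assume p: "p \<in> S"
    have "nrm (after k p) \<le> nrm (fst p) + c + nrm (snd p)"
      using nrm_after(1)[OF k Smem[OF p]] by (simp add: c_def)
    hence "s * nrm (after k p) \<le> s * (nrm (fst p) + c + nrm (snd p))" using s0 by (intro mult_left_mono) auto
    thus "wt s (fst p) * wt s (snd p) * exp (- s * c) \<le> wt s (after k p)"
      by (simp add: algebra_simps flip: exp_add)
  qed
  also have "\<dots> = (\<Sum>f\<in>after k ` S. \<Sum>p\<in>{p \<in> S. after k p = f}. wt s (after k p))"
    by (rule sum.image_gen[OF S])
  also have "\<dots> = (\<Sum>f\<in>after k ` S. real (card {p \<in> S. after k p = f}) * wt s f)"
    by (intro sum.cong refl) simp
  also have "\<dots> \<le> (\<Sum>f\<in>after k ` S. real M * wt s f)"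
    using fibre by (intro sum_mono mult_right_mono) auto
  also have "\<dots> = real M * sum (wt s) (after k ` S)" by (simp only: sum_distrib_left)
  also have "\<dots> \<le> real M * P"
    unfolding P_def using S after_in_F[OF k Smem]
    by (intro mult_left_mono sum_le_PS_real \<delta>_facts(3)[OF s]) auto
  finally have main: "sum (wt s) T * sum (wt s) T2 * exp (- s * c) \<le> real M * P" .
  have nn: "0 \<le> sum (wt s) T" by (intro sum_nonneg) auto
  have "sum (wt s) T * (P / 2) * exp (- s * c) \<le> sum (wt s) T * sum (wt s) T2 * exp (- s * c)"
    using T2(3) nn by (intro mult_right_mono mult_left_mono) auto
  hence "sum (wt s) T * (P / 2) * exp (- s * c) \<le> real M * P" using main by (rule order_trans)
  moreover have "x * E \<le> 2 * m" if "x * (P / 2) * E \<le> m * P" for x E m :: real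
  proof -
    have "P * (x * E) \<le> P * (2 * m)" using that by (simp add: algebra_simps)
    thus ?thesis using P by simp
  qed
  ultimately have "sum (wt s) T * exp (- s * c) \<le> 2 * real M" by blast
  hence "sum (wt s) T * exp (- s * c) * exp (s * c) \<le> 2 * real M * exp (s * c)" by (intro mult_right_mono) auto
  moreover have "exp (- s * c) * exp (s * c) = 1" by (simp flip: exp_add)
  ultimately show ?thesis unfolding M_def c_def by (simp only: mult.assoc mult_1_right)
qed

text \<open>A finite sum is continuous in the exponent, so the bound for s > \<delta> passes to
  \<delta>; at larger exponents the weights are smaller.\<close>

lemma Pre_sum_bounded:
  assumes k: "k \<ge> 1"
  obtains B where "0 \<le> B" "\<And>s T. \<lbrakk>\<delta> \<le> s; finite T; T \<subseteq> Pre k\<rbrakk> \<Longrightarrow> sum (wt s) T \<le> B"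
proof -
  define c where "c = nrm (gen k) + nrm a"
  define N where "N = 2 * real (card {g \<in> carrier G. nrm g \<le> 14 * C})"
  define B where "B = N * exp (\<delta> * c)"
  have at_\<delta>: "sum (wt \<delta>) T \<le> B" if T: "finite T" "T \<subseteq> Pre k" for T
  proof (rule tendsto_le[of "at_right \<delta>"])
    show "((\<lambda>s. N * exp (s * c)) \<longlongrightarrow> B) (at_right \<delta>)" unfolding B_def by (intro tendsto_intros)
    show "((\<lambda>s. sum (wt s) T) \<longlongrightarrow> sum (wt \<delta>) T) (at_right \<delta>)" by (intro tendsto_intros)
    show "\<forall>\<^sub>F s in at_right \<delta>. sum (wt s) T \<le> N * exp (s * c)"
      using eventually_at_right_less[of \<delta>]
      by eventually_elim (use Pre_sum_le[OF k _ T] in \<open>simp add: N_def c_def\<close>)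
  qed simp
  show thesis
  proof (rule that)
    show "0 \<le> B" by (simp add: B_def N_def)
    show "sum (wt s) T \<le> B" if "\<delta> \<le> s" "finite T" "T \<subseteq> Pre k" for s T
    proof -
      have "sum (wt s) T \<le> sum (wt \<delta>) T" using that Pre_carrier by (intro sum_mono wt_antimono) auto
      thus ?thesis using at_\<delta>[OF that(2,3)] by simp
    qed
  qed
qed

text \<open>The series converges at \<delta>, so \<open>T0\<close> can nearly exhaust it;
  monotonicity makes the tail small for all larger exponents simultaneously.\<close>

lemma Pre_tail:
  assumes k: "k \<ge> 1" and \<eta>: "0 < \<eta>"
  obtains T0 where "finite T0" "T0 \<subseteq> Pre k" "T0 \<noteq> {}"
    "\<And>s T. \<lbrakk>\<delta> \<le> s; finite T; T \<subseteq> Pre k - T0\<rbrakk> \<Longrightarrow> sum (wt s) T \<le> \<eta>"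
proof -
  obtain B where B: "\<And>s T. \<lbrakk>\<delta> \<le> s; finite T; T \<subseteq> Pre k\<rbrakk> \<Longrightarrow> sum (wt s) T \<le> B"
    using Pre_sum_bounded[OF k] by metis
  define Z where "Z = sum (wt \<delta>) ` {T. finite T \<and> T \<subseteq> Pre k}"
  have bdd: "bdd_above Z" unfolding Z_def using B[of \<delta>] by (intro bdd_aboveI[of _ B]) auto
  have "Z \<noteq> {}" unfolding Z_def by auto
  then obtain z where "z \<in> Z" "Sup Z - \<eta> < z" using \<eta> less_cSup_iff[OF _ bdd, of "Sup Z - \<eta>"] by auto
  then obtain T1 where T1: "finite T1" "T1 \<subseteq> Pre k" "Sup Z - \<eta> < sum (wt \<delta>) T1" unfolding Z_def by auto
  \<comment> \<open>Adding \<open>\<one>\<close> keeps \<open>T0\<close> nonempty, so that the later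
    closed set is nonempty and distances to it are meaningful.\<close>
  define T0 where "T0 = insert \<one> T1"
  have T0: "finite T0" "T0 \<subseteq> Pre k" "T0 \<noteq> {}" using T1 one_in_Pre by (auto simp: T0_def)
  have big: "Sup Z - \<eta> < sum (wt \<delta>) T0"
  proof -
    have "sum (wt \<delta>) T1 \<le> sum (wt \<delta>) T0" using T0(1) by (intro sum_mono2) (auto simp: T0_def)
    thus ?thesis using T1(3) by linarith
  qed
  show thesis
  proof (rule that[OF T0])
    fix s T assume s: "\<delta> \<le> s" and T: "finite T" "T \<subseteq> Pre k - T0"
    have "sum (wt s) T \<le> sum (wt \<delta>) T" using s T Pre_carrier by (intro sum_mono wt_antimono) auto
    also have "\<dots> = sum (wt \<delta>) (T0 \<union> T) - sum (wt \<delta>) T0"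
      using T T0 by (subst sum.union_disjoint) auto
    also have "sum (wt \<delta>) (T0 \<union> T) \<le> Sup Z"
      using T T0 by (intro cSup_upper bdd) (auto simp: Z_def)
    finally show "sum (wt s) T \<le> \<eta>" using big by simp
  qed
qed

text \<open>The remaining elements avoid \<open>gen k\<close> (\<open>X1\<close>), have it only as
  the final letter (\<open>X2\<close>), or have a prefix outside \<open>T0\<close>
  (\<open>X3\<close>). The first two are prefixes shifted by a fixed element, hence bounded; only
  the third grows with the series of \<open>F\<close>, with factor \<eta>.\<close>

lemma outside_cylinders_sum:
  assumes k: "k \<ge> 1" and s: "\<delta> < s" and T0: "T0 \<subseteq> Pre k"
    and B: "\<And>T. \<lbrakk>finite T; T \<subseteq> Pre k\<rbrakk> \<Longrightarrow> sum (wt s) T \<le> B"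
    and \<eta>: "0 \<le> \<eta>" "\<And>T. \<lbrakk>finite T; T \<subseteq> Pre k - T0\<rbrakk> \<Longrightarrow> sum (wt s) T \<le> \<eta>"
    and A: "finite A" "A \<subseteq> F - after k ` (T0 \<times> F)"
  shows "sum (wt s) A \<le> (exp (s * nrm a) + exp (s * nrm (gen k))) * B + \<eta> * enn2real (PS F s)"
proof -
  define g where "g = gen k"
  have s0: "0 \<le> s" using s \<delta>_facts(1) by simp
  have gc: "g \<in> carrier G" using gen_PA[OF k] PA_carrier by (simp add: g_def)
  have ins: "insert g Gens = Gens" using gen_Gens[OF k] by (auto simp: g_def)
  \<comment> \<open>Recovering the prefix from \<open>f\<close> costs at most \<open>nrm a\<close>
    in the first case and \<open>nrm g\<close> in the second.\<close>
  define r where "r = Max (insert 0 (nrm ` A)) + nrm a + nrm g"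
  have r: "nrm f + nrm a + nrm g \<le> r" if "f \<in> A" for f using A(1) that by (simp add: r_def)
  define Q where "Q = {v \<in> Pre k. nrm v \<le> r}"
  define F' where "F' = {u \<in> F. nrm u \<le> r}"
  have fin: "finite Q" "finite F'" using Pre_carrier F_carrier unfolding Q_def F'_def
    by (auto intro!: finite_subset[OF _ finite_norm_ball[of r]])
  define X1 X2 X3 where "X1 = (\<lambda>v. v \<otimes> inv a) ` Q" and "X2 = (\<lambda>v. v \<otimes> g) ` Q" and "X3 = after k ` ((Q - T0) \<times> F')"
  have sub: "A \<subseteq> X1 \<union> X2 \<union> X3"
  proof
    fix f assume f: "f \<in> A"
    have fc: "f \<in> carrier G" using f A F_carrier by blast
    have na: "0 \<le> nrm a" "0 \<le> nrm g" using nrm_nonneg a_in gc by auto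
    have "f \<in> spelled (insert g Gens)" using f A F_spelled ins by auto
    hence "(f \<in> spelled (Gens - {g})) \<or> (\<exists>us. set us \<subseteq> Gens - {g} \<and> f = word us \<otimes> g)
      \<or> (\<exists>us u. set us \<subseteq> Gens - {g} \<and> u \<in> F \<and> f = word us \<otimes> g \<otimes> a \<otimes> u)"
      using spelled_cases[of f g Gens] ins F_spelled by (metis subset_refl)
    then consider "f \<in> spelled (Gens - {g})" | us where "set us \<subseteq> Gens - {g}" "f = word us \<otimes> g"
      | us u where "set us \<subseteq> Gens - {g}" "u \<in> F" "f = word us \<otimes> g \<otimes> a \<otimes> u"
      by blast
    thus "f \<in> X1 \<union> X2 \<union> X3"
    proof cases
      case 1
      then obtain xs x where x: "f = word xs \<otimes> x" "set xs \<subseteq> Gens - {g}" "x \<in> Gens - {g}"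
        unfolding spelled_def by blast
      have c: "set xs \<subseteq> carrier G" "x \<in> carrier G" using x Gens_carrier by blast+
      define v where "v = word (xs @ [x])"
      have v: "v = f \<otimes> a" using c by (simp add: v_def x(1) word_snoc)
      have "v \<in> Pre k" unfolding Pre_def v_def using x(2,3) by (auto simp: g_def intro!: exI[of _ "xs @ [x]"])
      moreover have "nrm v \<le> r" using nrm_mult[OF fc a_in] r[OF f] na v by simp
      moreover have "f = v \<otimes> inv a" using v fc a_in by (simp add: m_assoc)
      ultimately show ?thesis unfolding X1_def Q_def by blast
    next
      case 2
      have v: "word us \<in> Pre k" unfolding Pre_def using 2 by (auto simp: g_def)
      have "nrm (word us) \<le> nrm f + nrm g" using nrm_after(3)[OF k v gen_in_F[OF k]] 2 by (simp add: g_def)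
      hence "word us \<in> Q" using r[OF f] na v by (simp add: Q_def)
      thus ?thesis using 2 unfolding X2_def by blast
    next
      case 3
      have v: "word us \<in> Pre k" unfolding Pre_def using 3 by (auto simp: g_def)
      have e: "f = after k (word us, u)" using 3 by (simp add: g_def)
      have vu: "0 \<le> nrm (word us)" "0 \<le> nrm u" using nrm_nonneg v 3 Pre_carrier F_carrier by blast+
      have "nrm (word us) + nrm u \<le> nrm f" using nrm_after(2)[OF k v 3(2)] e by simp
      hence "nrm (word us) \<le> r" "nrm u \<le> r" using r[OF f] na vu by linarith+
      hence "word us \<in> Q" "u \<in> F'" using v 3 by (auto simp: Q_def F'_def)
      moreover have "word us \<notin> T0" using A f e 3 by blast
      ultimately show ?thesis using e unfolding X3_def by blast
    qed
  qed
  have S1: "sum (wt s) X1 \<le> exp (s * nrm a) * B"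
    unfolding X1_def
  proof (rule sum_le_of_image[OF fin(1), where g = "\<lambda>v. exp (s * nrm a) * wt s v"])
    fix v assume "v \<in> Q"
    hence "v \<in> carrier G" using Pre_carrier by (auto simp: Q_def)
    hence "nrm v \<le> nrm (v \<otimes> inv a) + nrm a" using nrm_mult[of "v \<otimes> inv a" a] a_in by (simp add: m_assoc)
    thus "wt s (v \<otimes> inv a) \<le> exp (s * nrm a) * wt s v" using s0 by (rule wt_le_shift)
  next
    show "(\<Sum>v\<in>Q. exp (s * nrm a) * wt s v) \<le> exp (s * nrm a) * B"
      using B[OF fin(1)] unfolding sum_distrib_left[symmetric] by (intro mult_left_mono) (auto simp: Q_def)
  qed simp
  have S2: "sum (wt s) X2 \<le> exp (s * nrm g) * B"
    unfolding X2_def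
  proof (rule sum_le_of_image[OF fin(1), where g = "\<lambda>v. exp (s * nrm g) * wt s v"])
    fix v assume "v \<in> Q"
    hence "nrm v \<le> nrm (v \<otimes> g) + nrm g" using nrm_after(3)[OF k _ gen_in_F[OF k]] by (simp add: g_def Q_def)
    thus "wt s (v \<otimes> g) \<le> exp (s * nrm g) * wt s v" using s0 by (rule wt_le_shift)
  next
    show "(\<Sum>v\<in>Q. exp (s * nrm g) * wt s v) \<le> exp (s * nrm g) * B"
      using B[OF fin(1)] unfolding sum_distrib_left[symmetric] by (intro mult_left_mono) (auto simp: Q_def)
  qed simp
  have S3: "sum (wt s) X3 \<le> \<eta> * enn2real (PS F s)"
    unfolding X3_def
  proof (rule sum_le_of_image[where g = "\<lambda>p. wt s (fst p) * wt s (snd p)"])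
    fix p assume "p \<in> (Q - T0) \<times> F'"
    hence "nrm (fst p) + nrm (snd p) \<le> nrm (after k p)"
      using nrm_after(2)[OF k, of "fst p" "snd p"] by (auto simp: Q_def F'_def)
    thus "wt s (after k p) \<le> wt s (fst p) * wt s (snd p)" using s0 by (rule wt_le_of_nrm)
  next
    have "(\<Sum>p\<in>(Q - T0) \<times> F'. wt s (fst p) * wt s (snd p)) = sum (wt s) (Q - T0) * sum (wt s) F'"
      by (simp only: sum_product sum.cartesian_product case_prod_unfold)
    also have "\<dots> \<le> \<eta> * enn2real (PS F s)"
      using fin \<eta> by (intro mult_mono \<eta>(2) sum_le_PS_real \<delta>_facts(3)[OF s] sum_nonneg) (auto simp: Q_def F'_def)
    finally show "(\<Sum>p\<in>(Q - T0) \<times> F'. wt s (fst p) * wt s (snd p)) \<le> \<eta> * enn2real (PS F s)" .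
  qed (use fin in auto)
  have finX: "finite X1" "finite X2" "finite X3" using fin by (auto simp: X1_def X2_def X3_def)
  have "sum (wt s) A \<le> sum (wt s) (X1 \<union> X2 \<union> X3)" using sub finX by (intro sum_mono2) auto
  also have "\<dots> \<le> sum (wt s) X1 + sum (wt s) X2 + sum (wt s) X3"
    using sum_Un_le[of "X1 \<union> X2" X3 "wt s"] sum_Un_le[of X1 X2 "wt s"] finX by simp
  finally show ?thesis using S1 S2 S3 by (simp add: g_def algebra_simps)
qed

end

section \<open>Patterson--Sullivan measures\<close>

lemma nn_integral_count_space_le:
  fixes f :: "'b \<Rightarrow> ennreal"
  assumes A: "countable A" and B: "\<And>T. \<lbrakk>finite T; T \<subseteq> A\<rbrakk> \<Longrightarrow> sum f T \<le> B"
  shows "(\<integral>\<^sup>+x. f x \<partial>count_space A) \<le> B"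
proof (cases "finite A")
  case True
  thus ?thesis using B by (simp add: nn_integral_count_space_finite)
next
  case False
  note bij = bij_betw_from_nat_into[OF A False]
  have "(\<integral>\<^sup>+x. f x \<partial>count_space A) = (\<Sum>n. f (from_nat_into A n))"
    using nn_integral_bij_count_space[OF bij, of f] by (simp add: nn_integral_count_space_nat)
  also have "\<dots> \<le> B"
  proof (rule suminf_le_const)
    fix n
    have "(\<Sum>i<n. f (from_nat_into A i)) = sum f (from_nat_into A ` {..<n})"
      using bij by (subst sum.reindex) (auto simp: bij_betw_def intro: inj_on_subset)
    also have "\<dots> \<le> B" using bij by (intro B) (auto simp: bij_betw_def)
    finally show "(\<Sum>i<n. f (from_nat_into A i)) \<le> B" .
  qed simp
  finally show ?thesis .
qed

context F_construction
begin

lemma countable_carrier: "countable (carrier G)"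
  unfolding enumeration[symmetric] by (intro countable_image countableI_type)

lemma approximating_integral_le:
  assumes s: "\<delta> < s" and f: "continuous_on (orbit_compactification G act x\<^sub>0) f"
    and f01: "\<And>x. 0 \<le> f x" "\<And>x. f x \<le> 1" and f0: "\<And>x. x \<in> V \<Longrightarrow> f x = 0"
    and d: "\<And>T. \<lbrakk>finite T; T \<subseteq> {g \<in> F. orb g \<notin> V}\<rbrakk> \<Longrightarrow> sum (wt s) T \<le> d"
  shows "integral\<^sup>L (approximating_measure G act x\<^sub>0 F s) f \<le> d / enn2real (PS F s)"
proof -
  define N where "N = restrict_space borel (orbit_compactification G act x\<^sub>0)"
  define P where "P = enn2real (PS F s)"
  have P: "0 < P" "PS F s = ennreal P" using PS_F_pos[OF s] \<delta>_facts(3)[OF s] by (simp_all add: P_def)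
  define w where "w g = ennreal (exp (- s * nrm g)) / PS F s" for g
  have w: "w g = ennreal (wt s g / P)" for g using P by (simp add: w_def divide_ennreal)
  have orbN: "orb \<in> F \<rightarrow> space N" using F_carrier by (auto simp: N_def space_restrict_space orbit_compactification_def orbit_def)
  have fN: "f \<in> borel_measurable N"
    unfolding N_def by (rule borel_measurable_continuous_on_restrict[OF f])
  have cF: "countable F" using countable_subset[OF F_carrier countable_carrier] .
  have d0: "0 \<le> d" using d[of "{}"] by simp
  have "(\<integral>\<^sup>+x. ennreal (f x) \<partial>approximating_measure G act x\<^sub>0 F s) = (\<integral>\<^sup>+g. ennreal (f (orb g)) \<partial>point_measure F w)"
    unfolding approximating_measure_def N_def[symmetric] w_def[symmetric]
    using orbN fN by (intro nn_integral_distr) auto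
  also have "\<dots> = (\<integral>\<^sup>+g. w g * ennreal (f (orb g)) \<partial>count_space F)"
    unfolding point_measure_def by (intro nn_integral_density) auto
  also have "\<dots> \<le> ennreal (d / P)"
  proof (rule nn_integral_count_space_le[OF cF])
    fix T assume T: "finite T" "T \<subseteq> F"
    define T' where "T' = {g \<in> T. orb g \<notin> V}"
    have "(\<Sum>g\<in>T. w g * ennreal (f (orb g))) = (\<Sum>g\<in>T'. w g * ennreal (f (orb g)))"
      using T f0 by (intro sum.mono_neutral_right) (auto simp: T'_def)
    also have "\<dots> \<le> (\<Sum>g\<in>T'. w g)"
    proof (rule sum_mono)
      fix g
      have "ennreal (f (orb g)) \<le> 1" using f01(2)[of "orb g"] by (simp add: ennreal_le_1)
      thus "w g * ennreal (f (orb g)) \<le> w g" using mult_left_mono[of "ennreal (f (orb g))" 1 "w g"] by simp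
    qed
    also have "\<dots> = ennreal (\<Sum>g\<in>T'. wt s g / P)" unfolding w using P by (intro sum_ennreal) auto
    also have "\<dots> \<le> ennreal (d / P)"
    proof (rule ennreal_leI)
      have "T' \<subseteq> {g \<in> F. orb g \<notin> V}" "finite T'" using T by (auto simp: T'_def)
      hence "sum (wt s) T' / P \<le> d / P" using d[of T'] P(1) by (intro divide_right_mono) auto
      thus "(\<Sum>g\<in>T'. wt s g / P) \<le> d / P" by (simp only: sum_divide_distrib)
    qed
    finally show "(\<Sum>g\<in>T. w g * ennreal (f (orb g))) \<le> ennreal (d / P)" .
  qed
  finally have "(\<integral>\<^sup>+x. ennreal (f x) \<partial>approximating_measure G act x\<^sub>0 F s) \<le> ennreal (d / P)" .
  moreover have "f \<in> borel_measurable (approximating_measure G act x\<^sub>0 F s)"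
    using fN by (simp add: approximating_measure_def N_def)
  hence "integral\<^sup>L (approximating_measure G act x\<^sub>0 F s) f = enn2real (\<integral>\<^sup>+x. ennreal (f x) \<partial>approximating_measure G act x\<^sub>0 F s)"
    using f01(1) by (intro integral_eq_nn_integral) auto
  ultimately show ?thesis using d0 P(1) unfolding P_def[symmetric]
    by (metis divide_nonneg_pos enn2real_leI)
qed

text \<open>Since weak convergence sees only continuous functions, the indicator of the complement
  is approximated from below by truncated multiples of the distance to \<open>V\<close>. The
  constant \<open>c\<close> disappears because the series of \<open>F\<close> tends to
  infinity.\<close>

lemma PS_measure_complement_le:
  assumes \<mu>: "patterson_sullivan_measure G act x\<^sub>0 F \<mu>" and V: "closed V" "V \<noteq> {}" and \<eta>: "0 \<le> \<eta>"
    and b: "\<And>s T. \<lbrakk>\<delta> < s; s \<le> \<delta> + 1; finite T; T \<subseteq> {g \<in> F. orb g \<notin> V}\<rbrakk> \<Longrightarrow> sum (wt s) T \<le> c + \<eta> * enn2real (PS F s)"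
  shows "emeasure \<mu> (space \<mu> - V) \<le> ennreal \<eta>"
proof -
  define X where "X = orbit_compactification G act x\<^sub>0"
  have sets: "sets \<mu> = sets (restrict_space borel X)" and one: "emeasure \<mu> (space \<mu>) = 1"
    using \<mu> by (auto simp: patterson_sullivan_measure_def X_def)
  interpret finite_measure \<mu> using one by (intro finite_measureI) simp
  have spX: "space \<mu> = X" using sets_eq_imp_space_eq[OF sets] by (simp add: space_restrict_space)
  obtain s where s: "\<And>n. \<delta> < s n" "s \<longlonglongrightarrow> \<delta>"
    "\<And>f :: 'a \<Rightarrow> real. continuous_on X f \<Longrightarrow>
      (\<lambda>n. integral\<^sup>L (approximating_measure G act x\<^sub>0 F (s n)) f) \<longlonglongrightarrow> integral\<^sup>L \<mu> f"
    using \<mu> unfolding patterson_sullivan_measure_def X_def by blast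
  define f where "f m x = min 1 (real m * infdist x V)" for m and x :: 'a
  have fc: "continuous_on X (f m)" for m unfolding f_def by (intro continuous_intros)
  have f01: "0 \<le> f m x" "f m x \<le> 1" for m x by (auto simp: f_def infdist_nonneg)
  have fV: "f m x = 0" if "x \<in> V" for m x using that by (simp add: f_def)
  have int_f: "integral\<^sup>L \<mu> (f m) \<le> \<eta>" for m
  proof (rule LIMSEQ_le[OF s(3)[OF fc]])
    have "(\<lambda>n. c / enn2real (PS F (s n))) \<longlonglongrightarrow> 0"
      by (rule real_tendsto_divide_at_top[OF tendsto_const PS_F_at_top[OF s(1,2)]])
    from tendsto_add[OF this tendsto_const[of \<eta>]]
    show "(\<lambda>n. c / enn2real (PS F (s n)) + \<eta>) \<longlonglongrightarrow> \<eta>" by simp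
    have "\<forall>\<^sub>F n in sequentially. s n < \<delta> + 1" using s(2) by (auto simp: order_tendsto_iff)
    hence "\<forall>\<^sub>F n in sequentially. integral\<^sup>L (approximating_measure G act x\<^sub>0 F (s n)) (f m) \<le> c / enn2real (PS F (s n)) + \<eta>"
    proof eventually_elim
      case (elim n)
      have "integral\<^sup>L (approximating_measure G act x\<^sub>0 F (s n)) (f m) \<le> (c + \<eta> * enn2real (PS F (s n))) / enn2real (PS F (s n))"
        using b[OF s(1)[of n]] elim f01 fV fc[unfolded X_def]
        by (intro approximating_integral_le[OF s(1), where V = V]) auto
      also have "\<dots> = c / enn2real (PS F (s n)) + \<eta>" using PS_F_pos[OF s(1)[of n]] by (simp add: add_divide_distrib)
      finally show ?case .
    qed
    thus "\<exists>N. \<forall>n\<ge>N. integral\<^sup>L (approximating_measure G act x\<^sub>0 F (s n)) (f m) \<le> c / enn2real (PS F (s n)) + \<eta>"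
      by (simp add: eventually_sequentially)
  qed
  have fm: "f m \<in> borel_measurable \<mu>" for m
    using borel_measurable_continuous_on_restrict[OF fc] measurable_cong_sets[OF sets refl] by blast
  have XV: "X - V \<in> sets \<mu>"
  proof -
    have "X - V = X \<inter> (- V)" by blast
    moreover have "- V \<in> sets borel" using V by (intro borel_open) (simp add: open_Compl)
    ultimately show ?thesis unfolding sets sets_restrict_space by blast
  qed
  have "(\<lambda>m. integral\<^sup>L \<mu> (f m)) \<longlonglongrightarrow> integral\<^sup>L \<mu> (indicator (X - V))"
  proof (rule integral_dominated_convergence[where w = "\<lambda>_. 1"])
    show "AE x in \<mu>. (\<lambda>m. f m x) \<longlonglongrightarrow> indicator (X - V) x"
    proof (rule AE_I2)
      fix x assume x: "x \<in> space \<mu>"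
      show "(\<lambda>m. f m x) \<longlonglongrightarrow> indicator (X - V) x"
      proof (cases "x \<in> V")
        case True thus ?thesis by (simp add: fV)
      next
        case False
        hence d: "0 < infdist x V" using V by (simp add: infdist_pos_not_in_closed)
        obtain N :: nat where N: "1 < real N * infdist x V" using reals_Archimedean3[OF d] by blast
        have "f m x = 1" if "N \<le> m" for m
        proof -
          have "real N * infdist x V \<le> real m * infdist x V" using that d by (intro mult_right_mono) auto
          thus ?thesis using N by (simp add: f_def)
        qed
        hence "\<forall>\<^sub>F m in sequentially. f m x = 1" by (auto simp: eventually_sequentially)
        thus ?thesis using False x spX by (simp add: tendsto_eventually)
      qed
    qed
  qed (use fm f01 XV in auto)
  hence "integral\<^sup>L \<mu> (indicator (X - V)) \<le> \<eta>" using int_f by (meson LIMSEQ_le_const2)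
  hence "measure \<mu> (X - V) \<le> \<eta>" using XV spX by (simp add: Int_absorb2)
  thus ?thesis by (simp add: spX emeasure_eq_measure ennreal_leI)
qed

text \<open>The closure is Euclidean, so it contains the boundary points approached while the prefix
  \<open>v\<close> stays fixed and the continuation varies.\<close>

definition cylinder :: "nat \<Rightarrow> 'g \<Rightarrow> 'a set"
  where "cylinder k v = closure (orb ` after k ` ({v} \<times> F))"

text \<open>Finitely many cylinders form a closed set and already carry all but \<eta> of the mass;
  \<eta> is arbitrary, so the countable union has full measure.\<close>

lemma AE_cylinder:
  assumes \<mu>: "patterson_sullivan_measure G act x\<^sub>0 F \<mu>" and k: "k \<ge> 1"
  shows "AE \<xi> in \<mu>. \<exists>v\<in>Pre k. \<xi> \<in> cylinder k v"
proof -
  define U where "U = (\<Union>v\<in>Pre k. cylinder k v)"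
  have sets: "sets \<mu> = sets (restrict_space borel (orbit_compactification G act x\<^sub>0))"
    using \<mu> by (auto simp: patterson_sullivan_measure_def)
  have spX: "space \<mu> = orbit_compactification G act x\<^sub>0"
    using sets_eq_imp_space_eq[OF sets] by (simp add: space_restrict_space)
  have meas: "space \<mu> - V \<in> sets \<mu>" if "V \<in> sets borel" for V
  proof -
    have "space \<mu> - V = space \<mu> \<inter> (- V)" by blast
    moreover have "- V \<in> sets borel" using that by (rule borel_comp)
    ultimately show ?thesis unfolding sets sets_restrict_space spX by blast
  qed
  have "countable (Pre k)" using countable_subset[OF Pre_carrier countable_carrier] .
  hence Ub: "U \<in> sets borel" unfolding U_def cylinder_def by (intro sets.countable_UN') auto
  have le: "emeasure \<mu> (space \<mu> - U) \<le> ennreal \<eta>" if \<eta>: "0 < \<eta>" for \<eta>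
  proof -
    obtain B where B: "0 \<le> B" "\<And>s T. \<lbrakk>\<delta> \<le> s; finite T; T \<subseteq> Pre k\<rbrakk> \<Longrightarrow> sum (wt s) T \<le> B"
      using Pre_sum_bounded[OF k] by metis
    obtain T0 where T0: "finite T0" "T0 \<subseteq> Pre k" "T0 \<noteq> {}"
      "\<And>s T. \<lbrakk>\<delta> \<le> s; finite T; T \<subseteq> Pre k - T0\<rbrakk> \<Longrightarrow> sum (wt s) T \<le> \<eta>"
      using Pre_tail[OF k \<eta>] by metis
    define V where "V = (\<Union>v\<in>T0. cylinder k v)"
    \<comment> \<open>Restricting to \<open>s \<le> \<delta> + 1\<close> makes this bound
      independent of \<open>s\<close>.\<close>
    define c where "c = (exp ((\<delta> + 1) * nrm a) + exp ((\<delta> + 1) * nrm (gen k))) * B"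
    have Vc: "closed V" unfolding V_def cylinder_def using T0(1) by (intro closed_UN) auto
    have orbV: "orb (after k (v, u)) \<in> V" if "v \<in> T0" "u \<in> F" for v u
    proof -
      have "orb (after k (v, u)) \<in> cylinder k v"
        unfolding cylinder_def by (rule subsetD[OF closure_subset]) (use that in blast)
      thus ?thesis using that by (auto simp: V_def)
    qed
    have Vne: "V \<noteq> {}" using orbV T0(3) gen_in_F[of 1] by fastforce
    have "emeasure \<mu> (space \<mu> - V) \<le> ennreal \<eta>"
    proof (rule PS_measure_complement_le[OF \<mu> Vc Vne, where c = c])
      show "0 \<le> \<eta>" using \<eta> by simp
      fix s T assume s: "\<delta> < s" "s \<le> \<delta> + 1" and T: "finite T" "T \<subseteq> {g \<in> F. orb g \<notin> V}"
      have "T \<subseteq> F - after k ` (T0 \<times> F)" using T(2) orbV by fastforce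
      hence "sum (wt s) T \<le> (exp (s * nrm a) + exp (s * nrm (gen k))) * B + \<eta> * enn2real (PS F s)"
        using B(2)[of s] T0(4)[of s] \<eta> s T(1) by (intro outside_cylinders_sum[OF k s(1) T0(2)]) auto
      also have "(exp (s * nrm a) + exp (s * nrm (gen k))) * B \<le> c"
        unfolding c_def using s B(1) nrm_nonneg[OF a_in] nrm_nonneg[OF PA_carrier[OF gen_PA[OF k]]]
        by (intro mult_right_mono add_mono) (auto intro!: mult_right_mono)
      finally show "sum (wt s) T \<le> c + \<eta> * enn2real (PS F s)" by simp
    qed
    moreover have "space \<mu> - U \<subseteq> space \<mu> - V" using T0(2) by (auto simp: U_def V_def)
    hence "emeasure \<mu> (space \<mu> - U) \<le> emeasure \<mu> (space \<mu> - V)"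
      using meas[of V] Vc by (intro emeasure_mono) auto
    ultimately show ?thesis by simp
  qed
  have "emeasure \<mu> (space \<mu> - U) \<le> 0"
    by (rule ennreal_le_epsilon) (use le in simp)
  hence "space \<mu> - U \<in> null_sets \<mu>" using meas[OF Ub] by auto
  thus ?thesis by (rule AE_I') (auto simp: U_def)
qed

lemma limit_set_F_subset: "limit_set act x\<^sub>0 F \<subseteq> limit_set act x\<^sub>0 (carrier G)"
  unfolding limit_set_def using islimpt_subset[OF _ image_mono[OF F_carrier]] by blast

text \<open>There is one null set for each generator, hence countably many. For given
  \<open>g\<close>, the cylinder of a suitable \<open>k\<close> fixes the prefix and with it the
  translate, and \<open>near_ray_of_closure\<close> carries nearness over to the ray.\<close>

lemma AE_myrberg:
  assumes \<mu>: "patterson_sullivan_measure G act x\<^sub>0 F \<mu>"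
  shows "AE \<xi> in \<mu>. \<xi> \<in> limit_set act x\<^sub>0 F \<longrightarrow> myrberg G act x\<^sub>0 \<xi> \<and>
    (\<forall>g\<in>carrier G. \<exists>h\<in>carrier G. act h ` geodesic_segment x\<^sub>0 (orb g) \<subseteq> hnbhd (13 * C) (geodesic_ray x\<^sub>0 \<xi>))"
proof -
  have "AE \<xi> in \<mu>. \<forall>k. 1 \<le> k \<longrightarrow> (\<exists>v\<in>Pre k. \<xi> \<in> cylinder k v)"
    unfolding AE_all_countable using AE_cylinder[OF \<mu>] by (auto intro: AE_I2)
  thus ?thesis
  proof eventually_elim
    case (elim \<xi>)
    show ?case
    proof
      assume \<xi>: "\<xi> \<in> limit_set act x\<^sub>0 F"
      hence \<xi>b: "\<xi> \<in> hboundary" by (simp add: limit_set_def)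
      have cover: "\<exists>h\<in>carrier G. act h ` geodesic_segment x\<^sub>0 (orb g) \<subseteq> hnbhd (13 * C) (geodesic_ray x\<^sub>0 \<xi>)"
        if g: "g \<in> carrier G" for g
      proof -
        obtain k where k: "k \<ge> 1"
          "\<And>us. set us \<subseteq> Gens \<Longrightarrow> \<exists>h\<in>carrier G. \<forall>u\<in>PA. \<forall>z\<in>act h ` closed_segment x\<^sub>0 (orb g).
             \<exists>y\<in>closed_segment x\<^sub>0 (orb (word us \<otimes> gen k \<otimes> a \<otimes> u)). hdist z y \<le> 3 * C"
          using gen_contains_translate[OF g] by metis
        obtain v where v: "v \<in> Pre k" "\<xi> \<in> cylinder k v" using elim k(1) by blast
        obtain us where us: "v = word us" "set us \<subseteq> Gens" using v(1) unfolding Pre_def by blast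
        obtain h where h: "h \<in> carrier G"
          "\<And>u z. \<lbrakk>u \<in> PA; z \<in> act h ` closed_segment x\<^sub>0 (orb g)\<rbrakk> \<Longrightarrow>
             \<exists>y\<in>closed_segment x\<^sub>0 (orb (word us \<otimes> gen k \<otimes> a \<otimes> u)). hdist z y \<le> 3 * C"
          using k(2)[OF us(2)] by blast
        have "act h ` geodesic_segment x\<^sub>0 (orb g) \<subseteq> hnbhd (13 * C) (geodesic_ray x\<^sub>0 \<xi>)"
        proof
          fix z assume "z \<in> act h ` geodesic_segment x\<^sub>0 (orb g)"
          hence z: "z \<in> act h ` closed_segment x\<^sub>0 (orb g)" by (simp add: geodesic_segment_def)
          have zh: "z \<in> hspace"
            using z h(1) closed_segment_additive(1)[OF base_point orb_in[OF g]] by auto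
          have "\<exists>y\<in>geodesic_ray x\<^sub>0 \<xi>. hdist z y \<le> 3 * C"
          proof (rule near_ray_of_closure[OF base_point v(2)[unfolded cylinder_def] \<xi>b zh])
            show "orb ` after k ` ({v} \<times> F) \<subseteq> hspace" using after_carrier[OF k(1) v(1)] by auto
            fix w assume "w \<in> orb ` after k ` ({v} \<times> F)"
            then obtain u where "u \<in> F" "w = orb (word us \<otimes> gen k \<otimes> a \<otimes> u)" using us by auto
            thus "\<exists>y\<in>closed_segment x\<^sub>0 w. hdist z y \<le> 3 * C" using h(2)[OF _ z] F_PA by blast
          qed
          \<comment> \<open>The distance \<open>3 * C\<close> lies well within the required strict
            bound.\<close>
          then obtain y where "y \<in> geodesic_ray x\<^sub>0 \<xi>" "hdist z y < 13 * C" using C_large by force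
          thus "z \<in> hnbhd (13 * C) (geodesic_ray x\<^sub>0 \<xi>)" using zh unfolding hnbhd_def by blast
        qed
        thus ?thesis using h(1) by blast
      qed
      have "myrberg G act x\<^sub>0 \<xi>"
        by (rule myrberg_criterion[OF subsetD[OF limit_set_F_subset \<xi>] cover])
      thus "myrberg G act x\<^sub>0 \<xi> \<and> (\<forall>g\<in>carrier G. \<exists>h\<in>carrier G. act h ` geodesic_segment x\<^sub>0 (orb g) \<subseteq> hnbhd (13 * C) (geodesic_ray x\<^sub>0 \<xi>))"
        using cover by (intro conjI ballI)
    qed
  qed
qed

end

theorem corollary5p8:
  fixes G :: "('g, 'm) monoid_scheme"
    and act :: "'g \<Rightarrow> 'a::euclidean_space \<Rightarrow> 'a" and x\<^sub>0 :: 'a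
    and gam :: "nat \<Rightarrow> 'g" and a b :: 'g and C :: real and \<Phi> :: "'g \<Rightarrow> 'g"
    and \<epsilon> r\<^sub>0 :: real and R :: "nat \<Rightarrow> real" and K :: "'g set" and \<beta> :: "nat \<Rightarrow> real"
    and eps :: "nat \<Rightarrow> nat \<Rightarrow> real" and \<phi> gen :: "nat \<Rightarrow> 'g"
    and Fs :: "nat \<Rightarrow> 'g set" and F :: "'g set" and \<mu> :: "'a measure"
  assumes "F_construction G act x\<^sub>0 gam a b C \<Phi> \<epsilon> r\<^sub>0 R K \<beta> eps \<phi> gen Fs F"
    and "patterson_sullivan_measure G act x\<^sub>0 F \<mu>"
  shows "AE \<xi> in \<mu>. \<xi> \<in> limit_set act x\<^sub>0 F \<longrightarrow>
    myrberg G act x\<^sub>0 \<xi> \<and>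
    (\<forall>g\<in>carrier G. \<exists>h\<in>carrier G.
       act h ` geodesic_segment x\<^sub>0 (act g x\<^sub>0) \<subseteq> hnbhd (13 * C) (geodesic_ray x\<^sub>0 \<xi>))"
proof -
  interpret F_construction G act x\<^sub>0 gam a b C \<Phi> \<epsilon> r\<^sub>0 R K \<beta> eps \<phi> gen Fs F
    by (rule assms(1))
  show ?thesis by (rule AE_myrberg[OF assms(2)])
qed

end
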